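(* Let $S$ be a nice hole with integral vertex coordinates, given as a doubly-linked list of its vertices in boundary order together with pointers to its unique leftmost edge, its unique rightmost edge and its falling corner (if one exists), and let $r_{new}=(w,h)$ be a rectangle with positive integers $w,h$. Then the set of all feasible BL-stable locations for placing $r_{new}$ within $S$ can be computed in $O(nv(S))$ time.
   Context: A hole is a set $H=J\cup I$ where $J$ is a closed rectilinear arc (a closed Jordan curve that is a finite union of axis-parallel segments) and $I$ its bounded inner region; $nv(H)$ is its number of vertices. Edges are the maximal straight segments of $J$, vertices the points where two edges meet. Clockwise traversal of $J$ labels edges leftward/rightward/upward/downward by traversal direction. For a vertical edge $e$ whose two adjacent horizontal edges both extend to the left of $e$: $e$ is a rightmost edge if the interior of $H$ near $e$ lies to its left, a left notch if to its right. For a vertical edge whose two adjacent horizontal edges both extend to the right: it is a leftmost edge if the interior lies to its right, a right notch if to its left. A horizontal edge whose two adjacent vertical edges extend above it is a top notch if the interior near it lies below it. A falling corner is a vertex whose clockwise-preceding edge is downward and clockwise-succeeding edge rightward. A BLS-hole is a hole with no right notch, no top notch and at most one falling corner; a nice hole is a BLS-hole with no left notch. A point $p=(p_1,p_2)$ is a feasible location for $(w,h)$ within $S$ if $[p_1,p_1+w]\times[p_2,p_2+h]\subseteq S$; it is a feasible BL-stable location if moreover there is $\varepsilon>0$ such that for every $t\in(0,\varepsilon)$ neither $(p_1-t,p_2)$ nor $(p_1,p_2-t)$ is a feasible location within $S$. *)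

theory Defs
  imports "HOL-Analysis.Analysis"
begin

section \<open>Holes\<close>

type_synonym pt = "real \<times> real"

definition closed_rectilinear_arc :: "pt set \<Rightarrow> bool" where
  "closed_rectilinear_arc J \<longleftrightarrow>
     (\<exists>g. simple_path g \<and> pathfinish g = pathstart g \<and> path_image g = J) \<and>
     (\<exists>F. finite F \<and> J = \<Union>F \<and>
        (\<forall>s\<in>F. \<exists>a b. s = closed_segment a b \<and> (fst a = fst b \<or> snd a = snd b)))"

definition hole :: "pt set \<Rightarrow> pt set \<Rightarrow> bool" where
  "hole J H \<longleftrightarrow> closed_rectilinear_arc J \<and> H = J \<union> inside J"

definition edges :: "pt set \<Rightarrow> pt set set" where
  "edges J = {e. (\<exists>a b. a \<noteq> b \<and> e = closed_segment a b) \<and> e \<subseteq> J \<and>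
     (\<forall>c d. e \<subseteq> closed_segment c d \<and> closed_segment c d \<subseteq> J \<longrightarrow> closed_segment c d = e)}"

definition vertices :: "pt set \<Rightarrow> pt set" where
  "vertices J = {v. \<exists>e\<in>edges J. \<exists>f\<in>edges J. e \<noteq> f \<and> v \<in> e \<and> v \<in> f}"

definition nv :: "pt set \<Rightarrow> nat" where
  "nv J = card (vertices J)"

text \<open>Below, an edge is given by its two end points; \<open>is_edge\<close> is symmetric in them.\<close>

definition is_edge :: "pt set \<Rightarrow> pt \<Rightarrow> pt \<Rightarrow> bool" where
  "is_edge J a b \<longleftrightarrow> a \<noteq> b \<and> closed_segment a b \<in> edges J"

definition vertical_edge :: "pt set \<Rightarrow> pt \<Rightarrow> pt \<Rightarrow> bool" where
  "vertical_edge J a b \<longleftrightarrow> is_edge J a b \<and> fst a = fst b"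

definition horizontal_edge :: "pt set \<Rightarrow> pt \<Rightarrow> pt \<Rightarrow> bool" where
  "horizontal_edge J a b \<longleftrightarrow> is_edge J a b \<and> snd a = snd b"

abbreviation (input) leftwards :: pt where "leftwards \<equiv> (-1, 0)"
abbreviation (input) rightwards :: pt where "rightwards \<equiv> (1, 0)"
abbreviation (input) upwards :: pt where "upwards \<equiv> (0, 1)"
abbreviation (input) downwards :: pt where "downwards \<equiv> (0, -1)"

text \<open>The inner region near the edge \<open>a b\<close> lies on the side to which the vector \<open>d\<close> points.\<close>

definition interior_towards :: "pt set \<Rightarrow> pt \<Rightarrow> pt \<Rightarrow> pt \<Rightarrow> bool" where
  "interior_towards J a b d \<longleftrightarrow>
     (\<exists>\<epsilon>>0. \<forall>p\<in>open_segment a b. \<forall>t. 0 < t \<and> t < \<epsilon> \<longrightarrow> p + t *\<^sub>R d \<in> inside J)"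

text \<open>Both edges adjacent to the edge \<open>a b\<close> leave it in direction \<open>d\<close>.\<close>

definition neighbours_extend :: "pt set \<Rightarrow> pt \<Rightarrow> pt \<Rightarrow> pt \<Rightarrow> bool" where
  "neighbours_extend J a b d \<longleftrightarrow>
     (\<exists>s>0. is_edge J a (a + s *\<^sub>R d)) \<and> (\<exists>s>0. is_edge J b (b + s *\<^sub>R d))"

definition rightmost_edge :: "pt set \<Rightarrow> pt \<Rightarrow> pt \<Rightarrow> bool" where
  "rightmost_edge J a b \<longleftrightarrow> vertical_edge J a b \<and>
     neighbours_extend J a b leftwards \<and> interior_towards J a b leftwards"

definition left_notch :: "pt set \<Rightarrow> pt \<Rightarrow> pt \<Rightarrow> bool" where
  "left_notch J a b \<longleftrightarrow> vertical_edge J a b \<and>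
     neighbours_extend J a b leftwards \<and> interior_towards J a b rightwards"

definition leftmost_edge :: "pt set \<Rightarrow> pt \<Rightarrow> pt \<Rightarrow> bool" where
  "leftmost_edge J a b \<longleftrightarrow> vertical_edge J a b \<and>
     neighbours_extend J a b rightwards \<and> interior_towards J a b rightwards"

definition right_notch :: "pt set \<Rightarrow> pt \<Rightarrow> pt \<Rightarrow> bool" where
  "right_notch J a b \<longleftrightarrow> vertical_edge J a b \<and>
     neighbours_extend J a b rightwards \<and> interior_towards J a b leftwards"

definition top_notch :: "pt set \<Rightarrow> pt \<Rightarrow> pt \<Rightarrow> bool" where
  "top_notch J a b \<longleftrightarrow> horizontal_edge J a b \<and>
     neighbours_extend J a b upwards \<and> interior_towards J a b downwards"

text \<open>The clockwise traversal passes the edge from \<open>a\<close> to \<open>b\<close>, that is, it has the inner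
  region on its right-hand side; \<open>(y, -x)\<close> is the vector \<open>(x, y)\<close> turned to the right.\<close>

definition clockwise_edge :: "pt set \<Rightarrow> pt \<Rightarrow> pt \<Rightarrow> bool" where
  "clockwise_edge J a b \<longleftrightarrow> is_edge J a b \<and>
     interior_towards J a b (snd (b - a), - fst (b - a))"

definition downward_edge :: "pt set \<Rightarrow> pt \<Rightarrow> pt \<Rightarrow> bool" where
  "downward_edge J a b \<longleftrightarrow> clockwise_edge J a b \<and> fst a = fst b \<and> snd b < snd a"

definition rightward_edge :: "pt set \<Rightarrow> pt \<Rightarrow> pt \<Rightarrow> bool" where
  "rightward_edge J a b \<longleftrightarrow> clockwise_edge J a b \<and> snd a = snd b \<and> fst a < fst b"

definition falling_corner :: "pt set \<Rightarrow> pt \<Rightarrow> bool" where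
  "falling_corner J v \<longleftrightarrow> (\<exists>a b. downward_edge J a v \<and> rightward_edge J v b)"

definition BLS_hole :: "pt set \<Rightarrow> pt set \<Rightarrow> bool" where
  "BLS_hole J H \<longleftrightarrow> hole J H \<and>
     (\<nexists>a b. right_notch J a b) \<and> (\<nexists>a b. top_notch J a b) \<and>
     (\<forall>u v. falling_corner J u \<and> falling_corner J v \<longrightarrow> u = v)"

definition nice_hole :: "pt set \<Rightarrow> pt set \<Rightarrow> bool" where
  "nice_hole J H \<longleftrightarrow> BLS_hole J H \<and> (\<nexists>a b. left_notch J a b)"

definition integral_vertices :: "pt set \<Rightarrow> bool" where
  "integral_vertices J \<longleftrightarrow> (\<forall>v\<in>vertices J. fst v \<in> \<int> \<and> snd v \<in> \<int>)"

section \<open>Placements\<close>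

definition feasible :: "pt set \<Rightarrow> real \<Rightarrow> real \<Rightarrow> pt \<Rightarrow> bool" where
  "feasible S w h p \<longleftrightarrow> {fst p .. fst p + w} \<times> {snd p .. snd p + h} \<subseteq> S"

definition BL_stable :: "pt set \<Rightarrow> real \<Rightarrow> real \<Rightarrow> pt \<Rightarrow> bool" where
  "BL_stable S w h p \<longleftrightarrow> feasible S w h p \<and>
     (\<exists>\<epsilon>>0. \<forall>t. 0 < t \<and> t < \<epsilon> \<longrightarrow>
        \<not> feasible S w h (fst p - t, snd p) \<and> \<not> feasible S w h (fst p, snd p - t))"

section \<open>Machine model\<close>

text \<open>A random access machine with structured control flow. Registers and memory cells hold
  integers; addition, subtraction, comparison, register and memory access take unit time. There
  is deliberately no multiplication, division or bit operation, which would make unit-cost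
  arithmetic on unbounded integers unrealistically powerful.\<close>

datatype aexp =
    Const int
  | Reg nat
  | Mem aexp
  | Plus aexp aexp
  | Minus aexp aexp

datatype bexp =
    Less aexp aexp
  | Neg bexp
  | And bexp bexp

datatype com =
    Skip
  | Assign nat aexp
  | Store aexp aexp
  | Seq com com
  | Cond bexp com com
  | While bexp com

type_synonym state = "(nat \<Rightarrow> int) \<times> (int \<Rightarrow> int)"

fun aval :: "aexp \<Rightarrow> state \<Rightarrow> int" where
  "aval (Const c) s = c"
| "aval (Reg r) s = fst s r"
| "aval (Mem a) s = snd s (aval a s)"
| "aval (Plus a b) s = aval a s + aval b s"
| "aval (Minus a b) s = aval a s - aval b s"

fun bval :: "bexp \<Rightarrow> state \<Rightarrow> bool" where
  "bval (Less a b) s \<longleftrightarrow> aval a s < aval b s"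
| "bval (Neg b) s \<longleftrightarrow> \<not> bval b s"
| "bval (And b c) s \<longleftrightarrow> bval b s \<and> bval c s"

fun acost :: "aexp \<Rightarrow> nat" where
  "acost (Const c) = 1"
| "acost (Reg r) = 1"
| "acost (Mem a) = acost a + 1"
| "acost (Plus a b) = acost a + acost b + 1"
| "acost (Minus a b) = acost a + acost b + 1"

fun bcost :: "bexp \<Rightarrow> nat" where
  "bcost (Less a b) = acost a + acost b + 1"
| "bcost (Neg b) = bcost b + 1"
| "bcost (And b c) = bcost b + bcost c + 1"

text \<open>\<open>exec c s t s'\<close>: started in state \<open>s\<close>, program \<open>c\<close> halts in state \<open>s'\<close> after time \<open>t\<close>.\<close>

inductive exec :: "com \<Rightarrow> state \<Rightarrow> nat \<Rightarrow> state \<Rightarrow> bool" where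
  Skip: "exec Skip s 1 s"
| Assign: "exec (Assign r a) s (acost a + 1) ((fst s)(r := aval a s), snd s)"
| Store: "exec (Store a b) s (acost a + acost b + 1) (fst s, (snd s)(aval a s := aval b s))"
| Seq: "exec c s t s' \<Longrightarrow> exec d s' u s'' \<Longrightarrow> exec (Seq c d) s (t + u) s''"
| CondTrue: "bval b s \<Longrightarrow> exec c s t s' \<Longrightarrow> exec (Cond b c d) s (bcost b + 1 + t) s'"
| CondFalse: "\<not> bval b s \<Longrightarrow> exec d s t s' \<Longrightarrow> exec (Cond b c d) s (bcost b + 1 + t) s'"
| WhileFalse: "\<not> bval b s \<Longrightarrow> exec (While b c) s (bcost b + 1) s"
| WhileTrue: "bval b s \<Longrightarrow> exec c s t s' \<Longrightarrow> exec (While b c) s' u s'' \<Longrightarrow>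
    exec (While b c) s (bcost b + 1 + t + u) s''"

inductive_cases exec_elims:
  "exec Skip s t s'" "exec (Assign r a) s t s'" "exec (Store a b) s t s'"
  "exec (Seq c d) s t s'" "exec (Cond b c d) s t s'" "exec (While b c) s t s'"

lemma exec_deterministic:
  "exec c s t s' \<Longrightarrow> exec c s u s'' \<Longrightarrow> t = u \<and> s' = s''"
proof (induction arbitrary: u s'' rule: exec.induct)
  case (Seq c s t s' d t' s1)
  from Seq.prems show ?case
    by (rule exec_elims(4)) (metis Seq.IH)
next
  case (CondTrue b s c t s' d)
  from CondTrue.prems show ?case
    by (rule exec_elims(5)) (use CondTrue.hyps in \<open>auto dest: CondTrue.IH\<close>)
next
  case (CondFalse b s d t s' c)
  from CondFalse.prems show ?case
    by (rule exec_elims(5)) (use CondFalse.hyps in \<open>auto dest: CondFalse.IH\<close>)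
next
  case (WhileFalse b s c)
  from WhileFalse.prems show ?case
    by (rule exec_elims(6)) (simp_all add: WhileFalse.hyps)
next
  case (WhileTrue b s c t s' t' s1)
  obtain v s2 v' where 2: "exec c s v s2" "exec (While b c) s2 v' s''" "u = bcost b + 1 + v + v'"
    using WhileTrue.prems WhileTrue.hyps(1) by (auto elim: exec_elims(6))
  then have "t = v" "s' = s2" using WhileTrue.IH(1) by blast+
  then show ?case using WhileTrue.IH(2)[of v' s''] 2 by simp
qed (auto elim: exec_elims)

section \<open>Input and output format\<close>

text \<open>Either orientation of the boundary is allowed.\<close>

definition boundary_order :: "pt set \<Rightarrow> pt list \<Rightarrow> bool" where
  "boundary_order J vs \<longleftrightarrow> distinct vs \<and> set vs = vertices J \<and>
     edges J = {closed_segment (vs ! i) (vs ! (Suc i mod length vs)) | i. i < length vs}"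

text \<open>The circular doubly-linked list \<open>vs\<close> is stored in memory \<open>m\<close>: the node of \<open>vs ! i\<close> occupies
  the four cells from address \<open>ad ! i\<close> on, which hold the two coordinates and the addresses of the
  successor and predecessor nodes. Nodes do not overlap and may be scattered arbitrarily over the
  addresses from 1 up to, but excluding, \<open>fr\<close>. Address 0 serves as null pointer.\<close>

definition stored_list :: "(int \<Rightarrow> int) \<Rightarrow> pt list \<Rightarrow> int list \<Rightarrow> int \<Rightarrow> bool" where
  "stored_list m vs ad fr \<longleftrightarrow> length ad = length vs \<and>
     (\<forall>i<length vs.
        1 \<le> ad ! i \<and> ad ! i + 4 \<le> fr \<and>
        (of_int (m (ad ! i)), of_int (m (ad ! i + 1))) = vs ! i \<and>
        m (ad ! i + 2) = ad ! (Suc i mod length vs) \<and>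
        m (ad ! i + 3) = ad ! ((i + length vs - 1) mod length vs)) \<and>
     (\<forall>i<length vs. \<forall>j<length vs. i \<noteq> j \<longrightarrow> 4 \<le> \<bar>ad ! i - ad ! j\<bar>)"

text \<open>A pointer to an edge is the address of the node of its first end point in list order.
  Registers 0, 1 and 2 point to the leftmost edge, the rightmost edge and the falling corner,
  registers 3 and 4 hold the size of the rectangle, and the cells from the address in register 5
  on are available as working space. All other registers and cells have arbitrary contents.\<close>

definition placement_input :: "pt set \<Rightarrow> int \<Rightarrow> int \<Rightarrow> state \<Rightarrow> bool" where
  "placement_input J w h s \<longleftrightarrow>
     (\<exists>vs ad. boundary_order J vs \<and> stored_list (snd s) vs ad (fst s 5) \<and>
        (\<exists>i<length vs. fst s 0 = ad ! i \<and> leftmost_edge J (vs ! i) (vs ! (Suc i mod length vs))) \<and>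
        (\<exists>i<length vs. fst s 1 = ad ! i \<and> rightmost_edge J (vs ! i) (vs ! (Suc i mod length vs))) \<and>
        (if \<exists>v. falling_corner J v
         then \<exists>i<length vs. fst s 2 = ad ! i \<and> falling_corner J (vs ! i)
         else fst s 2 = 0) \<and>
        fst s 3 = w \<and> fst s 4 = h)"

text \<open>The set \<open>X\<close> is output as a repetition-free array of coordinate pairs; register 0 holds its
  address and register 1 the number of pairs.\<close>

definition output_set :: "state \<Rightarrow> pt set \<Rightarrow> bool" where
  "output_set s X \<longleftrightarrow>
     (\<exists>ps. distinct ps \<and> set ps = X \<and> fst s 1 = int (length ps) \<and>
        (\<forall>i<length ps. ps ! i =
           (of_int (snd s (fst s 0 + 2 * int i)), of_int (snd s (fst s 0 + 2 * int i + 1)))))"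

end

theory Submission imports Defs begin

text \<open>Because the vertices are integral, a nice hole is a union of closed unit cells, and a unit
  segment lies on the boundary iff exactly one of its two neighbouring cells belongs to the hole:
  by the Jordan curve theorem the curve is the frontier of its inside and of its outside. A column
  run with two neighbouring runs on the same side would produce a left or right notch; as the inside
  is connected, every column is therefore an interval, and the hole lies between a lower and an upper
  staircase over \<open>{a..b}\<close>.

  Cut the hole vertically at every step of either staircase, giving pieces
  \<open>{X k..X (k + 1)} \<times> {L k..U k}\<close>. A rectangle that cannot be moved left rests with its left
  side at some \<open>X k\<close>, and one that cannot be moved down rests on the maximum of \<open>L\<close> over the pieces
  below it, so there is at most one stable location for each \<open>k\<close>. The program merges the two
  boundary chains, starting at the leftmost edge, into the list of pieces, links each piece to the
  next one with a greater value of \<open>L\<close> (and of \<open>-U\<close>), and then slides a window of width \<open>w\<close>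
  over the pieces. The position of the maximum over the window only moves right along these links,
  so that the total work is linear.\<close>

section \<open>Rectilinear Jordan curves on the integer grid\<close>

text \<open>Edges and notches are defined topologically, by maximal segments of a curve and points
  of its inside. The bridge to integers is the finite set \<open>C\<close> of unit cells contained
  in \<open>inside J\<close>: it determines which unit segments lie on \<open>J\<close>, so edges
  and notches become patterns of cells. Cells serve the geometry only. Their columns may be far more
  numerous than the vertices, so the program works on pieces. The ends of the pieces are abscissas
  of vertices and pairwise different, hence \<open>m + 1 \<le> nv J\<close>. The orientation of the
  stored list is unknown. The program detects it by comparing the heights of the two ends of the
  leftmost edge; from there on, each chain is followed correctly because one of the two list
  neighbours of a node is the node just left. Upper values are stored negated, so that the minimum
  of \<open>U\<close> over a window is found by the code for the maximum of \<open>L\<close>. The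
  four phases take at most \<open>70 * m + 60\<close>, twice \<open>70 * m + 20\<close>, and
  \<open>210 * m + 40\<close> steps, which together is at most \<open>420 * (m + 1)\<close>; this is
  the origin of the constant 420.\<close>

lemma Jordan_inside_outside_prod:
  fixes g :: "real \<Rightarrow> real \<times> real"
  assumes "simple_path g" "pathfinish g = pathstart g"
  defines "J \<equiv> path_image g"
  shows "inside J \<noteq> {}" "open (inside J)" "connected (inside J)" "bounded (inside J)"
    "frontier (inside J) = J" "frontier (outside J) = J"
proof -
  \<comment> \<open>The Jordan curve theorem is applied over \<open>complex\<close>; the linear
    bijection \<open>f'\<close> carries openness, connectedness, boundedness and frontiers back to
    the real plane.\<close>
  define f :: "real \<times> real \<Rightarrow> complex" where "f = (\<lambda>p. Complex (fst p) (snd p))"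
  define f' :: "complex \<Rightarrow> real \<times> real" where "f' = (\<lambda>z. (Re z, Im z))"
  have ff: "f (f' z) = z" "f' (f p) = p" for z p by (auto simp: f_def f'_def)
  have linf: "linear f" by (auto simp: f_def intro!: linearI simp: complex_eq_iff)
  have linf': "linear f'" by (auto simp: f'_def intro!: linearI)
  have injf: "inj f" and bijf': "bij f'" by (metis injI ff, metis bijI' ff)
  have injf': "inj f'" and surjf': "surj f'" using bijf' by (auto simp: bij_def)
  define c where "c = f \<circ> g"
  have c1: "simple_path c" unfolding c_def
    using simple_path_linear_image_eq[OF linf injf] assms by simp
  have c2: "pathfinish c = pathstart c" using assms by (simp add: c_def pathfinish_def pathstart_def)
  have Jc: "f' ` path_image c = J" unfolding c_def J_def path_image_compose image_image ff by simp
  obtain inn out where *: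
     "inn \<noteq> {}" "open inn" "connected inn" "out \<noteq> {}" "open out" "connected out"
     "bounded inn" "\<not> bounded out" "inn \<inter> out = {}" "inn \<union> out = - path_image c"
     "frontier inn = path_image c" "frontier out = path_image c"
    by (rule Jordan_curve[OF c1 c2])
  define I where "I = f' ` inn"
  define O' where "O' = f' ` out"
  have oI: "open I" and oO: "open O'" unfolding I_def O'_def
    using open_surjective_linear_image[OF _ linf' surjf'] * by auto
  have cI: "connected I" "connected O'" unfolding I_def O'_def
    using connected_linear_image[OF linf'] * by (auto simp: linear_conv_bounded_linear)
  have bI: "bounded I" "\<not> bounded O'" unfolding I_def O'_def
    using bounded_linear_image[of _ f'] bounded_linear_image[of "f' ` out" f] * linf linf'
    by (auto simp: linear_conv_bounded_linear image_image ff)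
  have fr: "frontier (f' ` X) = f' ` frontier X" if "open X" "open (f' ` X)" for X
    using that closure_injective_linear_image[OF linf' injf', of X]
    by (simp add: frontier_def interior_open image_set_diff[OF injf'])
  have fI: "frontier I = J" "frontier O' = J"
    using fr[of inn] fr[of out] oI oO * Jc by (auto simp: I_def O'_def)
  have U: "I \<union> O' = - J" "I \<inter> O' = {}"
    using * Jc bijf' unfolding I_def O'_def
    by (metis bij_image_Compl_eq image_Un, metis image_Int injf' image_empty)
  \<comment> \<open>One inclusion holds because \<open>I\<close> is bounded and open with frontier
    \<open>J\<close>, the other because its complement in \<open>- J\<close> is connected and
    unbounded.\<close>
  have inner: "inside J = I"
    by (metis fI(1) bI(1) oI cI dual_order.antisym inside_subset interior_eq interior_inside_frontier U bI(2))
  have outer: "outside J = O'"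
    using outside_inside[of J] U inner by auto
  show "inside J \<noteq> {}" "open (inside J)" "connected (inside J)" "bounded (inside J)"
    "frontier (inside J) = J" "frontier (outside J) = J"
    using inner outer oI cI bI fI * by (auto simp: I_def)
qed


lemma closed_segment_vertical:
  "closed_segment (x, y1) (x, y2) = {x} \<times> closed_segment y1 y2" for x y1 y2 :: real
proof -
  have e: "(1 - u) * x + u * x = x" for u by (simp add: algebra_simps)
  show ?thesis by (auto simp: in_segment e)
qed

lemma closed_segment_horizontal:
  "closed_segment (x1, y) (x2, y) = closed_segment x1 x2 \<times> {y}" for x1 x2 y :: real
proof -
  have e: "(1 - u) * y + u * y = y" for u by (simp add: algebra_simps)
  show ?thesis by (auto simp: in_segment e)
qed

text \<open>Two different points fix the line of the segment. This shows that any segment extending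
  a vertical one is itself vertical.\<close>

lemma closed_segment_same_fst:
  assumes "(x, y1) \<in> closed_segment c d" "(x, y2) \<in> closed_segment c d" "y1 \<noteq> (y2::real)"
  shows "fst c = x" "fst d = (x::real)"
proof -
  obtain u where u: "(x, y1) = (1 - u) *\<^sub>R c + u *\<^sub>R d" using assms(1) by (auto simp: in_segment)
  obtain v where v: "(x, y2) = (1 - v) *\<^sub>R c + v *\<^sub>R d" using assms(2) by (auto simp: in_segment)
  have "u \<noteq> v" using u v assms(3) by (metis prod.inject)
  have 1: "x = (1 - u) * fst c + u * fst d" using arg_cong[OF u, of fst] by simp
  have 2: "x = (1 - v) * fst c + v * fst d" using arg_cong[OF v, of fst] by simp
  have "(u - v) * (fst d - fst c) = 0" using 1 2 by (simp add: algebra_simps)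
  then have "fst d = fst c" using \<open>u \<noteq> v\<close> by simp
  then show "fst c = x" "fst d = x" using 1 by (auto simp: algebra_simps)
qed

lemma closed_segment_same_snd:
  assumes "(x1, y) \<in> closed_segment c d" "(x2, y) \<in> closed_segment c d" "x1 \<noteq> (x2::real)"
  shows "snd c = y" "snd d = (y::real)"
proof -
  obtain u where u: "(x1, y) = (1 - u) *\<^sub>R c + u *\<^sub>R d" using assms(1) by (auto simp: in_segment)
  obtain v where v: "(x2, y) = (1 - v) *\<^sub>R c + v *\<^sub>R d" using assms(2) by (auto simp: in_segment)
  have "u \<noteq> v" using u v assms(3) by (metis prod.inject)
  have 1: "y = (1 - u) * snd c + u * snd d" using arg_cong[OF u, of snd] by simp
  have 2: "y = (1 - v) * snd c + v * snd d" using arg_cong[OF v, of snd] by simp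
  have "(u - v) * (snd d - snd c) = 0" using 1 2 by (simp add: algebra_simps)
  then have "snd d = snd c" using \<open>u \<noteq> v\<close> by simp
  then show "snd c = y" "snd d = y" using 1 by (auto simp: algebra_simps)
qed

section \<open>Unit segments and unit cells of the grid\<close>

definition hseg :: "int \<Rightarrow> int \<Rightarrow> pt set" where
  "hseg i j = {of_int i..of_int i + 1} \<times> {of_int j}"

definition vseg :: "int \<Rightarrow> int \<Rightarrow> pt set" where
  "vseg i j = {of_int i} \<times> {of_int j..of_int j + 1}"

definition cell :: "int \<Rightarrow> int \<Rightarrow> pt set" where
  "cell i j = {of_int i<..<of_int i + 1} \<times> {of_int j<..<of_int j + 1}"

definition ccell :: "int \<Rightarrow> int \<Rightarrow> pt set" where
  "ccell i j = {of_int i..of_int i + 1} \<times> {of_int j..of_int j + 1}"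

lemma between_ints_unique:
  assumes "of_int i < (x::real)" "x < of_int i + 1" "of_int k \<le> x" "x \<le> of_int k + 1"
  shows "k = i"
  using assms by linarith

text \<open>The interface between topology and combinatorics: the consequences of the Jordan curve
  theorem, together with the fact that the curve is made of whole unit grid segments.\<close>

locale grid_curve =
  fixes J :: "pt set"
  assumes inside_ne: "inside J \<noteq> {}" and open_in: "open (inside J)"
    and conn_in: "connected (inside J)" and bdd_in: "bounded (inside J)"
    and fr_in: "frontier (inside J) = J" and fr_out: "frontier (outside J) = J"
    and grid: "p \<in> J \<Longrightarrow> \<exists>i j. p \<in> hseg i j \<and> hseg i j \<subseteq> J \<or> p \<in> vseg i j \<and> vseg i j \<subseteq> J"
begin

definition C :: "(int \<times> int) set" where
  "C = {(i, j). cell i j \<subseteq> inside J}"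

text \<open>A point strictly between the ends of a unit segment lies on no other unit segment, so
  the one provided by \<open>grid\<close> must be this one.\<close>

lemma hseg_subsetI:
  assumes "(x, of_int j) \<in> J" "of_int i < x" "x < of_int i + 1"
  shows "hseg i j \<subseteq> J"
proof -
  obtain k l where "(x, of_int j) \<in> hseg k l \<and> hseg k l \<subseteq> J \<or> (x, of_int j) \<in> vseg k l \<and> vseg k l \<subseteq> J"
    using grid assms(1) by blast
  then show ?thesis
  proof
    assume "(x, of_int j) \<in> hseg k l \<and> hseg k l \<subseteq> J"
    moreover from this have "k = i" "l = j"
      using between_ints_unique[OF assms(2,3), of k] by (auto simp: hseg_def)
    ultimately show ?thesis by simp
  qed (use assms(2,3) in \<open>auto simp: vseg_def\<close>)
qed

lemma vseg_subsetI:
  assumes "(of_int i, y) \<in> J" "of_int j < y" "y < of_int j + 1"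
  shows "vseg i j \<subseteq> J"
proof -
  obtain k l where "(of_int i, y) \<in> hseg k l \<and> hseg k l \<subseteq> J \<or> (of_int i, y) \<in> vseg k l \<and> vseg k l \<subseteq> J"
    using grid assms(1) by blast
  then show ?thesis
  proof
    assume "(of_int i, y) \<in> vseg k l \<and> vseg k l \<subseteq> J"
    moreover from this have "k = i" "l = j"
      using between_ints_unique[OF assms(2,3), of l] by (auto simp: vseg_def)
    ultimately show ?thesis by simp
  qed (use assms(2,3) in \<open>auto simp: hseg_def\<close>)
qed

lemma cell_disjoint: "cell i j \<inter> J = {}"
proof -
  have False if "p \<in> cell i j" "p \<in> J" for p
  proof -
    obtain k l where "p \<in> hseg k l \<or> p \<in> vseg k l" using grid[OF \<open>p \<in> J\<close>] by blast
    with that(1) show False by (auto simp: cell_def hseg_def vseg_def)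
  qed
  then show ?thesis by blast
qed

lemma connected_subset_inside:
  assumes "connected T" "T \<inter> J = {}" "T \<inter> inside J \<noteq> {}"
  shows "T \<subseteq> inside J"
  using connected_Int_frontier[OF assms(1,3)] assms(2) fr_in by blast

lemma connected_cell: "connected (cell i j)"
  by (auto simp: cell_def intro!: convex_connected convex_Times)

lemma cell_meets_inside: "p \<in> cell i j \<Longrightarrow> p \<in> inside J \<Longrightarrow> (i, j) \<in> C"
  using connected_subset_inside[OF connected_cell cell_disjoint] by (auto simp: C_def)

lemma cell_meets_outside: "p \<in> cell i j \<Longrightarrow> p \<in> outside J \<Longrightarrow> (i, j) \<notin> C"
  using inside_Int_outside[of J] unfolding C_def by blast

lemma C_cell: "(i, j) \<in> C \<Longrightarrow> p \<in> cell i j \<Longrightarrow> p \<in> inside J"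
  by (auto simp: C_def)

lemma cell_ne: "(of_int i + 1/2, of_int j + 1/2) \<in> cell i j"
  by (auto simp: cell_def)

lemma near_inside: "p \<in> J \<Longrightarrow> e > 0 \<Longrightarrow> \<exists>q. q \<in> inside J \<and> dist q p < e"
  using fr_in by (metis closure_approachable frontier_def DiffD1)

lemma near_outside: "p \<in> J \<Longrightarrow> e > 0 \<Longrightarrow> \<exists>q. q \<in> outside J \<and> dist q p < e"
  using fr_out by (metis closure_approachable frontier_def DiffD1)

text \<open>Near the midpoint of a segment of \<open>J\<close> there are inside and outside points,
  and within distance 1/2 every point off \<open>J\<close> lies in one of the two adjacent cells,
  each of which is entirely inside or contains no inside point. Conversely, if the segment is not on
  \<open>J\<close>, then its interior misses \<open>J\<close> and joins the two cells to a connected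
  set.\<close>

lemma hseg_iff: "hseg i j \<subseteq> J \<longleftrightarrow> ((i, j) \<in> C) \<noteq> ((i, j - 1) \<in> C)"
proof
  assume sub: "hseg i j \<subseteq> J"
  define p :: pt where "p = (of_int i + 1/2, of_int j)"
  have pJ: "p \<in> J" using sub by (auto simp: p_def hseg_def)
  have *: "q \<in> cell i j \<or> q \<in> cell i (j - 1)" if "dist q p < 1/2" "q \<notin> J" for q
  proof -
    have "\<bar>fst q - fst p\<bar> < 1/2" "\<bar>snd q - snd p\<bar> < 1/2"
      using that(1) dist_fst_le[of q p] dist_snd_le[of q p] by (auto simp: dist_real_def)
    moreover from this have "snd q = of_int j \<Longrightarrow> q \<in> hseg i j"
      by (auto simp: hseg_def p_def mem_Times_iff abs_real_def split: if_splits)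
    then have "snd q \<noteq> of_int j" using that(2) sub by blast
    ultimately show ?thesis by (cases q) (auto simp: cell_def p_def abs_real_def split: if_splits)
  qed
  obtain q where q: "q \<in> inside J" "dist q p < 1/2" using near_inside[OF pJ, of "1/2"] by auto
  obtain r where r: "r \<in> outside J" "dist r p < 1/2" using near_outside[OF pJ, of "1/2"] by auto
  show "((i, j) \<in> C) \<noteq> ((i, j - 1) \<in> C)"
    using *[OF q(2)] *[OF r(2)] q(1) r(1) inside_no_overlap[of J] outside_no_overlap[of J]
      cell_meets_inside cell_meets_outside by blast
next
  assume ne: "((i, j) \<in> C) \<noteq> ((i, j - 1) \<in> C)"
  show "hseg i j \<subseteq> J"
  proof (rule ccontr)
    assume n: "\<not> hseg i j \<subseteq> J"
    define R :: "pt set" where "R = {of_int i<..<of_int i + 1} \<times> {of_int j - 1<..<of_int j + 1}"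
    have "R \<inter> J = {}"
    proof -
      have False if "p \<in> R" "p \<in> J" for p
      proof -
        have "p \<in> cell i j \<or> p \<in> cell i (j-1) \<or> snd p = of_int j"
          using that(1) by (cases p) (auto simp: R_def cell_def)
        then show False using that hseg_subsetI[of "fst p" j i] cell_disjoint n
          by (cases p) (auto simp: R_def)
      qed
      then show ?thesis by blast
    qed
    moreover have "connected R" by (auto simp: R_def intro!: convex_connected convex_Times)
    moreover have "cell i j \<subseteq> R" "cell i (j-1) \<subseteq> R" by (auto simp: R_def cell_def)
    ultimately have "((i, j) \<in> C) = ((i, j - 1) \<in> C)"
      using connected_subset_inside[of R] cell_ne[of i j] cell_ne[of i "j-1"]
      unfolding C_def by blast
    with ne show False by simp
  qed
qed

lemma vseg_iff: "vseg i j \<subseteq> J \<longleftrightarrow> ((i, j) \<in> C) \<noteq> ((i - 1, j) \<in> C)"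
proof
  assume sub: "vseg i j \<subseteq> J"
  define p :: pt where "p = (of_int i, of_int j + 1/2)"
  have pJ: "p \<in> J" using sub by (auto simp: p_def vseg_def)
  have *: "q \<in> cell i j \<or> q \<in> cell (i - 1) j" if "dist q p < 1/2" "q \<notin> J" for q
  proof -
    have "\<bar>fst q - fst p\<bar> < 1/2" "\<bar>snd q - snd p\<bar> < 1/2"
      using that(1) dist_fst_le[of q p] dist_snd_le[of q p] by (auto simp: dist_real_def)
    moreover from this have "fst q = of_int i \<Longrightarrow> q \<in> vseg i j"
      by (auto simp: vseg_def p_def mem_Times_iff abs_real_def split: if_splits)
    then have "fst q \<noteq> of_int i" using that(2) sub by blast
    ultimately show ?thesis by (cases q) (auto simp: cell_def p_def abs_real_def split: if_splits)
  qed
  obtain q where q: "q \<in> inside J" "dist q p < 1/2" using near_inside[OF pJ, of "1/2"] by auto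
  obtain r where r: "r \<in> outside J" "dist r p < 1/2" using near_outside[OF pJ, of "1/2"] by auto
  show "((i, j) \<in> C) \<noteq> ((i - 1, j) \<in> C)"
    using *[OF q(2)] *[OF r(2)] q(1) r(1) inside_no_overlap[of J] outside_no_overlap[of J]
      cell_meets_inside cell_meets_outside by blast
next
  assume ne: "((i, j) \<in> C) \<noteq> ((i - 1, j) \<in> C)"
  show "vseg i j \<subseteq> J"
  proof (rule ccontr)
    assume n: "\<not> vseg i j \<subseteq> J"
    define R :: "pt set" where "R = {of_int i - 1<..<of_int i + 1} \<times> {of_int j<..<of_int j + 1}"
    have "R \<inter> J = {}"
    proof -
      have False if "p \<in> R" "p \<in> J" for p
      proof -
        have "p \<in> cell i j \<or> p \<in> cell (i-1) j \<or> fst p = of_int i"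
          using that(1) by (cases p) (auto simp: R_def cell_def)
        then show False using that vseg_subsetI[of i "snd p" j] cell_disjoint n
          by (cases p) (auto simp: R_def)
      qed
      then show ?thesis by blast
    qed
    moreover have "connected R" by (auto simp: R_def intro!: convex_connected convex_Times)
    moreover have "cell i j \<subseteq> R" "cell (i-1) j \<subseteq> R" by (auto simp: R_def cell_def)
    ultimately have "((i, j) \<in> C) = ((i - 1, j) \<in> C)"
      using connected_subset_inside[of R] cell_ne[of i j] cell_ne[of "i-1" j]
      unfolding C_def by blast
    with ne show False by simp
  qed
qed

end

lemma ccell_eq_closure: "ccell i j = closure (cell i j)"
  by (simp add: cell_def ccell_def closure_Times)

lemma closed_ccell: "closed (ccell i j)"
  by (simp add: ccell_eq_closure)

section \<open>Adjacency of the cells of the hole, and maximal segments of the curve\<close>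

context grid_curve
begin

text \<open>An open set that meets the closure of a cell meets the cell. In particular, all four
  cells around an inside grid point belong to \<open>C\<close>.\<close>

lemma inside_ccell: "p \<in> inside J \<Longrightarrow> p \<in> ccell i j \<Longrightarrow> (i, j) \<in> C"
  using open_Int_closure_eq_empty[OF open_in, of "cell i j"] cell_meets_inside
  unfolding ccell_eq_closure by blast

lemma finite_C: "finite C"
proof -
  obtain B where B: "\<And>p. p \<in> inside J \<Longrightarrow> norm p \<le> B" using bdd_in by (auto simp: bounded_iff)
  have "C \<subseteq> {-\<lceil>B\<rceil> - 1..\<lceil>B\<rceil> + 1} \<times> {-\<lceil>B\<rceil> - 1..\<lceil>B\<rceil> + 1}"
  proof clarify
    fix i j assume "(i, j) \<in> C"
    then have "(of_int i + 1/2, of_int j + 1/2) \<in> inside J" using C_cell cell_ne by blast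
    then have n: "norm (of_int i + 1/2 :: real, of_int j + 1/2 :: real) \<le> B" by (rule B)
    have "\<bar>of_int i + 1/2 :: real\<bar> \<le> B" "\<bar>of_int j + 1/2 :: real\<bar> \<le> B"
      using n norm_fst_le[of "of_int i + 1/2 :: real" "of_int j + 1/2 :: real"] norm_snd_le[of "of_int j + 1/2 :: real" "of_int i + 1/2 :: real"]
      by auto
    then show "i \<in> {-\<lceil>B\<rceil> - 1..\<lceil>B\<rceil> + 1} \<and> j \<in> {-\<lceil>B\<rceil> - 1..\<lceil>B\<rceil> + 1}" by simp linarith
  qed
  then show ?thesis by (rule finite_subset) auto
qed

lemma inside_subset_ccells: "inside J \<subseteq> (\<Union>(i, j)\<in>C. ccell i j)"
proof
  fix p assume p: "p \<in> inside J"
  have "p \<in> ccell \<lfloor>fst p\<rfloor> \<lfloor>snd p\<rfloor>" by (auto simp: ccell_def mem_Times_iff)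
  with inside_ccell[OF p] show "p \<in> (\<Union>(i, j)\<in>C. ccell i j)" by blast
qed

lemma hole_eq_ccells: "J \<union> inside J = (\<Union>(i, j)\<in>C. ccell i j)"
proof -
  have cl: "closure (inside J) = J \<union> inside J" by (metis closure_Un_frontier fr_in sup_commute)
  have "closed (\<Union>(i, j)\<in>C. ccell i j)" using finite_C closed_ccell by auto
  then have "closure (inside J) \<subseteq> (\<Union>(i, j)\<in>C. ccell i j)"
    using inside_subset_ccells by (simp add: closure_minimal)
  moreover have "ccell i j \<subseteq> closure (inside J)" if "(i, j) \<in> C" for i j
    unfolding ccell_eq_closure using that by (auto simp: C_def intro!: closure_mono)
  ultimately show ?thesis using cl by blast
qed

lemma C_ne: "C \<noteq> {}"
  using inside_ne inside_subset_ccells by auto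

text \<open>Otherwise the closed cells of \<open>W\<close> and of \<open>C - W\<close> would form
  two closed sets covering the connected inside; these must share an inside point, at which a cell
  of \<open>W\<close> touches one outside \<open>W\<close>.\<close>

lemma C_connected:
  assumes "W \<subseteq> C" "W \<noteq> {}"
    and cl: "\<And>i j i' j'. (i, j) \<in> W \<Longrightarrow> (i', j') \<in> C \<Longrightarrow>
      i' = i \<and> \<bar>j' - j\<bar> = 1 \<or> j' = j \<and> \<bar>i' - i\<bar> = 1 \<Longrightarrow> (i', j') \<in> W"
  shows "W = C"
proof (rule ccontr)
  assume "W \<noteq> C"
  define A where "A = (\<Union>(i, j)\<in>W. ccell i j)"
  define B where "B = (\<Union>(i, j)\<in>C - W. ccell i j)"
  have fin: "finite W" "finite (C - W)" using finite_C assms(1) finite_subset by auto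
  have c: "closed A" "closed B" unfolding A_def B_def using fin closed_ccell by auto
  have "inside J \<subseteq> A \<union> B" using inside_subset_ccells assms(1) unfolding A_def B_def by blast
  moreover have "A \<inter> inside J \<noteq> {}"
  proof -
    obtain i j where ij: "(i, j) \<in> W" using assms(2) by auto
    then have "(of_int i + 1/2, of_int j + 1/2) \<in> inside J" using assms(1) C_cell cell_ne by blast
    moreover have "(of_int i + 1/2, of_int j + 1/2) \<in> A" unfolding A_def using ij
      by (auto simp: ccell_def intro!: bexI[of _ "(i,j)"])
    ultimately show ?thesis by blast
  qed
  moreover have "B \<inter> inside J \<noteq> {}"
  proof -
    obtain i j where ij: "(i, j) \<in> C - W" using \<open>W \<noteq> C\<close> assms(1) by auto
    then have "(of_int i + 1/2, of_int j + 1/2) \<in> inside J" using C_cell cell_ne by blast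
    moreover have "(of_int i + 1/2, of_int j + 1/2) \<in> B" unfolding B_def using ij
      by (auto simp: ccell_def intro!: bexI[of _ "(i,j)"])
    ultimately show ?thesis by blast
  qed
  ultimately have "A \<inter> B \<inter> inside J \<noteq> {}"
    using connected_closedD[OF conn_in _ _ c] by blast
  then obtain p i j k l where p: "p \<in> inside J" "p \<in> ccell i j" "p \<in> ccell k l"
    and W: "(i, j) \<in> W" "(k, l) \<in> C" "(k, l) \<notin> W"
    unfolding A_def B_def by blast
  \<comment> \<open>The two cells may touch in a corner only; then the cell \<open>(i, l)\<close>
    also contains \<open>p\<close>, hence is in \<open>C\<close>, and links them by two steps across
    sides.\<close>
  have *: "p \<in> ccell i l" using p(2,3) by (auto simp: ccell_def)
  then have il: "(i, l) \<in> C" using inside_ccell p(1) by blast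
  have d: "\<bar>k - i\<bar> \<le> 1" "\<bar>l - j\<bar> \<le> 1" using p(2,3) by (cases p; simp add: ccell_def; linarith)+
  have "(i, l) \<in> W" using cl[OF W(1) il] W(1) d by (cases "l = j") auto
  then have "(k, l) \<in> W" using cl[OF _ W(2)] d by (cases "k = i") auto
  with W show False by simp
qed

text \<open>The unit segments separating the cells of the column have cells of \<open>C\<close> on
  both sides, so by \<open>hseg_iff\<close> they are not on \<open>J\<close>.\<close>

lemma column_inside:
  assumes "\<And>j. y1 \<le> j \<Longrightarrow> j < y2 \<Longrightarrow> (i, j) \<in> C"
  shows "{of_int i<..<of_int i + 1} \<times> {of_int y1<..<of_int y2} \<subseteq> inside J"
proof clarify
  fix x y :: real assume x: "x \<in> {of_int i<..<of_int i + 1}" and y: "y \<in> {of_int y1<..<of_int y2}"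
  define j where "j = \<lfloor>y\<rfloor>"
  have j: "of_int j \<le> y" "y < of_int j + 1" "y1 \<le> j" "j < y2" using y by (auto simp: j_def floor_less_iff le_floor_iff)
  have "(i, j) \<in> C" using assms j by simp
  show "(x, y) \<in> inside J"
  proof (cases "y = of_int j")
    case False
    then show ?thesis using C_cell[OF \<open>(i, j) \<in> C\<close>] x j by (auto simp: cell_def)
  next
    case True
    then have "y1 < j" using y by auto
    then have "(i, j - 1) \<in> C" using assms j by simp
    then have "(x, y) \<notin> J" using hseg_iff[of i j] \<open>(i, j) \<in> C\<close> hseg_subsetI[of x j i] True x by auto
    moreover have "(x, y) \<in> ccell i j" using x j by (auto simp: ccell_def)
    ultimately show ?thesis using hole_eq_ccells \<open>(i, j) \<in> C\<close> by blast
  qed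
qed

lemma vertical_run_subset:
  assumes "y1 < y2" "\<And>j. y1 \<le> j \<Longrightarrow> j < y2 \<Longrightarrow> vseg x j \<subseteq> J"
  shows "{of_int x} \<times> {of_int y1..of_int y2} \<subseteq> J"
proof clarify
  fix y :: real assume y: "y \<in> {of_int y1..of_int y2}"
  \<comment> \<open>The cap \<open>y2 - 1\<close> assigns the upper end of the run to the last unit
    segment instead of the one above it. The same device recurs below.\<close>
  define j where "j = min \<lfloor>y\<rfloor> (y2 - 1)"
  have "y1 \<le> j" "j < y2" "of_int j \<le> y" "y \<le> of_int j + 1"
    using y assms(1) unfolding j_def by (auto simp: le_floor_iff min_def, linarith+)
  then show "(of_int x, y) \<in> J" using assms(2)[of j] by (auto simp: vseg_def)
qed

lemma horizontal_run_subset: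
  assumes "x1 < x2" "\<And>i. x1 \<le> i \<Longrightarrow> i < x2 \<Longrightarrow> hseg i y \<subseteq> J"
  shows "{of_int x1..of_int x2} \<times> {of_int y} \<subseteq> J"
proof clarify
  fix x :: real assume x: "x \<in> {of_int x1..of_int x2}"
  define i where "i = min \<lfloor>x\<rfloor> (x2 - 1)"
  have "x1 \<le> i" "i < x2" "of_int i \<le> x" "x \<le> of_int i + 1"
    using x assms(1) unfolding i_def by (auto simp: le_floor_iff min_def, linarith+)
  then show "(x, of_int y) \<in> J" using assms(2)[of i] by (auto simp: hseg_def)
qed

text \<open>A longer segment of \<open>J\<close> would be vertical and enter the interior of a unit
  segment beyond an end; \<open>vseg_subsetI\<close> would put that whole unit segment on
  \<open>J\<close>.\<close>

lemma is_edge_vertical: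
  assumes "y1 < y2" "\<And>j. y1 \<le> j \<Longrightarrow> j < y2 \<Longrightarrow> vseg x j \<subseteq> J"
    and n: "\<not> vseg x (y1 - 1) \<subseteq> J" "\<not> vseg x y2 \<subseteq> J"
  shows "is_edge J (of_int x, of_int y1) (of_int x, of_int y2)"
proof -
  let ?e = "closed_segment (of_int x, of_int y1) (of_int x, of_int y2) :: pt set"
  have e: "?e = {of_int x} \<times> {of_int y1..of_int y2}"
    using assms(1) by (simp add: closed_segment_vertical closed_segment_eq_real_ivl)
  have max: "closed_segment c d = ?e" if sub: "?e \<subseteq> closed_segment c d" "closed_segment c d \<subseteq> J" for c d
  proof -
    have "(of_int x, of_int y1) \<in> closed_segment c d" "(of_int x, of_int y2) \<in> closed_segment c d"
      using sub(1) by auto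
    from closed_segment_same_fst[OF this] assms(1) have cd: "fst c = of_int x" "fst d = of_int x" by auto
    define lo hi where "lo = min (snd c) (snd d)" and "hi = max (snd c) (snd d)"
    have s: "closed_segment c d = {of_int x} \<times> {lo..hi}"
      using cd closed_segment_vertical[of "of_int x" "snd c" "snd d"]
      by (cases c; cases d) (auto simp: lo_def hi_def closed_segment_eq_real_ivl)
    have le: "lo \<le> of_int y1" "of_int y2 \<le> hi" using sub(1) assms(1) unfolding s e by (auto simp: times_subset_iff)
    have "hi \<le> of_int y2"
    proof (rule ccontr)
      assume "\<not> hi \<le> of_int y2"
      \<comment> \<open>The minimum keeps the witness both on the longer segment and strictly inside
        the next unit segment.\<close>
      then have A: "(of_int x, min hi (of_int y2 + 1/2)) \<in> J" using sub(2) le assms(1) unfolding s by auto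
      have B: "of_int y2 < min hi (of_int y2 + 1/2)" "min hi (of_int y2 + 1/2) < of_int y2 + 1"
        using \<open>\<not> hi \<le> of_int y2\<close> by linarith+
      show False using n(2) vseg_subsetI[OF A B] by contradiction
    qed
    moreover have "of_int y1 \<le> lo"
    proof (rule ccontr)
      assume "\<not> of_int y1 \<le> lo"
      then have A: "(of_int x, max lo (of_int y1 - 1/2)) \<in> J" using sub(2) le assms(1) unfolding s by auto
      have B: "of_int (y1 - 1) < max lo (of_int y1 - 1/2)" "max lo (of_int y1 - 1/2) < of_int (y1 - 1) + 1"
        using \<open>\<not> of_int y1 \<le> lo\<close> by linarith+
      show False using n(1) vseg_subsetI[OF A B] by contradiction
    qed
    ultimately show ?thesis using le unfolding s e by simp
  qed
  have eJ: "?e \<subseteq> J" unfolding e by (rule vertical_run_subset[OF assms(1)]) (rule assms(2))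
  have ne: "(of_int x, of_int y1) \<noteq> ((of_int x, of_int y2) :: pt)" using assms(1) by simp
  have "?e \<in> edges J" unfolding edges_def
    by (intro CollectI conjI allI impI eJ exI[of _ "(of_int x, of_int y1)"] exI[of _ "(of_int x, of_int y2)"] ne refl) (elim conjE, rule max)
  then show ?thesis using ne by (simp add: is_edge_def)
qed

lemma is_edge_horizontal:
  assumes "x1 < x2" "\<And>i. x1 \<le> i \<Longrightarrow> i < x2 \<Longrightarrow> hseg i y \<subseteq> J"
    and n: "\<not> hseg (x1 - 1) y \<subseteq> J" "\<not> hseg x2 y \<subseteq> J"
  shows "is_edge J (of_int x1, of_int y) (of_int x2, of_int y)"
proof -
  let ?e = "closed_segment (of_int x1, of_int y) (of_int x2, of_int y) :: pt set"
  have e: "?e = {of_int x1..of_int x2} \<times> {of_int y}"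
    using assms(1) by (simp add: closed_segment_horizontal closed_segment_eq_real_ivl)
  have max: "closed_segment c d = ?e" if sub: "?e \<subseteq> closed_segment c d" "closed_segment c d \<subseteq> J" for c d
  proof -
    have "(of_int x1, of_int y) \<in> closed_segment c d" "(of_int x2, of_int y) \<in> closed_segment c d"
      using sub(1) by auto
    from closed_segment_same_snd[OF this] assms(1) have cd: "snd c = of_int y" "snd d = of_int y" by auto
    define lo hi where "lo = min (fst c) (fst d)" and "hi = max (fst c) (fst d)"
    have s: "closed_segment c d = {lo..hi} \<times> {of_int y}"
      using cd closed_segment_horizontal[of "fst c" "of_int y" "fst d"]
      by (cases c; cases d) (auto simp: lo_def hi_def closed_segment_eq_real_ivl)
    have le: "lo \<le> of_int x1" "of_int x2 \<le> hi" using sub(1) assms(1) unfolding s e by (auto simp: times_subset_iff)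
    have "hi \<le> of_int x2"
    proof (rule ccontr)
      assume "\<not> hi \<le> of_int x2"
      then have A: "(min hi (of_int x2 + 1/2), of_int y) \<in> J" using sub(2) le assms(1) unfolding s by auto
      have B: "of_int x2 < min hi (of_int x2 + 1/2)" "min hi (of_int x2 + 1/2) < of_int x2 + 1"
        using \<open>\<not> hi \<le> of_int x2\<close> by linarith+
      show False using n(2) hseg_subsetI[OF A B] by contradiction
    qed
    moreover have "of_int x1 \<le> lo"
    proof (rule ccontr)
      assume "\<not> of_int x1 \<le> lo"
      then have A: "(max lo (of_int x1 - 1/2), of_int y) \<in> J" using sub(2) le assms(1) unfolding s by auto
      have B: "of_int (x1 - 1) < max lo (of_int x1 - 1/2)" "max lo (of_int x1 - 1/2) < of_int (x1 - 1) + 1"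
        using \<open>\<not> of_int x1 \<le> lo\<close> by linarith+
      show False using n(1) hseg_subsetI[OF A B] by contradiction
    qed
    ultimately show ?thesis using le unfolding s e by simp
  qed
  have eJ: "?e \<subseteq> J" unfolding e by (rule horizontal_run_subset[OF assms(1)]) (rule assms(2))
  have ne: "(of_int x1, of_int y) \<noteq> ((of_int x2, of_int y) :: pt)" using assms(1) by simp
  have "?e \<in> edges J" unfolding edges_def
    by (intro CollectI conjI allI impI eJ exI[of _ "(of_int x1, of_int y)"] exI[of _ "(of_int x2, of_int y)"] ne refl) (elim conjE, rule max)
  then show ?thesis using ne by (simp add: is_edge_def)
qed

end

section \<open>Holes without notches\<close>

text \<open>Taking \<open>min\<close> and \<open>max\<close> makes the relation symmetric: two cells
  of column \<open>i\<close> are related iff they lie in the same vertical run of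
  \<open>C\<close>.\<close>

definition run :: "(int \<times> int) set \<Rightarrow> int \<Rightarrow> int \<Rightarrow> int \<Rightarrow> bool" where
  "run C i j j' \<longleftrightarrow> (\<forall>k. min j j' \<le> k \<and> k \<le> max j j' \<longrightarrow> (i, k) \<in> C)"

lemma run_trans:
  assumes "run C i j k" "run C i k l"
  shows "run C i j l"
  unfolding run_def
proof (intro allI impI)
  fix q assume "min j l \<le> q \<and> q \<le> max j l"
  then have "(min j k \<le> q \<and> q \<le> max j k) \<or> (min k l \<le> q \<and> q \<le> max k l)" by linarith
  then show "(i, q) \<in> C" using assms unfolding run_def by blast
qed

lemma run_sym: "run C i j k \<Longrightarrow> run C i k j"
  by (simp add: run_def min.commute max.commute)

lemma run_ends: "run C i j k \<Longrightarrow> (i, j) \<in> C \<and> (i, k) \<in> C"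
  by (simp add: run_def)

text \<open>Only walks that never turn back are recorded, with free vertical movement inside each
  column; stage \<open>n\<close> therefore concerns column \<open>i0 + d * n\<close> alone.\<close>

primrec reach :: "(int \<times> int) set \<Rightarrow> int \<Rightarrow> int \<Rightarrow> int \<Rightarrow> nat \<Rightarrow> int set" where
  "reach C d i0 j0 0 = {j. run C i0 j0 j}"
| "reach C d i0 j0 (Suc n) = {k. \<exists>j\<in>reach C d i0 j0 n.
      (i0 + d * int (Suc n), j) \<in> C \<and> run C (i0 + d * int (Suc n)) j k}"

text \<open>\<open>tr\<close> makes the run next to a given run unique, so the runs reached by steps to the right
  only, or to the left only, are closed under adjacency: they exhaust \<open>C\<close>.\<close>

lemma columns_convex:
  fixes C :: "(int \<times> int) set"
  assumes conn: "\<And>W. W \<subseteq> C \<Longrightarrow> W \<noteq> {} \<Longrightarrow>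
      (\<And>i j i' j'. (i, j) \<in> W \<Longrightarrow> (i', j') \<in> C \<Longrightarrow>
        i' = i \<and> \<bar>j' - j\<bar> = 1 \<or> j' = j \<and> \<bar>i' - i\<bar> = 1 \<Longrightarrow> (i', j') \<in> W) \<Longrightarrow> W = C"
    and tr: "\<And>d i j k. \<bar>d\<bar> = 1 \<Longrightarrow> run C i j k \<Longrightarrow> (i + d, j) \<in> C \<Longrightarrow> (i + d, k) \<in> C \<Longrightarrow> run C (i + d) j k"
    and C: "(i0, j0) \<in> C" "(i0, j1) \<in> C"
  shows "run C i0 j0 j1"
proof -
  let ?r = "\<lambda>d. reach C d i0 j0"
  have in_C: "(i0 + d * int n, j) \<in> C" if "j \<in> ?r d n" for d n j
    using that by (cases n) (auto dest: run_ends)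
  have closed: "k \<in> ?r d n" if "j \<in> ?r d n" "run C (i0 + d * int n) j k" for d n j k
    using that by (cases n) (auto intro: run_trans)
  have unique: "run C (i0 + d * int n) j k" if "\<bar>d\<bar> = 1" "j \<in> ?r d n" "k \<in> ?r d n" for d n j k
    using that(2,3)
  proof (induction n arbitrary: j k)
    case 0
    then show ?case by (auto intro: run_trans run_sym)
  next
    case (Suc n)
    define i where "i = i0 + d * int n"
    have i: "i0 + d * int (Suc n) = i + d" by (simp add: i_def algebra_simps)
    obtain j' k' where *: "j' \<in> ?r d n" "(i + d, j') \<in> C" "run C (i + d) j' j"
      "k' \<in> ?r d n" "(i + d, k') \<in> C" "run C (i + d) k' k"
      using Suc.prems unfolding reach.simps i by auto
    have "run C i j' k'" using Suc.IH * by (simp add: i_def)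
    then have "run C (i + d) j' k'" using tr \<open>\<bar>d\<bar> = 1\<close> * by blast
    then show ?case unfolding i using * run_trans run_sym by meson
  qed
  define W where "W = {(i, j). \<exists>n d. \<bar>d\<bar> = 1 \<and> i = i0 + d * int n \<and> j \<in> ?r d n}"
  have "(i0, j0) \<in> W" unfolding W_def using C 
    by (simp, intro exI[of _ "0::nat"] exI[of _ "1::int"]) (auto simp: run_def)
  moreover have "W \<subseteq> C" unfolding W_def using in_C by auto
  moreover have "(i', j') \<in> W" if W: "(i, j) \<in> W" and "(i', j') \<in> C"
    and adj: "i' = i \<and> \<bar>j' - j\<bar> = 1 \<or> j' = j \<and> \<bar>i' - i\<bar> = 1" for i j i' j'
  proof -
    obtain n d where nd: "\<bar>d\<bar> = 1" "i = i0 + d * int n" "j \<in> ?r d n" using W unfolding W_def by auto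
    have ij: "(i, j) \<in> C" using in_C nd by auto
    consider "i' = i" "\<bar>j' - j\<bar> = 1" | "j' = j" "i' = i + d" | "j' = j" "i' = i - d"
      using adj nd(1) by linarith
    then show ?thesis
    proof cases
      case 1
      have "run C i j j'" unfolding run_def
      proof (intro allI impI)
        fix k assume "min j j' \<le> k \<and> k \<le> max j j'"
        then have "k = j \<or> k = j'" using 1 by auto
        then show "(i, k) \<in> C" using ij \<open>(i', j') \<in> C\<close> 1 by auto
      qed
      then have "j' \<in> ?r d n" using closed nd by blast
      then show ?thesis unfolding W_def using nd 1 by auto
    next
      case 2
      have i': "i' = i0 + d * int (Suc n)" using 2 nd by (simp add: algebra_simps)
      have "j' \<in> ?r d (Suc n)"
        unfolding reach.simps i'[symmetric] using nd 2 \<open>(i', j') \<in> C\<close> by (auto simp: run_def)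
      then show ?thesis unfolding W_def using nd i' by blast
    next
      \<comment> \<open>A step back towards column \<open>i0\<close>. At \<open>n = 0\<close> it
        starts a walk in the opposite direction; otherwise \<open>tr\<close> for \<open>- d\<close>
        shows that it lands in the run from which the current one was entered.\<close>
      case 3
      show ?thesis
      proof (cases n)
        case 0
        have i': "i' = i0 + (- d) * int (Suc 0)" using 3 nd 0 by simp
        have "j' \<in> ?r (- d) (Suc 0)"
          unfolding reach.simps i'[symmetric] using nd 0 3 \<open>(i', j') \<in> C\<close> by (auto simp: run_def)
        then show ?thesis unfolding W_def using nd i' by (metis (mono_tags, lifting) abs_minus_cancel case_prodI mem_Collect_eq)
      next
        case (Suc m)
        have i': "i' = i0 + d * int m" "i' + d = i" using 3 nd Suc by (auto simp: algebra_simps)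
        obtain k where k: "k \<in> ?r d m" "(i, k) \<in> C" "run C i k j"
          using nd(2,3) unfolding Suc reach.simps by auto
        have "(i + - d, k) \<in> C" using in_C[OF k(1)] i' by auto
        then have "run C (i + - d) k j" using tr[of "- d" i k j] nd(1) k 3 \<open>(i', j') \<in> C\<close> by simp
        then have "j \<in> ?r d m" using closed[OF k(1)] i' 3 by auto
        then show ?thesis unfolding W_def using nd(1) i' 3 by blast
      qed
    qed
  qed
  ultimately have "W = C" using conn[of W] by blast
  \<comment> \<open>The equation for \<open>i0\<close> forces \<open>n = 0\<close>, so in column
    \<open>i0\<close> only the starting run has been reached.\<close>
  then obtain n d where "\<bar>d\<bar> = (1::int)" "i0 = i0 + d * int n" "j1 \<in> ?r d n"
    using C(2) unfolding W_def by blast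
  then show ?thesis by (cases n) auto
qed

lemma is_edge_sym: "is_edge J a b \<longleftrightarrow> is_edge J b a"
  by (auto simp: is_edge_def closed_segment_commute)

section \<open>Columns of a hole without left and right notches\<close>

context grid_curve
begin

lemma C_bounds: obtains B where "\<And>i j. (i, j) \<in> C \<Longrightarrow> \<bar>i\<bar> < B \<and> \<bar>j\<bar> < B"
proof -
  let ?S = "(\<lambda>(i, j). max \<bar>i\<bar> \<bar>j\<bar>) ` C"
  have "\<bar>i\<bar> < Max ?S + 1 \<and> \<bar>j\<bar> < Max ?S + 1" if "(i, j) \<in> C" for i j
  proof -
    have "max \<bar>i\<bar> \<bar>j\<bar> \<le> Max ?S" using that finite_C by (intro Max_ge) force+
    then show ?thesis by auto
  qed
  then show thesis using that by blast
qed

text \<open>The edge extends to the first unit segment in direction \<open>d\<close> that is not on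
  \<open>J\<close>; one exists because \<open>C\<close> is bounded. The conditionals select the unit
  segment ahead of \<open>x\<close> and the one behind it.\<close>

lemma horizontal_edge_from:
  assumes "\<bar>d\<bar> = (1::int)" "hseg (if d = 1 then x else x - 1) y \<subseteq> J" "\<not> hseg (if d = 1 then x - 1 else x) y \<subseteq> J"
  shows "\<exists>s>0. is_edge J (of_int x, of_int y) ((of_int x, of_int y) + s *\<^sub>R (of_int d, 0))"
proof -
  obtain B where B: "\<And>i j. (i, j) \<in> C \<Longrightarrow> \<bar>i\<bar> < B \<and> \<bar>j\<bar> < B" using C_bounds by blast
  define P where "P n = hseg (if d = 1 then x + int n else x - 1 - int n) y" for n
  have "\<not> P (nat (\<bar>B\<bar> + \<bar>x\<bar> + 1)) \<subseteq> J" unfolding P_def hseg_iff using B by fastforce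
  then obtain n where n: "\<not> P n \<subseteq> J" "\<And>m. m < n \<Longrightarrow> P m \<subseteq> J"
    using exists_least_iff[of "\<lambda>n. \<not> P n \<subseteq> J"] by blast
  have "n > 0" using n(1) assms(2) by (intro Nat.gr0I) (auto simp: P_def split: if_splits)
  have "is_edge J (of_int x, of_int y) (of_int (x + d * int n), of_int y)"
  proof (cases "d = 1")
    case True
    have "hseg i y \<subseteq> J" if "x \<le> i" "i < x + int n" for i
      using n(2)[of "nat (i - x)"] that True by (auto simp: P_def)
    then show ?thesis using is_edge_horizontal[of x "x + int n" y] n(1) assms(3) True \<open>n > 0\<close>
      by (auto simp: P_def)
  next
    case False
    then have d: "d = -1" using assms(1) by auto
    have "hseg i y \<subseteq> J" if "x - int n \<le> i" "i < x" for i
      using n(2)[of "nat (x - 1 - i)"] that d by (auto simp: P_def)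
    moreover have "\<not> hseg (x - int n - 1) y \<subseteq> J" using n(1) d by (simp add: P_def algebra_simps)
    ultimately show ?thesis using is_edge_horizontal[of "x - int n" x y] assms(3) d \<open>n > 0\<close>
      by (simp add: is_edge_sym)
  qed
  then show ?thesis using \<open>n > 0\<close> by (intro exI[of _ "of_nat n"]) (auto simp: mult.commute)
qed

lemma interior_towards_vertical:
  assumes d: "\<bar>d\<bar> = (1::int)" and C: "\<And>j. y1 \<le> j \<Longrightarrow> j < y2 \<Longrightarrow> ((if d = 1 then x else x - 1), j) \<in> C"
    and "y1 < y2"
  shows "interior_towards J (of_int x, of_int y1) (of_int x, of_int y2) (of_int d, 0)"
  unfolding interior_towards_def
proof (intro exI[of _ 1] conjI ballI allI impI)
  have d': "d = 1 \<or> d = -1" using d by auto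
  fix p :: pt and t :: real
  assume p: "p \<in> open_segment (of_int x, of_int y1) (of_int x, of_int y2)" and t: "0 < t \<and> t < 1"
  have "p \<in> {of_int x} \<times> {of_int y1<..<of_int y2}"
    using p \<open>y1 < y2\<close> unfolding open_segment_def closed_segment_vertical
    by (auto simp: closed_segment_eq_real_ivl less_le)
  then have "p + t *\<^sub>R (of_int d, 0) \<in>
      {of_int (if d = 1 then x else x - 1)<..<of_int (if d = 1 then x else x - 1) + 1} \<times> {of_int y1<..<of_int y2}"
    using d' t by (elim disjE) auto
  moreover have "{of_int (if d = 1 then x else x - 1)<..<of_int (if d = 1 then x else x - 1) + 1} \<times> {of_int y1<..<of_int y2} \<subseteq> inside J"
    by (rule column_inside) (rule C)
  ultimately show "p + t *\<^sub>R (of_int d, 0) \<in> inside J" by (rule rev_subsetD)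
qed simp

text \<open>The wall between the run in column \<open>i\<close> and the gap in column
  \<open>i + d\<close> is a vertical edge. Its horizontal neighbours border the gap and leave in
  direction \<open>d\<close>, while the inside lies opposite: a right notch for
  \<open>d = 1\<close>, a left notch for \<open>d = -1\<close>.\<close>

lemma no_notch_pattern:
  assumes d: "\<bar>d\<bar> = (1::int)" and y: "y1 < y2"
    and nn: "d = 1 \<Longrightarrow> \<nexists>a b. right_notch J a b" "d = -1 \<Longrightarrow> \<nexists>a b. left_notch J a b"
    and C: "\<And>j. y1 - 1 \<le> j \<Longrightarrow> j \<le> y2 \<Longrightarrow> (i, j) \<in> C" "(i + d, y1 - 1) \<in> C" "(i + d, y2) \<in> C"
    and nC: "\<And>j. y1 \<le> j \<Longrightarrow> j < y2 \<Longrightarrow> (i + d, j) \<notin> C"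
  shows False
proof -
  define x where "x = (if d = 1 then i + 1 else i)"
  define a b :: pt where "a = (of_int x, of_int y1)" and "b = (of_int x, of_int y2)"
  have dd: "d = 1 \<or> d = -1" using d by auto
  have v: "vseg x j \<subseteq> J \<longleftrightarrow> ((i, j) \<in> C) \<noteq> ((i + d, j) \<in> C)" for j
    using dd unfolding x_def vseg_iff by (elim disjE; auto)
  have e: "is_edge J a b" unfolding a_def b_def
    by (rule is_edge_vertical) (use v C nC y in simp_all)
  have h: "hseg (if d = 1 then x else x - 1) j \<subseteq> J \<longleftrightarrow> ((i + d, j) \<in> C) \<noteq> ((i + d, j - 1) \<in> C)"
     "hseg (if d = 1 then x - 1 else x) j \<subseteq> J \<longleftrightarrow> ((i, j) \<in> C) \<noteq> ((i, j - 1) \<in> C)" for j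
    using dd unfolding x_def hseg_iff by (elim disjE; simp)+
  have n: "neighbours_extend J a b (of_int d, 0)"
    unfolding neighbours_extend_def a_def b_def
    by (intro conjI horizontal_edge_from[OF d]) (use h C nC y in simp_all)
  have t: "interior_towards J a b (of_int (- d), 0)"
    unfolding a_def b_def
  proof (rule interior_towards_vertical)
    show "(if - d = 1 then x else x - 1, j) \<in> C" if "y1 \<le> j" "j < y2" for j
      using dd C(1)[of j] that by (auto simp: x_def)
  qed (use d y in simp_all)
  have ve: "vertical_edge J a b" using e by (simp add: vertical_edge_def a_def b_def)
  from dd show False
  proof
    assume "d = 1"
    then have "right_notch J a b" using ve n t by (simp add: right_notch_def)
    then show False using nn(1) \<open>d = 1\<close> by blast
  next
    assume "d = -1"
    then have "left_notch J a b" using ve n t by (simp add: left_notch_def)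
    then show False using nn(2) \<open>d = -1\<close> by blast
  qed
qed

text \<open>If some cell \<open>l\<close> were missing, the nearest cells of \<open>C\<close> below
  and above it in column \<open>i + d\<close> would delimit a gap as in
  \<open>no_notch_pattern\<close>.\<close>

lemma run_transfer:
  assumes d: "\<bar>d\<bar> = (1::int)"
    and nn: "\<nexists>a b. right_notch J a b" "\<nexists>a b. left_notch J a b"
    and r: "run C i j k" and C: "(i + d, j) \<in> C" "(i + d, k) \<in> C"
  shows "run C (i + d) j k"
proof (rule ccontr)
  assume "\<not> run C (i + d) j k"
  then obtain l where l: "min j k \<le> l" "l \<le> max j k" "(i + d, l) \<notin> C" by (auto simp: run_def)
  define lo hi where "lo = min j k" and "hi = max j k"
  have lh: "(i + d, lo) \<in> C" "(i + d, hi) \<in> C" using C by (auto simp: lo_def hi_def min_def max_def)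
  define m where "m = (LEAST n. (i + d, l - int n) \<in> C)"
  define n where "n = (LEAST n. (i + d, l + int n) \<in> C)"
  have m0: "(i + d, l - int (nat (l - lo))) \<in> C" and n0: "(i + d, l + int (nat (hi - l))) \<in> C"
    using lh l by (auto simp: lo_def hi_def)
  have m: "(i + d, l - int m) \<in> C" "m \<le> nat (l - lo)" "\<And>q. q < m \<Longrightarrow> (i + d, l - int q) \<notin> C"
    unfolding m_def using LeastI[where P="\<lambda>n. (i + d, l - int n) \<in> C", OF m0]
      Least_le[where P="\<lambda>n. (i + d, l - int n) \<in> C", OF m0] not_less_Least[where P="\<lambda>n. (i + d, l - int n) \<in> C"] by blast+
  have n: "(i + d, l + int n) \<in> C" "n \<le> nat (hi - l)" "\<And>q. q < n \<Longrightarrow> (i + d, l + int q) \<notin> C"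
    unfolding n_def using LeastI[where P="\<lambda>n. (i + d, l + int n) \<in> C", OF n0]
      Least_le[where P="\<lambda>n. (i + d, l + int n) \<in> C", OF n0] not_less_Least[where P="\<lambda>n. (i + d, l + int n) \<in> C"] by blast+
  have mn: "m > 0" "n > 0" using m(1) n(1) l(3) by (auto intro!: Nat.gr0I)
  show False
  proof (rule no_notch_pattern[OF d, of "l - int m + 1" "l + int n" i])
    show "(i, q) \<in> C" if "l - int m + 1 - 1 \<le> q" "q \<le> l + int n" for q
    proof -
      have "min j k \<le> q" "q \<le> max j k"
        using that m(2) n(2) l(1,2) unfolding lo_def hi_def by linarith+
      then show ?thesis using r unfolding run_def by blast
    qed
    show "(i + d, q) \<notin> C" if "l - int m + 1 \<le> q" "q < l + int n" for q
    proof (cases "q \<le> l")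
      case True then show ?thesis using m(3)[of "nat (l - q)"] that by simp
    next
      case False then show ?thesis using n(3)[of "nat (q - l)"] that by simp
    qed
    show "(i + d, l - int m + 1 - 1) \<in> C" using m(1) by simp
    show "(i + d, l + int n) \<in> C" by (rule n(1))
    show "l - int m + 1 < l + int n" using mn by simp
    show "\<nexists>a b. right_notch J a b" "\<nexists>a b. left_notch J a b" by (rule nn)+
  qed
qed

end

context grid_curve
begin

text \<open>By \<open>columns_convex\<close> each column is a single run, with \<open>up\<close> one
  past its last cell. The final inequalities express that consecutive columns have a cell row in
  common, as connectedness requires.\<close>

lemma staircase_columns:
  assumes nn: "\<nexists>a b. right_notch J a b" "\<nexists>a b. left_notch J a b"
  obtains a b lo up where "a < b"
    "C = {(i, j). a \<le> i \<and> i < b \<and> lo i \<le> j \<and> j < up i}"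
    "\<And>i. a \<le> i \<Longrightarrow> i < b \<Longrightarrow> lo i < up i"
    "\<And>i. a < i \<Longrightarrow> i < b \<Longrightarrow> lo i < up (i - 1) \<and> lo (i - 1) < up i"
proof -
  have cv: "run C i j k" if "(i, j) \<in> C" "(i, k) \<in> C" for i j k
    by (rule columns_convex[OF C_connected run_transfer[OF _ nn] that])
  define a b where "a = Min (fst ` C)" and "b = Max (fst ` C) + 1"
  define lo up where "lo i = Min {j. (i, j) \<in> C}" and "up i = Max {j. (i, j) \<in> C} + 1" for i
  have fc: "finite {j. (i, j) \<in> C}" for i
    by (rule finite_subset[of _ "snd ` C"]) (use finite_C in force)+
  have f: "finite (fst ` C)" "fst ` C \<noteq> {}" using finite_C C_ne by auto
  have ab: "a \<le> i" "i < b" if "(i, j) \<in> C" for i j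
  proof -
    have "i \<in> fst ` C" using that by force
    then show "a \<le> i" "i < b" using Min_le[OF f(1)] Max_ge[OF f(1)] by (auto simp: a_def b_def zle_add1_eq_le)
  qed
  have ex: "\<exists>j. (a, j) \<in> C" "\<exists>j. (b - 1, j) \<in> C"
    using Min_in[OF f] Max_in[OF f] by (auto simp: a_def b_def)
  then have "a < b" using ab by blast
  have cross: "\<exists>j. (i, j) \<in> C \<and> (i + 1, j) \<in> C" if "a \<le> i" "i + 1 < b" for i
  proof (rule ccontr)
    assume no: "\<nexists>j. (i, j) \<in> C \<and> (i + 1, j) \<in> C"
    \<comment> \<open>If columns \<open>i\<close> and \<open>i + 1\<close> shared no row, the cells
      up to column \<open>i\<close> would be closed under adjacency and hence be all of
      \<open>C\<close>.\<close>
    define W where "W = {(k, j). (k, j) \<in> C \<and> k \<le> i}"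
    have "W = C"
    proof (rule C_connected)
      show "W \<noteq> {}" using ex(1) that by (auto simp: W_def)
      fix k j k' j' assume kj: "(k, j) \<in> W" "(k', j') \<in> C" "k' = k \<and> \<bar>j' - j\<bar> = 1 \<or> j' = j \<and> \<bar>k' - k\<bar> = 1"
      have "k' \<le> i"
      proof (rule ccontr)
        assume "\<not> k' \<le> i"
        then have "k = i" "k' = i + 1" "j' = j" using kj by (auto simp: W_def)
        then show False using kj no by (auto simp: W_def)
      qed
      then show "(k', j') \<in> W" using kj by (auto simp: W_def)
    qed (auto simp: W_def)
    moreover obtain j where "(b - 1, j) \<in> C" using ex(2) by blast
    ultimately have "(b - 1, j) \<in> W" by simp
    then show False using that by (simp add: W_def)
  qed
  have ne: "\<exists>j. (i, j) \<in> C" if "a \<le> i" "i < b" for i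
    using cross[of i] ex that by (cases "i = b - 1") auto
  have lu: "(i, lo i) \<in> C" "(i, up i - 1) \<in> C" if "a \<le> i" "i < b" for i
    using Min_in[OF fc] Max_in[OF fc] ne[OF that] by (auto simp: lo_def up_def)
  have bd: "lo i \<le> j" "j < up i" if "(i, j) \<in> C" for i j
    using Min_le[OF fc] Max_ge[OF fc] that by (auto simp: lo_def up_def zle_add1_eq_le)
  have "(i, j) \<in> C" if "a \<le> i" "i < b" "lo i \<le> j" "j < up i" for i j
    using cv[OF lu[OF that(1,2)]] that(3,4) unfolding run_def by auto
  then have "(i, j) \<in> C \<longleftrightarrow> a \<le> i \<and> i < b \<and> lo i \<le> j \<and> j < up i" for i j
    using ab bd by blast
  then have Ceq: "C = {(i, j). a \<le> i \<and> i < b \<and> lo i \<le> j \<and> j < up i}" by auto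
  moreover have "lo i < up i" if "a \<le> i" "i < b" for i
    using ne[OF that] bd by fastforce
  moreover have "lo i < up (i - 1) \<and> lo (i - 1) < up i" if "a < i" "i < b" for i
  proof -
    obtain j where "(i - 1, j) \<in> C" "(i, j) \<in> C" using cross[of "i - 1"] \<open>a < i\<close> \<open>i < b\<close> by auto
    then show ?thesis using bd by fastforce
  qed
  ultimately show thesis using that \<open>a < b\<close> by blast
qed

end

section \<open>Edges of a region between two staircases\<close>

locale staircase_hole = grid_curve J for J +
  fixes a b :: int and lo up :: "int \<Rightarrow> int"
  assumes ab: "a < b"
    and C_eq: "C = {(i, j). a \<le> i \<and> i < b \<and> lo i \<le> j \<and> j < up i}"
    and lo_up: "a \<le> i \<Longrightarrow> i < b \<Longrightarrow> lo i < up i"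
    and overlap: "a < i \<Longrightarrow> i < b \<Longrightarrow> lo i < up (i - 1) \<and> lo (i - 1) < up i"
begin

lemma C_iff: "(i, j) \<in> C \<longleftrightarrow> a \<le> i \<and> i < b \<and> lo i \<le> j \<and> j < up i"
  by (simp add: C_eq)

lemma hseg_stair_iff: "hseg i y \<subseteq> J \<longleftrightarrow> a \<le> i \<and> i < b \<and> (y = lo i \<or> y = up i)"
  unfolding hseg_iff C_iff using lo_up[of i] by auto

lemma hole_columns:
  "J \<union> inside J = (\<Union>i\<in>{a..<b}. {of_int i..of_int i + 1} \<times> {of_int (lo i)..of_int (up i)})"
proof (intro set_eqI iffI)
  fix p :: pt assume "p \<in> J \<union> inside J"
  then obtain i j where ij: "(i, j) \<in> C" "p \<in> ccell i j" unfolding hole_eq_ccells by blast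
  then have "of_int (lo i) \<le> (of_int j :: real)" "of_int j + 1 \<le> (of_int (up i) :: real)"
    unfolding C_iff by linarith+
  then have "p \<in> {of_int i..of_int i + 1} \<times> {of_int (lo i)..of_int (up i)}"
    using ij(2) unfolding ccell_def by auto
  then show "p \<in> (\<Union>i\<in>{a..<b}. {of_int i..of_int i + 1} \<times> {of_int (lo i)..of_int (up i)})"
    using ij(1) C_iff by auto
next
  fix p :: pt assume "p \<in> (\<Union>i\<in>{a..<b}. {of_int i..of_int i + 1} \<times> {of_int (lo i)..of_int (up i)})"
  then obtain i where i: "a \<le> i" "i < b" "p \<in> {of_int i..of_int i + 1} \<times> {of_int (lo i)..of_int (up i)}"
    by auto
  define j where "j = min \<lfloor>snd p\<rfloor> (up i - 1)"
  have y: "of_int (lo i) \<le> snd p" "snd p \<le> of_int (up i)" using i(3) by auto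
  have "lo i \<le> j" "j < up i" "of_int j \<le> snd p" "snd p \<le> of_int j + 1"
    using y lo_up[OF i(1,2)] unfolding j_def by (auto simp: le_floor_iff min_def, linarith+)
  then have "(i, j) \<in> C" "p \<in> ccell i j" using i by (auto simp: C_iff ccell_def)
  then show "p \<in> J \<union> inside J" unfolding hole_eq_ccells by blast
qed

text \<open>At a step the top could otherwise only be continued by the bottom of the neighbouring
  column; \<open>overlap\<close> excludes this.\<close>

lemma top_edge:
  assumes "a \<le> x1" "x1 < x2" "x2 \<le> b" "\<And>i. x1 \<le> i \<Longrightarrow> i < x2 \<Longrightarrow> up i = y"
    "x1 = a \<or> up (x1 - 1) \<noteq> y" "x2 = b \<or> up x2 \<noteq> y"
  shows "is_edge J (of_int x1, of_int y) (of_int x2, of_int y)"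
proof (rule is_edge_horizontal)
  have e: "up x1 = y" "up (x2 - 1) = y" using assms(2,4) by auto
  show "\<not> hseg (x1 - 1) y \<subseteq> J" unfolding hseg_stair_iff using assms(1-3,5) overlap[of x1] e by auto
  show "\<not> hseg x2 y \<subseteq> J" unfolding hseg_stair_iff using assms(1-3,6) overlap[of x2] e by auto
qed (use assms in \<open>auto simp: hseg_stair_iff\<close>)

lemma bottom_edge:
  assumes "a \<le> x1" "x1 < x2" "x2 \<le> b" "\<And>i. x1 \<le> i \<Longrightarrow> i < x2 \<Longrightarrow> lo i = y"
    "x1 = a \<or> lo (x1 - 1) \<noteq> y" "x2 = b \<or> lo x2 \<noteq> y"
  shows "is_edge J (of_int x1, of_int y) (of_int x2, of_int y)"
proof (rule is_edge_horizontal)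
  have e: "lo x1 = y" "lo (x2 - 1) = y" using assms(2,4) by auto
  show "\<not> hseg (x1 - 1) y \<subseteq> J" unfolding hseg_stair_iff using assms(1-3,5) overlap[of x1] e by auto
  show "\<not> hseg x2 y \<subseteq> J" unfolding hseg_stair_iff using assms(1-3,6) overlap[of x2] e by auto
qed (use assms in \<open>auto simp: hseg_stair_iff\<close>)

lemma top_step:
  assumes "a < x" "x < b" "up (x - 1) \<noteq> up x"
  shows "is_edge J (of_int x, of_int (up (x - 1))) (of_int x, of_int (up x))"
proof -
  let ?l = "min (up (x - 1)) (up x)" and ?u = "max (up (x - 1)) (up x)"
  have "is_edge J (of_int x, of_int ?l) (of_int x, of_int ?u)"
    by (rule is_edge_vertical)
      (use assms overlap[of x] lo_up[of x] lo_up[of "x - 1"] in \<open>auto simp: vseg_iff C_iff min_def max_def split: if_splits\<close>)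
  then show ?thesis by (cases "up (x - 1) \<le> up x") (auto simp: is_edge_sym max_def min_def)
qed

lemma bottom_step:
  assumes "a < x" "x < b" "lo (x - 1) \<noteq> lo x"
  shows "is_edge J (of_int x, of_int (lo (x - 1))) (of_int x, of_int (lo x))"
proof -
  let ?l = "min (lo (x - 1)) (lo x)" and ?u = "max (lo (x - 1)) (lo x)"
  have "is_edge J (of_int x, of_int ?l) (of_int x, of_int ?u)"
    by (rule is_edge_vertical)
      (use assms overlap[of x] lo_up[of x] lo_up[of "x - 1"] in \<open>auto simp: vseg_iff C_iff min_def max_def split: if_splits\<close>)
  then show ?thesis by (cases "lo (x - 1) \<le> lo x") (auto simp: is_edge_sym max_def min_def)
qed

lemma left_edge: "is_edge J (of_int a, of_int (lo a)) (of_int a, of_int (up a))"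
  by (rule is_edge_vertical) (use lo_up[of a] ab in \<open>auto simp: vseg_iff C_iff\<close>)

lemma right_edge: "is_edge J (of_int b, of_int (lo (b - 1))) (of_int b, of_int (up (b - 1)))"
  by (rule is_edge_vertical) (use lo_up[of "b - 1"] ab in \<open>auto simp: vseg_iff C_iff\<close>)

lemma edge_extends_rightwards:
  assumes "s > 0" "is_edge J (of_int x, of_int y) ((of_int x, of_int y) + s *\<^sub>R (1, 0))"
  shows "hseg x y \<subseteq> J"
\<comment> \<open>The length \<open>s\<close> is arbitrary; half of \<open>min s 1\<close> gives a
  point on the edge that is also strictly inside the unit segment.\<close>
proof (rule hseg_subsetI[of "of_int x + min s 1 / 2"])
  have "closed_segment (of_int x, of_int y) (of_int x + s, of_int y) \<subseteq> J"
    using assms(2) by (simp add: is_edge_def edges_def)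
  then show "(of_int x + min s 1 / 2, of_int y) \<in> J"
    using assms(1) by (auto simp: closed_segment_horizontal closed_segment_eq_real_ivl min_def)
qed (use assms(1) in \<open>auto simp: min_def\<close>)

lemma edge_extends_leftwards:
  assumes "s > 0" "is_edge J (of_int x, of_int y) ((of_int x, of_int y) + s *\<^sub>R (-1, 0))"
  shows "hseg (x - 1) y \<subseteq> J"
proof (rule hseg_subsetI[of "of_int x - min s 1 / 2"])
  have "closed_segment (of_int x, of_int y) (of_int x - s, of_int y) \<subseteq> J"
    using assms(2) by (simp add: is_edge_def edges_def)
  then show "(of_int x - min s 1 / 2, of_int y) \<in> J"
    using assms(1) by (auto simp: closed_segment_horizontal closed_segment_eq_real_ivl min_def)
qed (use assms(1) in \<open>auto simp: min_def\<close>)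

lemma vertical_edge_vseg:
  assumes "is_edge J (of_int x, of_int y1) (of_int x, of_int y2)" "min y1 y2 \<le> j" "j < max y1 y2"
  shows "vseg x j \<subseteq> J"
proof (rule vseg_subsetI[of x "of_int j + 1/2"])
  have "closed_segment (of_int x, of_int y1) (of_int x, of_int y2) \<subseteq> J"
    using assms(1) by (simp add: is_edge_def edges_def)
  moreover have "real_of_int (min y1 y2) \<le> of_int j" "real_of_int j + 1 \<le> of_int (max y1 y2)"
    using assms(2,3) by linarith+
  then have "of_int j + 1/2 \<in> closed_segment (real_of_int y1) (of_int y2)"
    by (auto simp: closed_segment_eq_real_ivl min_def max_def split: if_splits)
  ultimately show "(of_int x, of_int j + 1/2) \<in> J" unfolding closed_segment_vertical by blast
qed auto

text \<open>The horizontal neighbours force the ends to be bottom and top of column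
  \<open>x\<close>. If \<open>x\<close> were not \<open>a\<close>, the edge would cross the row
  \<open>max (lo x) (lo (x - 1))\<close>, which by \<open>overlap\<close> has cells of the hole on
  both sides.\<close>

lemma leftmost_edge_eq:
  assumes "leftmost_edge J (of_int x, of_int y1) (of_int x', of_int y2)"
  shows "x = a \<and> x' = a \<and> (y1 = lo a \<and> y2 = up a \<or> y1 = up a \<and> y2 = lo a)"
proof -
  have e: "is_edge J (of_int x, of_int y1) (of_int x, of_int y2)" and x': "x' = x"
    using assms by (auto simp: leftmost_edge_def vertical_edge_def)
  have "hseg x y1 \<subseteq> J" "hseg x y2 \<subseteq> J"
    using assms edge_extends_rightwards x'
    unfolding leftmost_edge_def neighbours_extend_def by blast+
  moreover have "y1 \<noteq> y2" using e by (auto simp: is_edge_def)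
  ultimately have x: "a \<le> x" "x < b" and y: "y1 = lo x \<and> y2 = up x \<or> y1 = up x \<and> y2 = lo x"
    by (auto simp: hseg_stair_iff)
  have "x = a"
  proof (rule ccontr)
    assume "x \<noteq> a"
    then have "\<not> vseg x (max (lo x) (lo (x - 1))) \<subseteq> J"
      unfolding vseg_iff C_iff using x overlap[of x] lo_up[of x] lo_up[of "x - 1"] by auto
    moreover have "vseg x (max (lo x) (lo (x - 1))) \<subseteq> J"
      by (rule vertical_edge_vseg[OF e]) (use x y overlap[of x] lo_up[of x] \<open>x \<noteq> a\<close> in auto)
    ultimately show False by simp
  qed
  with x' y show ?thesis by simp
qed

lemma rightmost_edge_eq:
  assumes "rightmost_edge J (of_int x, of_int y1) (of_int x', of_int y2)"
  shows "x = b"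
proof (rule ccontr)
  assume "x \<noteq> b"
  have e: "is_edge J (of_int x, of_int y1) (of_int x, of_int y2)" and x': "x' = x"
    using assms by (auto simp: rightmost_edge_def vertical_edge_def)
  have "hseg (x - 1) y1 \<subseteq> J" "hseg (x - 1) y2 \<subseteq> J"
    using assms edge_extends_leftwards x'
    unfolding rightmost_edge_def neighbours_extend_def by blast+
  moreover have "y1 \<noteq> y2" using e by (auto simp: is_edge_def)
  ultimately have x: "a < x" "x < b" and y: "y1 = lo (x - 1) \<and> y2 = up (x - 1) \<or> y1 = up (x - 1) \<and> y2 = lo (x - 1)"
    using \<open>x \<noteq> b\<close> by (auto simp: hseg_stair_iff)
  have "\<not> vseg x (max (lo x) (lo (x - 1))) \<subseteq> J"
    unfolding vseg_iff C_iff using x overlap[of x] lo_up[of x] lo_up[of "x - 1"] by auto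
  moreover have "vseg x (max (lo x) (lo (x - 1))) \<subseteq> J"
    by (rule vertical_edge_vseg[OF e]) (use x y overlap[of x] lo_up[of "x - 1"] in auto)
  ultimately show False by simp
qed

end

section \<open>Integral vertices\<close>

text \<open>On the line through \<open>u\<close> and \<open>v\<close> the parameters of points of
  \<open>J\<close> form a compact set. Its component at 0 is a compact interval, whose image is the
  required maximal segment.\<close>

lemma segment_extends_to_edge:
  fixes u v :: pt
  assumes "compact J" "u \<noteq> v" "closed_segment u v \<subseteq> J"
  shows "\<exists>e\<in>edges J. closed_segment u v \<subseteq> e"
proof -
  define \<phi> where "\<phi> t = u + t *\<^sub>R (v - u)" for t :: real
  have \<phi>_seg: "\<phi> ` closed_segment s t = closed_segment (\<phi> s) (\<phi> t)" for s t
  proof -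
    have "\<phi> r = (1 - k) *\<^sub>R \<phi> s + k *\<^sub>R \<phi> t" if "r = (1 - k) *\<^sub>R s + k *\<^sub>R t" for r k
      unfolding \<phi>_def that by (simp add: algebra_simps)
    then show ?thesis unfolding closed_segment_image_interval image_image by (intro image_cong) auto
  qed
  have cont: "continuous_on UNIV \<phi>" unfolding \<phi>_def by (intro continuous_intros)
  have inj: "\<phi> s = \<phi> t \<longleftrightarrow> s = t" for s t using assms(2) by (auto simp: \<phi>_def)
  define L where "L = \<phi> -` J"
  have "closed L" unfolding L_def using cont assms(1) compact_imp_closed continuous_closed_vimage
    by (metis continuous_on_eq_continuous_at open_UNIV UNIV_I)
  have "bounded L"
  proof -
    obtain B where B: "\<And>p. p \<in> J \<Longrightarrow> norm p \<le> B" using compact_imp_bounded[OF assms(1)] by (auto simp: bounded_iff)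
    have "norm t \<le> (B + norm u) / norm (v - u)" if "t \<in> L" for t
    proof -
      have "norm (t *\<^sub>R (v - u)) \<le> norm (\<phi> t) + norm u"
        using norm_triangle_ineq4[of "\<phi> t" u] by (simp add: \<phi>_def)
      also have "\<dots> \<le> B + norm u" using B that by (simp add: L_def)
      finally show ?thesis using assms(2) by (simp add: pos_le_divide_eq)
    qed
    then show ?thesis unfolding bounded_iff by blast
  qed
  define K where "K = connected_component_set L 0"
  have sub01: "closed_segment 0 1 \<subseteq> L"
  proof -
    have "\<phi> ` closed_segment 0 1 \<subseteq> J" unfolding \<phi>_seg using assms(3) by (simp add: \<phi>_def)
    then show ?thesis by (auto simp: L_def)
  qed
  have sub: "T \<subseteq> K" if "connected T" "0 \<in> T" "T \<subseteq> L" for T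
    unfolding K_def using that by (intro connected_component_maximal)
  have K: "closed_segment 0 1 \<subseteq> K" using sub01 by (intro sub) auto
  have "compact K" unfolding K_def
    using \<open>closed L\<close> \<open>bounded L\<close> connected_component_subset[of L 0]
    by (meson bounded_subset closed_connected_component compact_eq_bounded_closed)
  moreover have "connected K" by (simp add: K_def)
  ultimately obtain t1 t2 where t: "K = {t1..t2}" by (meson connected_compact_interval_1)
  have t12: "t1 \<le> 0" "1 \<le> t2" using K by (auto simp: t closed_segment_eq_real_ivl)
  then have K_seg: "K = closed_segment t1 t2" by (simp add: t closed_segment_eq_real_ivl)
  define e where "e = closed_segment (\<phi> t1) (\<phi> t2)"
  have e: "e = \<phi> ` K" by (simp add: e_def K_seg \<phi>_seg)
  have uv: "u = \<phi> 0" "v = \<phi> 1" by (auto simp: \<phi>_def)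
  have uve: "closed_segment u v \<subseteq> e" unfolding e uv \<phi>_seg[symmetric] using K by blast
  have max: "closed_segment c d = e" if cd: "e \<subseteq> closed_segment c d" "closed_segment c d \<subseteq> J" for c d
  proof -
    have "u \<in> closed_segment c d" "v \<in> closed_segment c d" using uve cd(1) by auto
    then obtain \<alpha> \<beta> where \<alpha>: "u = (1 - \<alpha>) *\<^sub>R c + \<alpha> *\<^sub>R d" and \<beta>: "v = (1 - \<beta>) *\<^sub>R c + \<beta> *\<^sub>R d"
      by (auto simp: in_segment)
    have ne: "\<alpha> \<noteq> \<beta>" using \<alpha> \<beta> assms(2) by auto
    have vu: "v - u = (\<beta> - \<alpha>) *\<^sub>R (d - c)" unfolding \<alpha> \<beta> by (simp add: algebra_simps)
    have \<phi>': "\<phi> r = c + (\<alpha> + r * (\<beta> - \<alpha>)) *\<^sub>R (d - c)" for r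
      unfolding \<phi>_def vu by (subst \<alpha>) (simp add: algebra_simps)
    \<comment> \<open>Any larger segment lies on the same line because it contains \<open>u\<close>
      and \<open>v\<close>; these are the parameters of its ends. As it is connected and contains
      \<open>u\<close>, it stays within the component \<open>K\<close>.\<close>
    have "c = \<phi> (- \<alpha> / (\<beta> - \<alpha>))" "d = \<phi> ((1 - \<alpha>) / (\<beta> - \<alpha>))" unfolding \<phi>' using ne by auto
    then obtain s s' where s: "closed_segment c d = \<phi> ` closed_segment s s'" using \<phi>_seg by metis
    have "closed_segment s s' \<subseteq> K"
    proof (rule sub)
      show "0 \<in> closed_segment s s'" using \<open>u \<in> closed_segment c d\<close> unfolding s uv using inj by auto
      show "closed_segment s s' \<subseteq> L" using cd(2) unfolding s L_def by auto
    qed simp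
    then show ?thesis using cd(1) unfolding s e by blast
  qed
  have eJ: "e \<subseteq> J" unfolding e using connected_component_subset[of L 0] by (auto simp: K_def L_def)
  have ne: "\<phi> t1 \<noteq> \<phi> t2" using inj t12 by auto
  have "e \<in> edges J" unfolding edges_def
  proof (intro CollectI conjI allI impI)
    show "\<exists>a b. a \<noteq> b \<and> e = closed_segment a b" using ne e_def by (intro exI conjI)
    show "closed_segment c d = e" if "e \<subseteq> closed_segment c d \<and> closed_segment c d \<subseteq> J" for c d
      using that by (elim conjE) (rule max)
  qed (rule eJ)
  with uve show ?thesis by (intro bexI)
qed

text \<open>The finite family may contain single points. But a connected set with two points has no
  isolated point, so \<open>p\<close> is a limit point of the closed union of the nondegenerate
  segments and belongs to it.\<close>

lemma rectilinear_arc_covered: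
  assumes "closed_rectilinear_arc J" "q \<in> J" "r \<in> J" "q \<noteq> r" "p \<in> J"
  shows "\<exists>u v. u \<noteq> v \<and> (fst u = fst v \<or> snd u = snd v) \<and> p \<in> closed_segment u v \<and> closed_segment u v \<subseteq> J"
proof -
  have "\<exists>F. finite F \<and> J = \<Union>F \<and>
      (\<forall>s\<in>F. \<exists>a b. s = closed_segment a b \<and> (fst a = fst b \<or> snd a = snd b))"
    using assms(1) unfolding closed_rectilinear_arc_def by (rule conjunct2)
  then obtain F where F: "finite F" "J = \<Union>F"
    "\<And>s. s \<in> F \<Longrightarrow> \<exists>a b. s = closed_segment a b \<and> (fst a = fst b \<or> snd a = snd b)"
    by (elim exE conjE) (rule that, assumption+, erule bspec)
  have "connected J" using assms(1) unfolding closed_rectilinear_arc_def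
    using connected_simple_path_image by blast
  then have lim: "p islimpt J" using assms(2-5) by (intro connected_imp_perfect) auto
  define D where "D = {s \<in> F. finite s}"
  have "J = \<Union>(F - D) \<union> \<Union>D" using F(2) by (auto simp: D_def)
  moreover have "finite (\<Union>D)" using F(1) by (auto simp: D_def)
  ultimately have "p islimpt \<Union>(F - D)"
    using lim islimpt_Un islimpt_finite by metis
  moreover have "closed (\<Union>(F - D))" using F(1,3) by (intro closed_Union) (auto, metis closed_segment)
  ultimately have "p \<in> \<Union>(F - D)" using closed_limpt by blast
  then obtain s where s: "s \<in> F" "infinite s" "p \<in> s" by (auto simp: D_def)
  with F obtain a b where "s = closed_segment a b" "fst a = fst b \<or> snd a = snd b" by blast
  moreover have "a \<noteq> b" using calculation s(2) by auto
  moreover have "s \<subseteq> J" using s(1) F(2) by blast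
  ultimately show ?thesis using s(3) by blast
qed

lemma closed_segment_real_max: "closed_segment y1 y2 = {min y1 y2..max y1 y2}" for y1 y2 :: real
  by (auto simp: closed_segment_eq_real_ivl min_def max_def)

text \<open>Every point of \<open>J\<close> lies on a nondegenerate axis-parallel segment and so on
  an edge. By \<open>boundary_order\<close> the ends of an edge are vertices, hence integral, and
  the edge splits into unit segments. The edge \<open>q r\<close> supplies two distinct points of
  \<open>J\<close>.\<close>

lemma grid_curve_of_hole:
  assumes arc: "closed_rectilinear_arc J" and bo: "boundary_order J vs" and iv: "integral_vertices J"
    and e: "is_edge J q r"
  shows "grid_curve J"
proof -
  obtain g where g: "simple_path g" "pathfinish g = pathstart g" "path_image g = J"
    using arc unfolding closed_rectilinear_arc_def by blast
  have qr: "q \<in> J" "r \<in> J" "q \<noteq> r" using e by (auto simp: is_edge_def edges_def)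
  have "compact J" using g compact_simple_path_image by blast
  show ?thesis
  proof
    fix p assume p: "p \<in> J"
    obtain u v where uv: "u \<noteq> v" "fst u = fst v \<or> snd u = snd v" "p \<in> closed_segment u v" "closed_segment u v \<subseteq> J"
      using rectilinear_arc_covered[OF arc qr p] by blast
    obtain e where e: "e \<in> edges J" "closed_segment u v \<subseteq> e"
      using segment_extends_to_edge[OF \<open>compact J\<close> uv(1,4)] by blast
    then obtain i where i: "i < length vs" "e = closed_segment (vs ! i) (vs ! (Suc i mod length vs))"
      using bo unfolding boundary_order_def by auto
    have "Suc i mod length vs < length vs" by (rule mod_less_divisor) (use i(1) in linarith)
    then have vert: "vs ! i \<in> vertices J" "vs ! (Suc i mod length vs) \<in> vertices J"
      using bo i(1) unfolding boundary_order_def by (metis nth_mem)+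
    have "\<exists>c :: int \<times> int. p = (of_int (fst c), of_int (snd c))" if "p \<in> vertices J" for p
    proof -
      obtain x y where "fst p = of_int x" "snd p = of_int y"
        using iv \<open>p \<in> vertices J\<close> unfolding integral_vertices_def by (meson Ints_cases)
      then show ?thesis by (intro exI[of _ "(x, y)"]) (simp add: prod_eq_iff)
    qed
    with vert obtain c d where c: "vs ! i = (of_int (fst c), of_int (snd c))"
       and d: "vs ! (Suc i mod length vs) = (of_int (fst d), of_int (snd d))" by blast
    have eq: "e = closed_segment (of_int (fst c), of_int (snd c)) (of_int (fst d), of_int (snd d))"
      using i(2) c d by simp
    have ends: "u \<in> e" "v \<in> e" using e(2) by auto
    have pe: "p \<in> e" "e \<subseteq> J" using uv(3) e by (auto simp: edges_def)
    show "\<exists>i j. p \<in> hseg i j \<and> hseg i j \<subseteq> J \<or> p \<in> vseg i j \<and> vseg i j \<subseteq> J"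
      using uv(2)
    proof
      assume f: "fst u = fst v"
      then have "snd u \<noteq> snd v" using uv(1) by (simp add: prod_eq_iff)
      moreover have "(fst u, snd u) \<in> e" "(fst u, snd v) \<in> e" using ends f by (metis prod.collapse)+
      ultimately have "real_of_int (fst c) = fst u" "real_of_int (fst d) = fst u"
        using closed_segment_same_fst[of "fst u" "snd u" "vs ! i" "vs ! (Suc i mod length vs)" "snd v"] i c d by auto
      then have dc: "fst d = fst c" by simp
      define y1 y2 where "y1 = min (snd c) (snd d)" and "y2 = max (snd c) (snd d)"
      have eq': "e = {of_int (fst c)} \<times> {of_int y1..of_int y2}"
        unfolding eq dc closed_segment_vertical closed_segment_real_max y1_def y2_def by (auto simp: min_def max_def)
      have "real_of_int y1 \<le> snd u" "snd u \<le> of_int y2" "real_of_int y1 \<le> snd v" "snd v \<le> of_int y2"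
        using ends unfolding eq' by auto
      moreover have "snd u < snd v \<or> snd v < snd u" using \<open>snd u \<noteq> snd v\<close> by auto
      ultimately have "y1 < y2" by (elim disjE) linarith+
      define j where "j = min \<lfloor>snd p\<rfloor> (y2 - 1)"
      have y: "of_int y1 \<le> snd p" "snd p \<le> of_int y2" "fst p = of_int (fst c)" using pe(1) unfolding eq' by auto
      have j: "y1 \<le> j" "j < y2" "of_int j \<le> snd p" "snd p \<le> of_int j + 1"
        using y \<open>y1 < y2\<close> unfolding j_def by (auto simp: le_floor_iff min_def, linarith+)
      have j': "real_of_int y1 \<le> of_int j" "real_of_int j + 1 \<le> of_int y2" using j(1,2) by linarith+
      have "p \<in> vseg (fst c) j" using y j by (auto simp: vseg_def mem_Times_iff)
      moreover have "vseg (fst c) j \<subseteq> e" using j' unfolding eq' vseg_def by auto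
      ultimately show ?thesis using pe(2) by blast
    next
      assume f: "snd u = snd v"
      then have "fst u \<noteq> fst v" using uv(1) by (simp add: prod_eq_iff)
      moreover have "(fst u, snd u) \<in> e" "(fst v, snd u) \<in> e" using ends f by (metis prod.collapse)+
      ultimately have "real_of_int (snd c) = snd u" "real_of_int (snd d) = snd u"
        using closed_segment_same_snd[of "fst u" "snd u" "vs ! i" "vs ! (Suc i mod length vs)" "fst v"] i c d by auto
      then have dc: "snd d = snd c" by simp
      define x1 x2 where "x1 = min (fst c) (fst d)" and "x2 = max (fst c) (fst d)"
      have eq': "e = {of_int x1..of_int x2} \<times> {of_int (snd c)}"
        unfolding eq dc closed_segment_horizontal closed_segment_real_max x1_def x2_def by (auto simp: min_def max_def)
      have "real_of_int x1 \<le> fst u" "fst u \<le> of_int x2" "real_of_int x1 \<le> fst v" "fst v \<le> of_int x2"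
        using ends unfolding eq' by auto
      moreover have "fst u < fst v \<or> fst v < fst u" using \<open>fst u \<noteq> fst v\<close> by auto
      ultimately have "x1 < x2" by (elim disjE) linarith+
      define k where "k = min \<lfloor>fst p\<rfloor> (x2 - 1)"
      have x: "of_int x1 \<le> fst p" "fst p \<le> of_int x2" "snd p = of_int (snd c)" using pe(1) unfolding eq' by auto
      have k: "x1 \<le> k" "k < x2" "of_int k \<le> fst p" "fst p \<le> of_int k + 1"
        using x \<open>x1 < x2\<close> unfolding k_def by (auto simp: le_floor_iff min_def, linarith+)
      have k': "real_of_int x1 \<le> of_int k" "real_of_int k + 1 \<le> of_int x2" using k(1,2) by linarith+
      have "p \<in> hseg k (snd c)" using x k by (auto simp: hseg_def mem_Times_iff)
      moreover have "hseg k (snd c) \<subseteq> e" using k' unfolding eq' hseg_def by auto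
      ultimately show ?thesis using pe(2) by blast
    qed
  qed (use Jordan_inside_outside_prod[OF g(1,2)] g(3) in auto)
qed

section \<open>Stable locations in a sequence of pieces\<close>

locale staircase_pieces =
  fixes m :: nat and X L U :: "nat \<Rightarrow> real" and S :: "pt set" and w h :: real
  assumes X_step: "k < m \<Longrightarrow> X k < X (Suc k)"
    and S_eq: "S = (\<Union>k<m. {X k..X (Suc k)} \<times> {L k..U k})"
    and wh: "0 < w" "0 < h"
begin

lemma X_less: "i < j \<Longrightarrow> j \<le> m \<Longrightarrow> X i < X j"
proof (induction j)
  case (Suc j)
  then show ?case using X_step[of j] by (cases "i = j") auto
qed simp

lemma X_le: "i \<le> j \<Longrightarrow> j \<le> m \<Longrightarrow> X i \<le> X j"
  using X_less[of i j] by (cases "i = j") auto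

lemma X_less_iff: "i \<le> m \<Longrightarrow> j \<le> m \<Longrightarrow> X i < X j \<longleftrightarrow> i < j"
  using X_less[of i j] X_le[of j i] by (cases "i < j") auto

lemma locate_left_closed:
  assumes "X 0 \<le> t" "t < X m"
  obtains k where "k < m" "X k \<le> t" "t < X (Suc k)"
proof -
  define k where "k = (LEAST k. t < X (Suc k))"
  obtain n where n: "m = Suc n" using assms by (cases m) auto
  then have tn: "t < X (Suc n)" using assms(2) by simp
  have "t < X (Suc k)" unfolding k_def by (rule LeastI[where P = "\<lambda>k. t < X (Suc k)", OF tn])
  moreover have "k \<le> n" unfolding k_def by (rule Least_le[where P = "\<lambda>k. t < X (Suc k)", OF tn])
  moreover have "X k \<le> t"
  proof (cases k)
    case (Suc l)
    then show ?thesis using not_less_Least[of l "\<lambda>k. t < X (Suc k)"] by (auto simp: k_def[symmetric])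
  qed (use assms in auto)
  ultimately show thesis using that[of k] n by simp
qed

lemma locate_right_closed:
  assumes "X 0 < t" "t \<le> X m"
  obtains k where "k < m" "X k < t" "t \<le> X (Suc k)"
proof -
  define k where "k = (LEAST k. t \<le> X (Suc k))"
  obtain n where n: "m = Suc n" using assms by (cases m) auto
  then have tn: "t \<le> X (Suc n)" using assms(2) by simp
  have "t \<le> X (Suc k)" unfolding k_def by (rule LeastI[where P = "\<lambda>k. t \<le> X (Suc k)", OF tn])
  moreover have "k \<le> n" unfolding k_def by (rule Least_le[where P = "\<lambda>k. t \<le> X (Suc k)", OF tn])
  moreover have "X k < t"
  proof (cases k)
    case (Suc l)
    then show ?thesis using not_less_Least[of l "\<lambda>k. t \<le> X (Suc k)"] by (auto simp: k_def[symmetric])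
  qed (use assms in auto)
  ultimately show thesis using that[of k] n by simp
qed

text \<open>Only pieces whose open horizontal range meets that of the rectangle restrict
  \<open>y\<close>. A piece that merely touches a side of the rectangle does not.\<close>

lemma feasible_iff:
  "feasible S w h (x, y) \<longleftrightarrow> X 0 \<le> x \<and> x + w \<le> X m \<and>
     (\<forall>k<m. X k < x + w \<and> x < X (Suc k) \<longrightarrow> L k \<le> y \<and> y + h \<le> U k)"
    (is "?f \<longleftrightarrow> ?r")
proof
  assume f: ?f
  have inS: "\<exists>k<m. X k \<le> px \<and> px \<le> X (Suc k) \<and> L k \<le> py \<and> py \<le> U k"
    if "x \<le> px" "px \<le> x + w" "y \<le> py" "py \<le> y + h" for px py
  proof -
    have "(px, py) \<in> S" using f that by (auto simp: feasible_def)
    then show ?thesis by (auto simp: S_eq)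
  qed
  obtain k l where "k < m" "X k \<le> x" "l < m" "x + w \<le> X (Suc l)"
    using inS[of x y] inS[of "x + w" y] wh by auto
  then have "X 0 \<le> x" "x + w \<le> X m" using X_le[of 0 k] X_le[of "Suc l" m] by auto
  moreover have "L k \<le> y \<and> y + h \<le> U k" if k: "k < m" "X k < x + w" "x < X (Suc k)" for k
  proof -
    \<comment> \<open>The midpoint of the common horizontal range is interior to piece
      \<open>k\<close>, so no other piece contains it.\<close>
    define px where "px = (max x (X k) + min (x + w) (X (Suc k))) / 2"
    have px: "x \<le> px" "px \<le> x + w" "X k < px" "px < X (Suc k)"
      using k X_step[OF k(1)] wh unfolding px_def by (auto simp: min_def max_def field_simps)
    have *: "k' = k" if "k' < m" "X k' \<le> px" "px \<le> X (Suc k')" for k'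
      using that px k(1) X_less_iff[of k' "Suc k"] X_less_iff[of k "Suc k'"] by auto
    show ?thesis using inS[of px y] inS[of px "y + h"] px wh * by auto
  qed
  ultimately show ?r by auto
next
  assume r: ?r
  have "(px, py) \<in> S" if p: "x \<le> px" "px \<le> x + w" "y \<le> py" "py \<le> y + h" for px py
  proof -
    obtain k where k: "k < m" "X k \<le> px" "px \<le> X (Suc k)" "X k < x + w" "x < X (Suc k)"
    \<comment> \<open>A breakpoint belongs to two pieces: the right one is chosen, except at the
      right side of the rectangle, so that the chosen piece meets the open horizontal range.\<close>
    proof (cases "px < x + w")
      case True
      then have "X 0 \<le> px" "px < X m" using r p by auto
      then obtain k where "k < m" "X k \<le> px" "px < X (Suc k)" by (rule locate_left_closed)
      with that[of k] True p show thesis by auto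
    next
      case False
      then have "X 0 < px" "px \<le> X m" using r p wh by auto
      then obtain k where "k < m" "X k < px" "px \<le> X (Suc k)" by (rule locate_right_closed)
      with that[of k] False p wh show thesis by auto
    qed
    then have "L k \<le> y" "y + h \<le> U k" using r by auto
    then show ?thesis unfolding S_eq using k p by auto
  qed
  then show ?f by (auto simp: feasible_def)
qed

text \<open>Small shifts to the left from \<open>X k\<close> can newly touch only piece
  \<open>k - 1\<close>, so this piece alone, or the left end of the hole for \<open>k = 0\<close>,
  decides whether the rectangle is blocked.\<close>

definition stable_at :: "nat \<Rightarrow> real \<Rightarrow> bool" where
  "stable_at k y \<longleftrightarrow> X k + w \<le> X m \<and>
     (\<forall>j. k \<le> j \<and> j < m \<and> X j < X k + w \<longrightarrow> L j \<le> y \<and> y + h \<le> U j) \<and>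
     (\<exists>j. k \<le> j \<and> j < m \<and> X j < X k + w \<and> L j = y) \<and>
     (k = 0 \<or> y < L (k - 1) \<or> U (k - 1) < y + h)"

lemma feasible_at_iff:
  assumes "k < m"
  shows "feasible S w h (X k, y) \<longleftrightarrow> X k + w \<le> X m \<and>
     (\<forall>j. k \<le> j \<and> j < m \<and> X j < X k + w \<longrightarrow> L j \<le> y \<and> y + h \<le> U j)"
proof -
  have "X k < X (Suc j) \<longleftrightarrow> k \<le> j" if "j < m" for j
    using X_less_iff[of k "Suc j"] assms that by auto
  then show ?thesis unfolding feasible_iff using X_le[of 0 k] assms by auto
qed

lemma BL_stable_if_stable_at:
  assumes "k < m" "stable_at k y"
  shows "BL_stable S w h (X k, y)"
  unfolding BL_stable_def
\<comment> \<open>A shift to the left by less than \<open>w\<close> leaves the rectangle straddling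
  \<open>X k\<close>, so it still meets the blocking piece \<open>k - 1\<close>.\<close>
proof (intro conjI exI[of _ w] allI impI)
  show "feasible S w h (X k, y)" 
    using assms(2) unfolding feasible_at_iff[OF assms(1)] stable_at_def by simp
  fix t assume t: "0 < t \<and> t < w"
  show "\<not> feasible S w h (fst (X k, y) - t, snd (X k, y))"
  proof
    assume f: "feasible S w h (fst (X k, y) - t, snd (X k, y))"
    then have "X 0 \<le> X k - t" by (simp add: feasible_iff)
    then have "k \<noteq> 0" using t by (intro notI) simp
    then obtain l where l: "k = Suc l" by (cases k) auto
    have "X l < X k" using l assms(1) X_step by auto
    then have "L l \<le> y \<and> y + h \<le> U l" using f t l assms(1) by (auto simp: feasible_iff)
    then show False using assms(2) l by (auto simp: stable_at_def)
  qed
  show "\<not> feasible S w h (fst (X k, y), snd (X k, y) - t)"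
  proof -
    obtain j where "k \<le> j" "j < m" "X j < X k + w" "L j = y" using assms(2) unfolding stable_at_def by blast
    moreover have "\<not> y \<le> y - t" using t by simp
    ultimately have "\<not> feasible S w h (X k, y - t)" unfolding feasible_at_iff[OF assms(1)] by blast
    then show ?thesis by simp
  qed
qed (use wh in auto)

text \<open>Each failing condition yields a small feasible shift: down if no piece bottom supports
  the rectangle, left if \<open>x\<close> is strictly inside a piece, and left also if
  \<open>x = X k\<close> but piece \<open>k - 1\<close> leaves room.\<close>

lemma stable_at_if_BL_stable:
  assumes "BL_stable S w h (x, y)"
  shows "\<exists>k<m. x = X k \<and> stable_at k y"
proof -
  obtain \<epsilon> where \<epsilon>: "\<epsilon> > 0" "\<And>t. 0 < t \<Longrightarrow> t < \<epsilon> \<Longrightarrow> \<not> feasible S w h (x - t, y)"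
    "\<And>t. 0 < t \<Longrightarrow> t < \<epsilon> \<Longrightarrow> \<not> feasible S w h (x, y - t)" and f: "feasible S w h (x, y)"
    using assms unfolding BL_stable_def by auto
  have f': "X 0 \<le> x" "x + w \<le> X m"
    "\<And>k. k < m \<Longrightarrow> X k < x + w \<Longrightarrow> x < X (Suc k) \<Longrightarrow> L k \<le> y \<and> y + h \<le> U k"
    using f unfolding feasible_iff by blast+
  have bottom: "\<exists>j<m. X j < x + w \<and> x < X (Suc j) \<and> L j = y"
  proof (rule ccontr)
    assume no: "\<not> ?thesis"
    define W where "W = {j. j < m \<and> X j < x + w \<and> x < X (Suc j)}"
    \<comment> \<open>The smallest clearance above the finitely many bottoms, cut to half the
      radius.\<close>
    define t where "t = Min (insert (\<epsilon> / 2) ((\<lambda>j. y - L j) ` W))"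
    have fin: "finite W" by (simp add: W_def)
    have t: "t \<le> \<epsilon> / 2" "\<And>j. j \<in> W \<Longrightarrow> t \<le> y - L j" 
      unfolding t_def using fin by (intro Min_le; simp)+
    have pos: "L j < y" if "j \<in> W" for j
      using no f'(3)[of j] that by (auto simp: W_def less_le)
    have "t > 0" unfolding t_def using fin pos \<epsilon>(1) by auto
    have "feasible S w h (x, y - t)" unfolding feasible_iff
    proof (intro conjI allI impI)
      fix k assume k: "k < m" "X k < x + w \<and> x < X (Suc k)"
      then have "k \<in> W" by (simp add: W_def)
      then show "L k \<le> y - t" using t(2) by fastforce
      show "y - t + h \<le> U k" using f'(3)[of k] k \<open>t > 0\<close> by auto
    qed (use f' in auto)
    then show False using \<epsilon>(3)[of t] \<open>t > 0\<close> t(1) \<epsilon>(1) by auto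
  qed
  have "x < X m" using f'(2) wh by simp
  with f'(1) obtain k where k: "k < m" "X k \<le> x" "x < X (Suc k)" by (rule locate_left_closed)
  have xk: "x = X k"
  proof (rule ccontr)
    assume "x \<noteq> X k"
    define t where "t = min (\<epsilon> / 2) ((x - X k) / 2)"
    have t: "0 < t" "t < \<epsilon>" "X k < x - t" using \<epsilon>(1) k(2) \<open>x \<noteq> X k\<close> by (auto simp: t_def min_def field_simps)
    have "feasible S w h (x - t, y)" unfolding feasible_iff
    proof (intro conjI allI impI)
      show "X 0 \<le> x - t" using X_le[of 0 k] k t by auto
      fix j assume j: "j < m" "X j < x - t + w \<and> x - t < X (Suc j)"
      have "x < X (Suc j)"
      proof (rule ccontr)
        assume "\<not> ?thesis"
        then have "Suc j \<le> k" using X_less_iff[of "Suc j" "Suc k"] j k by auto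
        then have "X (Suc j) \<le> X k" using X_le k by auto
        then show False using t j by auto
      qed
      then show "L j \<le> y" "y + h \<le> U j" using f'(3)[of j] j t by auto
    qed (use f' t in auto)
    then show False using \<epsilon>(2) t by auto
  qed
  have "k = 0 \<or> y < L (k - 1) \<or> U (k - 1) < y + h"
  proof (rule ccontr)
    assume no: "\<not> ?thesis"
    then obtain l where l: "k = Suc l" by (cases k) auto
    have lk: "X l < X k" using X_step[of l] l k by auto
    define t where "t = min (\<epsilon> / 2) ((X k - X l) / 2)"
    have t: "0 < t" "t < \<epsilon>" "X l < X k - t" using \<epsilon>(1) lk by (auto simp: t_def min_def field_simps)
    have "feasible S w h (x - t, y)" unfolding feasible_iff xk
    proof (intro conjI allI impI)
      show "X 0 \<le> X k - t" using X_le[of 0 l] k t l by auto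
      fix j assume j: "j < m" "X j < X k - t + w \<and> X k - t < X (Suc j)"
      then have "l < Suc j" using t l k X_less_iff[of l "Suc j"] by auto
      then consider "j = l" | "k < Suc j" using l by linarith
      then have "L j \<le> y \<and> y + h \<le> U j"
      proof cases
        case 2
        then show ?thesis using f'(3)[of j] j t xk X_less[of k "Suc j"] by auto
      qed (use no l in auto)
      then show "L j \<le> y" "y + h \<le> U j" by auto
    qed (use f' xk t in auto)
    then show False using \<epsilon>(2) t by auto
  qed
  moreover have "\<exists>j\<ge>k. j < m \<and> X j < X k + w \<and> L j = y"
  proof -
    obtain j where j: "j < m" "X j < x + w" "x < X (Suc j)" "L j = y" using bottom by blast
    then have "k \<le> j" using X_less_iff[of k "Suc j"] k xk by auto
    with j xk show ?thesis by blast
  qed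
  ultimately have "stable_at k y"
    using f unfolding xk feasible_at_iff[OF k(1)] stable_at_def by simp
  then show ?thesis using k(1) xk by blast
qed

lemma BL_stable_set:
  "{p. BL_stable S w h p} = {(X k, y) | k y. k < m \<and> stable_at k y}"
proof (intro set_eqI iffI)
  fix p assume "p \<in> {p. BL_stable S w h p}"
  then obtain k where "k < m" "fst p = X k" "stable_at k (snd p)"
    using stable_at_if_BL_stable[of "fst p" "snd p"] by auto
  then show "p \<in> {(X k, y) | k y. k < m \<and> stable_at k y}" by (metis (mono_tags, lifting) mem_Collect_eq prod.collapse)
next
  fix p assume "p \<in> {(X k, y) | k y. k < m \<and> stable_at k y}"
  then show "p \<in> {p. BL_stable S w h p}" using BL_stable_if_stable_at by blast
qed

end

section \<open>Total correctness with running time\<close>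

text \<open>The postcondition sees time and final state together. The resulting equations for
  loop-free commands make \<open>halts_simps\<close> a symbolic interpreter that also counts
  time.\<close>

definition halts :: "com \<Rightarrow> state \<Rightarrow> (nat \<Rightarrow> state \<Rightarrow> bool) \<Rightarrow> bool" where
  "halts c s Q \<longleftrightarrow> (\<exists>t s'. exec c s t s' \<and> Q t s')"

lemma halts_Skip: "halts Skip s Q \<longleftrightarrow> Q 1 s"
  unfolding halts_def by (metis exec.Skip exec_elims(1))

lemma halts_Assign:
  "halts (Assign r a) s Q \<longleftrightarrow> Q (acost a + 1) ((fst s)(r := aval a s), snd s)"
  unfolding halts_def by (metis exec.Assign exec_elims(2))

lemma halts_Store:
  "halts (Store a b) s Q \<longleftrightarrow> Q (acost a + acost b + 1) (fst s, (snd s)(aval a s := aval b s))"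
  unfolding halts_def by (metis exec.Store exec_elims(3))

lemma halts_Seq:
  "halts (Seq c d) s Q \<longleftrightarrow> halts c s (\<lambda>t s'. halts d s' (\<lambda>u s''. Q (t + u) s''))"
  unfolding halts_def by (fastforce elim: exec_elims(4) intro: exec.Seq)

lemma halts_Cond:
  "halts (Cond b c d) s Q \<longleftrightarrow>
     (if bval b s then halts c s (\<lambda>t. Q (bcost b + 1 + t)) else halts d s (\<lambda>t. Q (bcost b + 1 + t)))"
  unfolding halts_def
  by (cases "bval b s") (fastforce elim: exec_elims(5) intro: exec.CondTrue exec.CondFalse)+

lemmas halts_simps = halts_Skip halts_Assign halts_Store halts_Seq halts_Cond

lemma haltsI: "exec c s t s' \<Longrightarrow> Q t s' \<Longrightarrow> halts c s Q"
  unfolding halts_def by blast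

lemma haltsE:
  assumes "halts c s Q"
  obtains t s' where "exec c s t s'" "Q t s'"
  using assms unfolding halts_def by blast

lemma halts_mono: "halts c s P \<Longrightarrow> (\<And>t s'. P t s' \<Longrightarrow> Q t s') \<Longrightarrow> halts c s Q"
  unfolding halts_def by blast

text \<open>The potential \<open>\<Phi>\<close> pays for the iterations; what is left of it at the end is kept
  in the conclusion, so that the costs of nested loops telescope.\<close>

lemma halts_While:
  fixes \<Phi> :: "'i \<Rightarrow> nat"
  assumes "I i s"
    and step: "\<And>i s. I i s \<Longrightarrow> bval b s \<Longrightarrow>
      halts c s (\<lambda>t s'. \<exists>i'. I i' s' \<and> bcost b + 1 + t + \<Phi> i' \<le> \<Phi> i)"
  shows "halts (While b c) s (\<lambda>t s'. \<exists>i'. I i' s' \<and> \<not> bval b s' \<and> t + \<Phi> i' \<le> \<Phi> i + bcost b + 1)"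
  using assms(1)
proof (induction "\<Phi> i" arbitrary: i s rule: less_induct)
  case less
  show ?case
  proof (cases "bval b s")
    case True
    then obtain t s' i' where 1: "exec c s t s'" "I i' s'" "bcost b + 1 + t + \<Phi> i' \<le> \<Phi> i"
      using step[OF less.prems] unfolding halts_def by blast
    then obtain u s'' j where 2: "exec (While b c) s' u s''" "I j s''" "\<not> bval b s''"
      "u + \<Phi> j \<le> \<Phi> i' + bcost b + 1"
      using less.hyps[of i' s'] unfolding halts_def by auto
    have "exec (While b c) s (bcost b + 1 + t + u) s''" using True 1 2 by (blast intro: exec.WhileTrue)
    with 1 2 show ?thesis unfolding halts_def
      by (intro exI[of _ "bcost b + 1 + t + u"] exI[of _ s''] conjI exI[of _ j]) auto
  next
    case False
    then show ?thesis unfolding halts_def using less.prems exec.WhileFalse by fastforce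
  qed
qed

section \<open>Next greater elements and sliding maxima\<close>

text \<open>The index \<open>m\<close> acts as a sentinel, so the least element exists even if no
  later value is greater.\<close>

definition next_greater :: "(nat \<Rightarrow> int) \<Rightarrow> nat \<Rightarrow> nat \<Rightarrow> nat" where
  "next_greater A m k = (LEAST j. k < j \<and> (m \<le> j \<or> A k < A j))"

lemma
  shows next_greater_gt: "k < next_greater A m k" and next_greater_stop: "m \<le> next_greater A m k \<or> A k < A (next_greater A m k)"
proof -
  have "k < max m (Suc k) \<and> (m \<le> max m (Suc k) \<or> A k < A (max m (Suc k)))" by auto
  then have "k < next_greater A m k \<and> (m \<le> next_greater A m k \<or> A k < A (next_greater A m k))" unfolding next_greater_def by (rule LeastI)
  then show "k < next_greater A m k" "m \<le> next_greater A m k \<or> A k < A (next_greater A m k)" by auto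
qed

lemma next_greater_le: "k < m \<Longrightarrow> next_greater A m k \<le> m"
  unfolding next_greater_def by (rule Least_le) simp

lemma next_greater_below: "k < j \<Longrightarrow> j < next_greater A m k \<Longrightarrow> A j \<le> A k"
  unfolding next_greater_def using not_less_Least[of j "\<lambda>j. k < j \<and> (m \<le> j \<or> A k < A j)"] by auto

lemma next_greater_eqI:
  assumes "k < t" "t \<le> m" "t = m \<or> A k < A t" "\<And>j. k < j \<Longrightarrow> j < t \<Longrightarrow> A j \<le> A k"
  shows "next_greater A m k = t"
  unfolding next_greater_def
proof (rule Least_equality)
  fix j assume j: "k < j \<and> (m \<le> j \<or> A k < A j)"
  show "t \<le> j"
  proof (rule ccontr)
    assume "\<not> t \<le> j"
    then show False using assms(2) assms(4)[of j] j by auto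
  qed
qed (use assms in auto)

text \<open>The number of links to follow from \<open>k\<close>: the potential that pays for the inner loop.\<close>

function depth :: "(nat \<Rightarrow> int) \<Rightarrow> nat \<Rightarrow> nat \<Rightarrow> nat" where
  "depth A m k = (if k < m then Suc (depth A m (next_greater A m k)) else 0)"
  by auto
termination
  by (relation "Wellfounded.measure (\<lambda>(A, m, k). m - k)") (auto intro: diff_less_mono2 next_greater_gt)

declare depth.simps [simp del]

text \<open>Piece \<open>k\<close> is stored in the five cells from \<open>F + 5 * k\<close> on: \<open>X k\<close>, \<open>L k\<close>, \<open>- U k\<close> and
  the addresses of the next pieces with a greater \<open>L\<close> and a greater \<open>- U\<close>. Register 5 holds \<open>F\<close>,
  register 12 the address \<open>F + 5 * m\<close> of a final record that only contains \<open>X m\<close>.\<close>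

abbreviation fld :: "nat \<Rightarrow> int \<Rightarrow> aexp" where
  "fld r k \<equiv> Mem (Plus (Reg r) (Const k))"

definition next_greater_inner :: "int \<Rightarrow> com" where
  "next_greater_inner off = While (And (Less (Reg 16) (Reg 12)) (Neg (Less (fld 15 off) (fld 16 off))))
     (Assign 16 (fld 16 (off + 2)))"

definition next_greater_prog :: "int \<Rightarrow> com" where
  "next_greater_prog off = Seq (Assign 15 (Reg 12)) (While (Less (Reg 5) (Reg 15))
     (Seq (Assign 15 (Minus (Reg 15) (Const 5)))
     (Seq (Assign 16 (Plus (Reg 15) (Const 5)))
     (Seq (next_greater_inner off) (Store (Plus (Reg 15) (Const (off + 2))) (Reg 16))))))"

text \<open>Following a link from a candidate \<open>t\<close> with \<open>A t \<le> A k\<close>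
  skips only values at most \<open>A t\<close>. A link costs exactly 20 and lowers the depth by one;
  the 35 consists of the final test and the one link by which \<open>k\<close> is deeper than its
  target.\<close>

lemma next_greater_inner_halts:
  assumes F: "R 12 = F + 5 * int m" "R 15 = F + 5 * int k" "R 16 = F + 5 * int (Suc k)" and "k < m"
    and A: "\<And>j. j < m \<Longrightarrow> M (F + 5 * int j + off) = A j"
    and N: "\<And>j. k < j \<Longrightarrow> j < m \<Longrightarrow> M (F + 5 * int j + (off + 2)) = F + 5 * int (next_greater A m j)"
  shows "halts (next_greater_inner off) (R, M) (\<lambda>t s'. s' = (R(16 := F + 5 * int (next_greater A m k)), M) \<and>
     t + 20 * depth A m k \<le> 20 * depth A m (Suc k) + 35)"
proof -
  define I where "I t s \<longleftrightarrow> k < t \<and> t \<le> m \<and> s = (R(16 := F + 5 * int t), M) \<and>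
      (\<forall>j. k < j \<and> j < t \<longrightarrow> A j \<le> A k)" for t :: nat and s
  let ?b = "And (Less (Reg 16) (Reg 12)) (Neg (Less (fld 15 off) (fld 16 off)))"
  have "R(16 := R 16) = R" by simp
  then have I0: "I (Suc k) (R, M)" using \<open>k < m\<close> F(3) by (simp add: I_def)
  have step: "halts (Assign 16 (fld 16 (off + 2))) s
      (\<lambda>u s'. \<exists>i'. I i' s' \<and> bcost ?b + 1 + u + 20 * depth A m i' \<le> 20 * depth A m t)"
    if I: "I t s" and b: "bval ?b s" for t s
  proof -
    have "t < m" "A t \<le> A k" using I b F A[of k] A[of t] \<open>k < m\<close> by (auto simp: I_def)
    moreover have "\<forall>j. k < j \<and> j < next_greater A m t \<longrightarrow> A j \<le> A k"
    proof (intro allI impI)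
      fix j assume j: "k < j \<and> j < next_greater A m t"
      show "A j \<le> A k"
      proof (cases "t < j")
        case True then show ?thesis using next_greater_below[of t j A m] j \<open>A t \<le> A k\<close> by auto
      next
        case False then show ?thesis using I \<open>A t \<le> A k\<close> j by (cases "j = t") (auto simp: I_def)
      qed
    qed
    ultimately show ?thesis
      using I N[of t] next_greater_gt[of t A m] next_greater_le[of t m A] depth.simps[of A m t]
      unfolding halts_simps by (intro exI[of _ "next_greater A m t"]) (auto simp: I_def add.assoc)
  qed
  obtain t s' i where e: "exec (next_greater_inner off) (R, M) t s'" and i: "I i s'" "\<not> bval ?b s'"
    "t + 20 * depth A m i \<le> 20 * depth A m (Suc k) + bcost ?b + 1"
    using halts_While[where I = I and \<Phi> = "\<lambda>i. 20 * depth A m i", OF I0 step] unfolding next_greater_inner_def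
    by (auto elim!: haltsE)
  have "i = m \<or> A k < A i"
    using i(1,2) F A[of k] A[of i] \<open>k < m\<close> by (cases "i = m") (auto simp: I_def)
  then have n: "next_greater A m k = i" using i(1) by (intro next_greater_eqI) (auto simp: I_def)
  then have "depth A m k = Suc (depth A m i)" using \<open>k < m\<close> by (simp add: depth.simps[of A m k])
  then show ?thesis using i n by (intro haltsI[OF e]) (simp add: I_def)
qed

text \<open>Working from right to left makes the links of all later pieces available. The potential
  \<open>70 * k + 20 * depth A m k\<close> pays for the inner loops; it is \<open>70 * m\<close> at
  the start, as index \<open>m\<close> has depth 0.\<close>

lemma next_greater_prog_halts:
  assumes F: "fst s 5 = F" "fst s 12 = F + 5 * int m" and off: "off = 1 \<or> off = 2"
    and A: "\<And>j. j < m \<Longrightarrow> snd s (F + 5 * int j + off) = A j"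
  shows "halts (next_greater_prog off) s (\<lambda>t s'. (\<forall>r. r \<noteq> 15 \<and> r \<noteq> 16 \<longrightarrow> fst s' r = fst s r) \<and>
      (\<forall>x. (\<forall>j<m. x \<noteq> F + 5 * int j + (off + 2)) \<longrightarrow> snd s' x = snd s x) \<and>
      (\<forall>j<m. snd s' (F + 5 * int j + (off + 2)) = F + 5 * int (next_greater A m j)) \<and> t \<le> 70 * m + 20)"
proof -
  define I where "I k s' \<longleftrightarrow> k \<le> m \<and> fst s' 15 = F + 5 * int k \<and>
      (\<forall>r. r \<noteq> 15 \<and> r \<noteq> 16 \<longrightarrow> fst s' r = fst s r) \<and>
      (\<forall>x. (\<forall>j<m. x \<noteq> F + 5 * int j + (off + 2)) \<longrightarrow> snd s' x = snd s x) \<and>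
      (\<forall>j. k \<le> j \<and> j < m \<longrightarrow> snd s' (F + 5 * int j + (off + 2)) = F + 5 * int (next_greater A m j))" for k s'
  let ?body = "Seq (Assign 15 (Minus (Reg 15) (Const 5)))
       (Seq (Assign 16 (Plus (Reg 15) (Const 5)))
       (Seq (next_greater_inner off) (Store (Plus (Reg 15) (Const (off + 2))) (Reg 16))))"
  let ?\<Phi> = "\<lambda>k. 70 * k + 20 * depth A m k"
  define s1 where "s1 = ((fst s)(15 := F + 5 * int m), snd s)"
  have I0: "I m s1" by (simp add: I_def s1_def)
  have step: "halts ?body s2 (\<lambda>u s'. \<exists>i'. I i' s' \<and> bcost (Less (Reg 5) (Reg 15)) + 1 + u + ?\<Phi> i' \<le> ?\<Phi> k')"
    if I: "I k' s2" and b: "bval (Less (Reg 5) (Reg 15)) s2" for k' s2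
  proof -
    have "0 < k'" using I b F by (auto simp: I_def)
    then obtain k where k: "k' = Suc k" by (cases k') auto
    have km: "k < m" using I k by (simp add: I_def)
    define R where "R = (fst s2)(15 := F + 5 * int k, 16 := F + 5 * int (Suc k))"
    define M where "M = snd s2"
    have A': "M (F + 5 * int j + off) = A j" if "j < m" for j
    proof -
      have "\<forall>i<m. F + 5 * int j + off \<noteq> F + 5 * int i + (off + 2)" by presburger
      then show ?thesis using I A[OF that] by (simp add: I_def M_def)
    qed
    have "halts (next_greater_inner off) (R, M) (\<lambda>t s'. s' = (R(16 := F + 5 * int (next_greater A m k)), M) \<and>
        t + 20 * depth A m k \<le> 20 * depth A m (Suc k) + 35)"
      by (rule next_greater_inner_halts) (use I F km k A' in \<open>auto simp: R_def M_def I_def\<close>)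
    then obtain t where t: "exec (next_greater_inner off) (R, M) t (R(16 := F + 5 * int (next_greater A m k)), M)"
      "t + 20 * depth A m k \<le> 20 * depth A m (Suc k) + 35" by (auto elim!: haltsE)
    have inj: "F + 5 * int j + (off + 2) = F + 5 * int k + (off + 2) \<longleftrightarrow> j = k" for j by auto
    have "I k (R(16 := F + 5 * int (next_greater A m k)), M(F + 5 * int k + (off + 2) := F + 5 * int (next_greater A m k)))"
      using I k km unfolding I_def M_def R_def by (auto simp: inj)
    moreover have "R 15 = F + 5 * int k" by (simp add: R_def)
    ultimately have "halts (Seq (next_greater_inner off) (Store (Plus (Reg 15) (Const (off + 2))) (Reg 16))) (R, M)
        (\<lambda>u s'. I k s' \<and> u + 20 * depth A m k \<le> 20 * depth A m (Suc k) + 40)"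
      unfolding halts_Seq using t(2) by (intro haltsI[OF t(1)]) (simp add: halts_simps)
    moreover have "((fst s2)(15 := fst s2 15 - 5, 16 := fst s2 15 - 5 + 5), snd s2) = (R, M)"
      using I k by (simp add: R_def M_def I_def add_ac)
    ultimately show ?thesis
      unfolding halts_Seq[of "Assign _ _"] halts_Assign aval.simps fst_conv snd_conv fun_upd_same
      using k by (auto elim!: halts_mono)
  qed
  obtain u s' k where e: "exec (While (Less (Reg 5) (Reg 15)) ?body) s1 u s'" and k: "I k s'"
    "\<not> bval (Less (Reg 5) (Reg 15)) s'" "u + ?\<Phi> k \<le> ?\<Phi> m + 4"
    using halts_While[where I = I and \<Phi> = ?\<Phi>, OF I0 step] by (auto elim!: haltsE)
  have "k = 0" using k(1,2) F by (auto simp: I_def)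
  moreover have "depth A m m = 0" by (simp add: depth.simps[of A m m])
  moreover have "exec (Assign 15 (Reg 12)) s 2 s1"
    using exec.Assign[of 15 "Reg 12" s] F by (simp add: s1_def eval_nat_numeral)
  then have "exec (next_greater_prog off) s (2 + u) s'" unfolding next_greater_prog_def using e by (rule exec.Seq)
  ultimately show ?thesis using k(1,3) unfolding I_def by (elim haltsI) auto
qed

section \<open>Scanning the pieces with a sliding window\<close>

text \<open>Registers 6 and 7 point to the first and the last piece of the window.\<close>

definition argmax_prog :: "nat \<Rightarrow> int \<Rightarrow> com" where
  "argmax_prog c off = Seq (Cond (Less (Reg c) (Reg 6)) (Assign c (Reg 6)) Skip)
     (While (Neg (Less (Reg 7) (fld c (off + 2)))) (Assign c (fld c (off + 2))))"

text \<open>A position that dominates everything before it in the window is a maximum as soon as its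
  next greater element lies beyond \<open>r\<close>. If the window has left \<open>i\<close> behind,
  the search restarts at \<open>k\<close>. The time is charged to the advance from \<open>i\<close>
  to \<open>i'\<close>, so it telescopes over the scan.\<close>

lemma argmax_prog_halts:
  assumes R: "R 6 = F + 5 * int k" "R 7 = F + 5 * int r" "R c = F + 5 * int i" "c \<noteq> 6" "c \<noteq> 7"
    and b: "k \<le> r" "r < m" "i \<le> r"
    and mx: "\<And>j. k \<le> j \<Longrightarrow> j < i \<Longrightarrow> A j \<le> A i"
    and N: "\<And>j. j < m \<Longrightarrow> M (F + 5 * int j + (off + 2)) = F + 5 * int (next_greater A m j)"
  shows "halts (argmax_prog c off) (R, M) (\<lambda>t s'. \<exists>i'. s' = (R(c := F + 5 * int i'), M) \<and> i \<le> i' \<and>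
     k \<le> i' \<and> i' \<le> r \<and> (\<forall>j. k \<le> j \<and> j \<le> r \<longrightarrow> A j \<le> A i') \<and> t + 20 * i \<le> 20 * i' + 20)"
proof -
  define I where "I i' s \<longleftrightarrow> s = (R(c := F + 5 * int i'), M) \<and> max i k \<le> i' \<and> i' \<le> r \<and>
     (\<forall>j. k \<le> j \<and> j < i' \<longrightarrow> A j \<le> A i')" for i' s
  let ?b = "Neg (Less (Reg 7) (fld c (off + 2)))"
  have "R(c := F + 5 * int i) = R" using R(3) by auto
  then have "halts (Cond (Less (Reg c) (Reg 6)) (Assign c (Reg 6)) Skip) (R, M) (\<lambda>t s'. t \<le> 6 \<and> I (max i k) s')"
    using R b mx unfolding halts_simps by (auto simp: I_def max_def)
  then obtain t s1 where e1: "exec (Cond (Less (Reg c) (Reg 6)) (Assign c (Reg 6)) Skip) (R, M) t s1"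
    and s1: "t \<le> 6" "I (max i k) s1" by (auto elim!: haltsE)
  have step: "halts (Assign c (fld c (off + 2))) s
      (\<lambda>u s'. \<exists>i''. I i'' s' \<and> bcost ?b + 1 + u + 20 * (r - i'') \<le> 20 * (r - i'))"
    if I: "I i' s" and bv: "bval ?b s" for i' s
  proof -
    have im: "i' < m" using I b by (auto simp: I_def)
    have n: "next_greater A m i' \<le> r" using I bv N[OF im] R(2,5) by (auto simp: I_def add.assoc)
    have "A i' < A (next_greater A m i')" using next_greater_stop[of m A i'] n b(2) by auto
    moreover have "A j \<le> A i'" if "k \<le> j" "j < next_greater A m i'" for j
    proof (cases "i' < j")
      case True then show ?thesis using next_greater_below that by blast
    next
      case False then show ?thesis using I that by (cases "j = i'") (auto simp: I_def)
    qed
    ultimately have *: "A j \<le> A (next_greater A m i')" if "k \<le> j" "j < next_greater A m i'" for j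
      using that by fastforce
    show ?thesis
      unfolding halts_simps using I N[OF im] n next_greater_gt[of i' A m] *
      by (intro exI[of _ "next_greater A m i'"]) (auto simp: I_def add.assoc)
  qed
  obtain u s' i' where e2: "exec (While ?b (Assign c (fld c (off + 2)))) s1 u s'"
    and i': "I i' s'" "\<not> bval ?b s'" "u + 20 * (r - i') \<le> 20 * (r - max i k) + bcost ?b + 1"
    using halts_While[where I = I and \<Phi> = "\<lambda>i. 20 * (r - i)", OF s1(2) step] by (auto elim!: haltsE)
  have im: "i' < m" using i' b by (auto simp: I_def)
  have n: "r < next_greater A m i'" using i' N[OF im] R(2,5) by (auto simp: I_def add.assoc)
  have "A j \<le> A i'" if "k \<le> j" "j \<le> r" for j
  proof (cases "i' < j")
    case True then show ?thesis using next_greater_below[of i' j A m] that n by simp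
  next
    case False then show ?thesis using i' that by (cases "j = i'") (auto simp: I_def)
  qed
  moreover have "t + u + 20 * i \<le> 20 * i' + 20" using i' s1 b by (auto simp: I_def)
  moreover have "exec (argmax_prog c off) (R, M) (t + u) s'" unfolding argmax_prog_def using e1 e2 by (rule exec.Seq)
  ultimately show ?thesis using i'(1) by (elim haltsI, intro exI[of _ i']) (auto simp: I_def)
qed

definition right_prog :: com where
  "right_prog = While (Less (fld 7 5) (Plus (Mem (Reg 6)) (Reg 3))) (Assign 7 (Plus (Reg 7) (Const 5)))"

text \<open>The test reads the abscissa of the following record, for \<open>r = m - 1\<close> that
  of the final record; since \<open>X k + w \<le> X m\<close>, the loop stops before index
  \<open>m\<close>.\<close>

lemma right_prog_halts:
  assumes R: "R 6 = F + 5 * int k" "R 7 = F + 5 * int r" "R 3 = w"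
    and M: "\<And>j. j \<le> m \<Longrightarrow> M (F + 5 * int j) = X j"
    and "k \<le> m" "r < m" "X r < X k + w" "X k + w \<le> X m"
  shows "halts right_prog (R, M) (\<lambda>t s'. \<exists>r'. s' = (R(7 := F + 5 * int r'), M) \<and> r \<le> r' \<and> r' < m \<and>
     X r' < X k + w \<and> X k + w \<le> X (Suc r') \<and> t + 20 * r \<le> 20 * r' + 20)"
proof -
  define I where "I r' s \<longleftrightarrow> s = (R(7 := F + 5 * int r'), M) \<and> r \<le> r' \<and> r' < m \<and> X r' < X k + w" for r' s
  let ?b = "Less (fld 7 5) (Plus (Mem (Reg 6)) (Reg 3))"
  have eq: "F + 5 * int j + 5 = F + 5 * int (Suc j)" for j by simp
  have "R(7 := F + 5 * int r) = R" using R(2) by auto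
  then have I0: "I r (R, M)" using assms by (simp add: I_def)
  have step: "halts (Assign 7 (Plus (Reg 7) (Const 5))) s
      (\<lambda>u s'. \<exists>i'. I i' s' \<and> bcost ?b + 1 + u + 20 * (m - i') \<le> 20 * (m - i))"
    if I: "I i s" and bv: "bval ?b s" for i s
  proof -
    have X: "X (Suc i) < X k + w"
      using I bv R assms(5) M[of "Suc i"] M[of k] by (auto simp: I_def eq simp del: of_nat_Suc)
    then have "Suc i < m" using I assms(8) by (cases "Suc i = m") (auto simp: I_def)
    then show ?thesis
      unfolding halts_simps using I X by (intro exI[of _ "Suc i"]) (auto simp: I_def)
  qed
  obtain t s' i where e: "exec right_prog (R, M) t s'" and i: "I i s'" "\<not> bval ?b s'"
    "t + 20 * (m - i) \<le> 20 * (m - r) + bcost ?b + 1"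
    using halts_While[where I = I and \<Phi> = "\<lambda>i. 20 * (m - i)", OF I0 step] unfolding right_prog_def
    by (auto elim!: haltsE)
  have "X k + w \<le> X (Suc i)"
    using i R assms(5) M[of "Suc i"] M[of k] by (auto simp: I_def eq simp del: of_nat_Suc)
  then show ?thesis using i by (intro haltsI[OF e] exI[of _ i]) (auto simp: I_def)
qed

text \<open>Integer comparisons \<open>\<le>\<close> appear as \<open><\<close> with 1 added.
  Offsets -4 and -3 from record \<open>k\<close> are the fields for \<open>L\<close> and
  \<open>- U\<close> of record \<open>k - 1\<close>; for \<open>k = 0\<close> they are read as well,
  but the comparison of registers 5 and 6 makes their values irrelevant.\<close>

definition emit_prog :: com where
  "emit_prog = Cond
     (And (Less (Plus (Plus (fld 9 2) (fld 8 1)) (Reg 4)) (Const 1))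
       (Neg (And (Less (Reg 5) (Reg 6))
         (And (Less (fld 6 (-4)) (Plus (fld 8 1) (Const 1)))
           (Less (Plus (Plus (fld 6 (-3)) (fld 8 1)) (Reg 4)) (Const 1))))))
     (Seq (Store (Reg 10) (Mem (Reg 6)))
     (Seq (Store (Plus (Reg 10) (Const 1)) (fld 8 1))
     (Seq (Assign 10 (Plus (Reg 10) (Const 2)))
       (Assign 11 (Plus (Reg 11) (Const 1))))))
     Skip"

definition scan_prog :: com where
  "scan_prog =
     Seq (Assign 6 (Reg 5)) (Seq (Assign 7 (Reg 5)) (Seq (Assign 8 (Reg 5)) (Seq (Assign 9 (Reg 5))
     (Seq (Assign 10 (Plus (Reg 12) (Const 5))) (Seq (Assign 11 (Const 0))
     (Seq (While (Neg (Less (Reg 14) (Plus (Mem (Reg 6)) (Reg 3))))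
        (Seq right_prog (Seq (argmax_prog 8 1) (Seq (argmax_prog 9 2)
        (Seq emit_prog (Assign 6 (Plus (Reg 6) (Const 5))))))))
     (Seq (Assign 0 (Plus (Reg 12) (Const 5))) (Assign 1 (Reg 11)))))))))"


text \<open>The integer form of \<open>stable_at\<close>, in which the program is verified.\<close>

definition stable_pair :: "(nat \<Rightarrow> int) \<Rightarrow> (nat \<Rightarrow> int) \<Rightarrow> (nat \<Rightarrow> int) \<Rightarrow> nat \<Rightarrow> int \<Rightarrow> int \<Rightarrow> nat \<Rightarrow> int \<Rightarrow> bool" where
  "stable_pair X L U m w h k y \<longleftrightarrow> X k + w \<le> X m \<and>
     (\<forall>j. k \<le> j \<and> j < m \<and> X j < X k + w \<longrightarrow> L j \<le> y \<and> y + h \<le> U j) \<and>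
     (\<exists>j. (k \<le> j \<and> j < m \<and> X j < X k + w) \<and> L j = y) \<and>
     (k = 0 \<or> y < L (k - 1) \<or> U (k - 1) < y + h)"

lemma emit_prog_halts:
  fixes F P :: int and k c d :: nat
  assumes R: "R 4 = h" "R 5 = F" "R 6 = F + 5 * int k" "R 8 = F + 5 * int c" "R 9 = F + 5 * int d" "R 10 = P"
    and M: "M (F + 5 * int k) = x" "M (F + 5 * int c + 1) = y" "M (F + 5 * int d + 2) = - z"
      "0 < k \<Longrightarrow> M (F + 5 * int k - 4) = l" "0 < k \<Longrightarrow> M (F + 5 * int k - 3) = - u"
    and P: "F + 5 * int c + 1 < P"
  shows "halts emit_prog (R, M) (\<lambda>t s'. t \<le> 65 \<and> s' =
     (if y + h \<le> z \<and> (k = 0 \<or> y < l \<or> u < y + h)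
      then (R(10 := P + 2, 11 := R 11 + 1), M(P := x, P + 1 := y)) else (R, M)))"
proof -
  have c: "M (F + 5 * int d + 2) + M (F + 5 * int c + 1) + h < 1 \<longleftrightarrow> y + h \<le> z" using M by auto
  have c2: "F < F + 5 * int k \<and> M (F + 5 * int k + -4) < M (F + 5 * int c + 1) + 1 \<and>
      M (F + 5 * int k + -3) + M (F + 5 * int c + 1) + h < 1 \<longleftrightarrow> 0 < k \<and> l \<le> y \<and> y + h \<le> u"
    using M by auto
  have ne: "F + 5 * int c + 1 \<noteq> P" using P by simp
  show ?thesis unfolding emit_prog_def halts_simps bval.simps aval.simps fst_conv snd_conv R c c2
    using M ne by (auto simp: R)
qed

lemma scan_prog_halts:
  assumes regs: "fst s 3 = w" "fst s 4 = h" "fst s 5 = F" "fst s 12 = F + 5 * int m" "fst s 14 = X m"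
    and mem: "\<And>k. k \<le> m \<Longrightarrow> snd s (F + 5 * int k) = X k"
      "\<And>k. k < m \<Longrightarrow> snd s (F + 5 * int k + 1) = L k" "\<And>k. k < m \<Longrightarrow> snd s (F + 5 * int k + 2) = - U k"
      "\<And>k. k < m \<Longrightarrow> snd s (F + 5 * int k + 3) = F + 5 * int (next_greater L m k)"
      "\<And>k. k < m \<Longrightarrow> snd s (F + 5 * int k + 4) = F + 5 * int (next_greater (\<lambda>k. - U k) m k)"
    and X: "\<And>k. k < m \<Longrightarrow> X k < X (Suc k)" and w: "0 < w" and m: "0 < m"
  shows "halts scan_prog s (\<lambda>t s'. t \<le> 210 * m + 40 \<and>
     (\<exists>ps. distinct ps \<and> set ps = {(X k, y) | k y. k < m \<and> stable_pair X L U m w h k y} \<and>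
        fst s' 1 = int (length ps) \<and>
        (\<forall>i<length ps. ps ! i = (snd s' (fst s' 0 + 2 * int i), snd s' (fst s' 0 + 2 * int i + 1)))))"
    (is "halts _ _ ?Q")
proof -
  have Xmono: "i < j \<Longrightarrow> j \<le> m \<Longrightarrow> X i < X j" for i j
  proof (induction j)
    case (Suc j)
    then show ?case using X[of j] by (cases "i = j") auto
  qed simp
  define V where "V k = - U k" for k
  define B where "B = F + 5 * int m + 5"
  define out where "out M ps \<longleftrightarrow> (\<forall>i<length ps. ps ! i = (M (B + 2 * int i), M (B + 2 * int i + 1)))"
    for M :: "int \<Rightarrow> int" and ps :: "(int \<times> int) list"
  define I where "I = (\<lambda>(k, r, c, d, ps) (s' :: state).
      fst s' 3 = w \<and> fst s' 4 = h \<and> fst s' 5 = F \<and> fst s' 12 = F + 5 * int m \<and> fst s' 14 = X m \<and>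
      fst s' 6 = F + 5 * int k \<and> fst s' 7 = F + 5 * int r \<and> fst s' 8 = F + 5 * int c \<and> fst s' 9 = F + 5 * int d \<and>
      fst s' 10 = B + 2 * int (length ps) \<and> fst s' 11 = int (length ps) \<and>
      (\<forall>x<B. snd s' x = snd s x) \<and> out (snd s') ps \<and>
      k \<le> m \<and> r < m \<and> X r < X k + w \<and> c \<le> r \<and> d \<le> r \<and>
      (\<forall>j. k \<le> j \<and> j < c \<longrightarrow> L j \<le> L c) \<and> (\<forall>j. k \<le> j \<and> j < d \<longrightarrow> V j \<le> V d) \<and>
      distinct ps \<and> set ps = {(X j, y) | j y. j < k \<and> stable_pair X L U m w h j y})"
  \<comment> \<open>Each of the three pointers pays 20 per position for its advance; 150 per window
    covers three fixed amounts of 20, the 65 of \<open>emit_prog\<close>, the loop test and the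
    increment.\<close>
  define \<Phi> where "\<Phi> = (\<lambda>(k, r, c, d, ps :: (int \<times> int) list). 150 * (m - k) + 20 * (m - r) + 20 * (m - c) + 20 * (m - d))"
  let ?b = "Neg (Less (Reg 14) (Plus (Mem (Reg 6)) (Reg 3)))"
  let ?body = "Seq right_prog (Seq (argmax_prog 8 1) (Seq (argmax_prog 9 2)
        (Seq emit_prog (Assign 6 (Plus (Reg 6) (Const 5))))))"
  define s1 where "s1 = ((fst s)(6 := F, 7 := F, 8 := F, 9 := F, 10 := B, 11 := 0), snd s)"
  have step: "halts ?body s' (\<lambda>t s''. \<exists>i'. I i' s'' \<and> bcost ?b + 1 + t + \<Phi> i' \<le> \<Phi> i)"
    if I: "I i s'" and b: "bval ?b s'" for i s'
  proof -
    obtain k r c d ps where i: "i = (k, r, c, d, ps)" by (cases i) auto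
    obtain R M where s': "s' = (R, M)" by (cases s')
    have regs': "R 3 = w" "R 4 = h" "R 5 = F" "R 12 = F + 5 * int m" "R 14 = X m"
      "R 6 = F + 5 * int k" "R 7 = F + 5 * int r" "R 8 = F + 5 * int c" "R 9 = F + 5 * int d"
      "R 10 = B + 2 * int (length ps)" "R 11 = int (length ps)"
      and old: "\<And>x. x < B \<Longrightarrow> M x = snd s x" and out: "out M ps"
      and idx: "k \<le> m" "r < m" "X r < X k + w" "c \<le> r" "d \<le> r"
      and mxL: "\<And>j. k \<le> j \<Longrightarrow> j < c \<Longrightarrow> L j \<le> L c" and mxV: "\<And>j. k \<le> j \<Longrightarrow> j < d \<Longrightarrow> V j \<le> V d"
      and ps: "distinct ps" "set ps = {(X j, y) | j y. j < k \<and> stable_pair X L U m w h j y}"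
      using I unfolding i s' I_def by auto
    have mem': "\<And>k. k \<le> m \<Longrightarrow> M (F + 5 * int k) = X k"
      "\<And>k. k < m \<Longrightarrow> M (F + 5 * int k + 1) = L k" "\<And>k. k < m \<Longrightarrow> M (F + 5 * int k + 2) = V k"
      "\<And>k. k < m \<Longrightarrow> M (F + 5 * int k + (1 + 2)) = F + 5 * int (next_greater L m k)"
      "\<And>k. k < m \<Longrightarrow> M (F + 5 * int k + (2 + 2)) = F + 5 * int (next_greater V m k)"
      using old mem by (auto simp: B_def V_def[abs_def])
    have kw: "X k + w \<le> X m" using b regs' mem'(1)[OF idx(1)] by (simp add: s')
    then have km: "k < m" using idx(1) w by (cases "k = m") auto
    obtain t1 r' where e1: "exec right_prog (R, M) t1 (R(7 := F + 5 * int r'), M)" and r': "r \<le> r'" "r' < m"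
      "X r' < X k + w" "X k + w \<le> X (Suc r')" and t1: "t1 + 20 * r \<le> 20 * r' + 20"
      using right_prog_halts[OF regs'(6,7,1) mem'(1) idx(1-3) kw] by (auto elim!: haltsE)
    have kr: "k \<le> r'"
    proof (rule ccontr)
      assume "\<not> k \<le> r'"
      then have "X (Suc r') \<le> X k" using Xmono[of "Suc r'" k] idx(1) by (cases "Suc r' = k") auto
      then show False using r'(4) w by simp
    qed
    \<comment> \<open>The pieces below a rectangle at \<open>X k\<close> are exactly those from
      \<open>k\<close> to \<open>r'\<close>, so extrema over this index range decide
      stability.\<close>
    have win: "k \<le> j \<and> j < m \<and> X j < X k + w \<longleftrightarrow> k \<le> j \<and> j \<le> r'" for j
    proof (cases "j \<le> r'")
      case True
      then show ?thesis using r' Xmono[of j r'] by (cases "j = r'") auto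
    next
      case False
      then show ?thesis using r'(4) Xmono[of "Suc r'" j] by (cases "j = Suc r'") auto
    qed
    have "halts (argmax_prog 8 1) (R(7 := F + 5 * int r'), M)
       (\<lambda>t s'. \<exists>i'. s' = ((R(7 := F + 5 * int r'))(8 := F + 5 * int i'), M) \<and> c \<le> i' \<and>
       k \<le> i' \<and> i' \<le> r' \<and> (\<forall>j. k \<le> j \<and> j \<le> r' \<longrightarrow> L j \<le> L i') \<and> t + 20 * c \<le> 20 * i' + 20)"
      by (rule argmax_prog_halts[where m=m]) (use regs' kr r' idx mxL mem' in auto)
    then obtain t2 c' where e2: "exec (argmax_prog 8 1) (R(7 := F + 5 * int r'), M) t2
        ((R(7 := F + 5 * int r'))(8 := F + 5 * int c'), M)" and c': "c \<le> c'" "k \<le> c'" "c' \<le> r'"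
      and mL: "\<And>j. k \<le> j \<Longrightarrow> j \<le> r' \<Longrightarrow> L j \<le> L c'" and t2: "t2 + 20 * c \<le> 20 * c' + 20"
      by (elim haltsE exE conjE) blast
    define R3 where "R3 = R(7 := F + 5 * int r', 8 := F + 5 * int c')"
    have "halts (argmax_prog 9 2) (R3, M) (\<lambda>t s'. \<exists>i'. s' = (R3(9 := F + 5 * int i'), M) \<and> d \<le> i' \<and>
       k \<le> i' \<and> i' \<le> r' \<and> (\<forall>j. k \<le> j \<and> j \<le> r' \<longrightarrow> V j \<le> V i') \<and> t + 20 * d \<le> 20 * i' + 20)"
      by (rule argmax_prog_halts[where m=m]) (use regs' kr r' idx mxV mem' in \<open>auto simp: R3_def\<close>)
    then obtain t3 d' where e3: "exec (argmax_prog 9 2) (R3, M) t3 (R3(9 := F + 5 * int d'), M)"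
      and d': "d \<le> d'" "k \<le> d'" "d' \<le> r'"
      and mV: "\<And>j. k \<le> j \<Longrightarrow> j \<le> r' \<Longrightarrow> V j \<le> V d'" and t3: "t3 + 20 * d \<le> 20 * d' + 20"
      by (elim haltsE exE conjE) blast
    define R4 where "R4 = R(7 := F + 5 * int r', 8 := F + 5 * int c', 9 := F + 5 * int d')"
    define P where "P = B + 2 * int (length ps)"
    define ok where "ok \<longleftrightarrow> L c' + h \<le> U d' \<and> (k = 0 \<or> L c' < L (k - 1) \<or> U (k - 1) < L c' + h)"
    have stable: "stable_pair X L U m w h k y \<longleftrightarrow> ok \<and> y = L c'" for y
    proof -
      have U: "\<And>j. k \<le> j \<Longrightarrow> j \<le> r' \<Longrightarrow> U d' \<le> U j" using mV by (auto simp: V_def)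
      have "stable_pair X L U m w h k y \<longleftrightarrow>
         (\<forall>j. k \<le> j \<and> j \<le> r' \<longrightarrow> L j \<le> y \<and> y + h \<le> U j) \<and> (\<exists>j. (k \<le> j \<and> j \<le> r') \<and> L j = y) \<and>
         (k = 0 \<or> y < L (k - 1) \<or> U (k - 1) < y + h)" (is "_ \<longleftrightarrow> ?rhs")
        unfolding stable_pair_def win using kw by simp
      also have "?rhs \<longleftrightarrow> ok \<and> y = L c'"
      proof
        assume a: ?rhs
        then have 1: "L c' \<le> y" "y + h \<le> U d'" using c' d' by auto
        from a obtain j where "k \<le> j" "j \<le> r'" "L j = y" by auto
        then have "y \<le> L c'" using mL by auto
        with 1 have "y = L c'" by simp
        then show "ok \<and> y = L c'" using a 1 by (simp add: ok_def)
      next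
        assume a: "ok \<and> y = L c'"
        then have "y + h \<le> U j" if "k \<le> j" "j \<le> r'" for j using U[OF that] by (simp add: ok_def)
        then show ?rhs using a mL c' by (auto simp: ok_def)
      qed
      finally show ?thesis .
    qed
    have "halts emit_prog (R4, M) (\<lambda>t s'. t \<le> 65 \<and> s' =
       (if L c' + h \<le> U d' \<and> (k = 0 \<or> L c' < L (k - 1) \<or> U (k - 1) < L c' + h)
        then (R4(10 := P + 2, 11 := R4 11 + 1), M(P := X k, P + 1 := L c')) else (R4, M)))"
    proof (rule emit_prog_halts)
      have "c' < m" "d' < m" using c' d' r' by auto
      then show "M (F + 5 * int c' + 1) = L c'" "M (F + 5 * int d' + 2) = - U d'" "F + 5 * int c' + 1 < P"
        using mem' by (auto simp: P_def B_def V_def)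
      show "M (F + 5 * int k - 4) = L (k - 1)" "M (F + 5 * int k - 3) = - U (k - 1)" if "0 < k"
        using mem'(2,3)[of "k - 1"] that km by (auto simp: V_def of_nat_diff algebra_simps)
    qed (use regs' mem'(1)[OF idx(1)] in \<open>auto simp: R4_def P_def\<close>)
    then obtain t4 s5 where e4: "exec emit_prog (R4, M) t4 s5" and t4: "t4 \<le> 65"
      and s5: "s5 = (if ok then (R4(10 := P + 2, 11 := R4 11 + 1), M(P := X k, P + 1 := L c')) else (R4, M))"
      unfolding ok_def by (elim haltsE conjE)
    define ps' where "ps' = (if ok then ps @ [(X k, L c')] else ps)"
    have set': "set ps' = {(X j, y) | j y. j < Suc k \<and> stable_pair X L U m w h j y}"
    proof -
      have "{(X j, y) | j y. j < Suc k \<and> stable_pair X L U m w h j y} =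
         set ps \<union> {(X k, y) | y. stable_pair X L U m w h k y}"
        unfolding ps(2) by (auto simp: less_Suc_eq)
      also have "{(X k, y) | y. stable_pair X L U m w h k y} = (if ok then {(X k, L c')} else {})"
        unfolding stable by auto
      finally show ?thesis by (auto simp: ps'_def)
    qed
    have "(X k, L c') \<notin> set ps" unfolding ps(2) using Xmono[OF _ idx(1)] by fastforce
    then have dist': "distinct ps'" using ps(1) by (simp add: ps'_def)
    have out': "out (M(P := X k, P + 1 := L c')) (ps @ [(X k, L c')])"
      using out unfolding out_def P_def by (auto simp: nth_append less_Suc_eq)
    have XX: "X r' < X (Suc k) + w" using r'(3) X[OF km] by simp
    have I': "I (Suc k, r', c', d', ps') ((fst s5)(6 := fst s5 6 + 5), snd s5)"
      unfolding I_def prod.case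
      using s5 regs' old out out' idx km r' c' d' mL mV set' dist' XX
      by (cases ok) (auto simp: R4_def ps'_def P_def)
    have "bcost ?b + 1 + (t1 + (t2 + (t3 + (t4 + 4)))) + \<Phi> (Suc k, r', c', d', ps') \<le> \<Phi> i"
    proof -
      have "m - k = Suc (m - Suc k)" "m - r = (m - r') + (r' - r)" "m - c = (m - c') + (c' - c)"
        "m - d = (m - d') + (d' - d)" using km r' c' d' by auto
      moreover have "t1 \<le> 20 * (r' - r) + 20" "t2 \<le> 20 * (c' - c) + 20" "t3 \<le> 20 * (d' - d) + 20" "t4 \<le> 65"
        using t1 t2 t3 t4 r' c' d' by (auto simp: diff_mult_distrib2)
      ultimately show ?thesis unfolding \<Phi>_def i by simp
    qed
    moreover have "exec ?body s' (t1 + (t2 + (t3 + (t4 + 4)))) ((fst s5)(6 := fst s5 6 + 5), snd s5)"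
      using e1 e2 e3 e4 exec.Assign[of 6 "Plus (Reg 6) (Const 5)" s5]
      unfolding s' R3_def R4_def by (intro exec.Seq) (simp_all add: eval_nat_numeral)
    ultimately show ?thesis using I' by (intro haltsI exI conjI)
  qed
  have I0: "I (0, 0, 0, 0, []) s1"
    using regs m w by (auto simp: I_def s1_def B_def out_def)
  obtain t s2 k r c d ps where e: "exec (While ?b ?body) s1 t s2" and I: "I (k, r, c, d, ps) s2"
    and b: "\<not> bval ?b s2" and t: "t \<le> 210 * m + 8"
    using halts_While[where I = I and \<Phi> = \<Phi>, OF I0 step] by (auto elim!: haltsE simp: \<Phi>_def)
  have k: "k \<le> m" using I by (simp add: I_def)
  have "snd s2 (F + 5 * int k) = X k" using I k mem(1)[of k] by (simp add: I_def B_def)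
  then have "X m < X k + w" using b I by (simp add: I_def)
  \<comment> \<open>If the rectangle placed at \<open>X k\<close> sticks out to the right, so does
    every later one; stopping early loses no location.\<close>
  then have no: "\<not> stable_pair X L U m w h j y" if "k \<le> j" "j < m" for j y
    using Xmono[of k j] that by (cases "j = k") (auto simp: stable_pair_def)
  have "j < k \<and> stable_pair X L U m w h j y \<longleftrightarrow> j < m \<and> stable_pair X L U m w h j y" for j y
    using no[of j y] k by (cases "j < k") auto
  moreover have "set ps = {(X j, y) | j y. j < k \<and> stable_pair X L U m w h j y}" using I by (simp add: I_def)
  ultimately have set: "set ps = {(X k, y) | k y. k < m \<and> stable_pair X L U m w h k y}" by simp
  have ps: "fst s2 11 = int (length ps)" "fst s2 12 + 5 = B" "distinct ps" "out (snd s2) ps"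
    using I by (auto simp: I_def B_def)
  let ?rest = "Seq (Assign 0 (Plus (Reg 12) (Const 5))) (Assign 1 (Reg 11))"
  have "halts (Seq (While ?b ?body) ?rest) s1 (\<lambda>t s'. ?Q (t + 14) s')"
    unfolding halts_Seq by (rule haltsI[OF e]) (use t set ps in \<open>auto simp: halts_simps out_def intro!: exI[of _ ps]\<close>)
  then show ?thesis unfolding scan_prog_def halts_Seq[of "Assign _ _"] halts_Assign
    by (simp add: s1_def B_def regs add_ac)
qed

section \<open>Merging the two boundary chains\<close>

definition plateau_end :: "int \<Rightarrow> (int \<Rightarrow> int) \<Rightarrow> int \<Rightarrow> int" where
  "plateau_end b f x = x + int (LEAST n. 0 < n \<and> (b \<le> x + int n \<or> f (x + int n) \<noteq> f x))"

lemma plateau_end: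
  assumes "x < b"
  shows "x < plateau_end b f x" "plateau_end b f x \<le> b"
    "plateau_end b f x = b \<or> f (plateau_end b f x) \<noteq> f x"
    "\<And>i. x \<le> i \<Longrightarrow> i < plateau_end b f x \<Longrightarrow> f i = f x"
proof -
  let ?P = "\<lambda>n. 0 < n \<and> (b \<le> x + int n \<or> f (x + int n) \<noteq> f x)"
  have P: "?P (nat (b - x))" using assms by simp
  have L: "?P (Least ?P)" by (rule LeastI[where P = ?P, OF P])
  have le: "Least ?P \<le> nat (b - x)" by (rule Least_le[where P = ?P, OF P])
  show "x < plateau_end b f x" "plateau_end b f x \<le> b"
    using L le assms unfolding plateau_end_def by auto
  show "plateau_end b f x = b \<or> f (plateau_end b f x) \<noteq> f x"
    using L le assms unfolding plateau_end_def by auto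
  show "f i = f x" if "x \<le> i" "i < plateau_end b f x" for i
  proof (cases "i = x")
    case False
    then have "nat (i - x) < Least ?P" using that unfolding plateau_end_def by simp
    from not_less_Least[OF this] show ?thesis using False that by auto
  qed simp
qed

text \<open>Used when one chain produces a breakpoint inside a plateau of the other: the pointer
  into that other chain remains correct.\<close>

lemma plateau_end_same:
  assumes "x < b" "x \<le> x'" "x' < plateau_end b f x"
  shows "plateau_end b f x' = plateau_end b f x" "f x' = f x"
proof -
  note e = plateau_end[OF assms(1), where f = f]
  have "x' < b" using assms(3) e(2) by simp
  note e' = plateau_end[OF this, where f = f]
  show fx: "f x' = f x" by (rule e(4)[OF assms(2,3)])
  have "\<not> plateau_end b f x' < plateau_end b f x"
  proof
    assume l: "plateau_end b f x' < plateau_end b f x"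
    then have "f (plateau_end b f x') = f x" using e'(1) assms(2) by (intro e(4)) auto
    then show False using e'(3) l e(2) fx by auto
  qed
  moreover have "\<not> plateau_end b f x < plateau_end b f x'"
  proof
    assume l: "plateau_end b f x < plateau_end b f x'"
    then have "f (plateau_end b f x) = f x'" using assms(3) by (intro e'(4)) auto
    then show False using e(3) l e'(2) fx by auto
  qed
  ultimately show "plateau_end b f x' = plateau_end b f x" by simp
qed

text \<open>The direction \<open>d\<close> is the offset of the pointer field in a list node: 2 is forward, 3 backward,
  and \<open>5 - d\<close> is the opposite direction.\<close>

definition neighbour :: "nat \<Rightarrow> int \<Rightarrow> nat \<Rightarrow> nat" where
  "neighbour n d i = (if d = 2 then Suc i mod n else (i + n - 1) mod n)"

lemma neighbour_less: "i < n \<Longrightarrow> neighbour n d i < n"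
  by (simp add: neighbour_def)

lemma mod_pred_Suc: "j < n \<Longrightarrow> (Suc j mod n + n - 1) mod n = j"
  by (cases "Suc j = n") auto

lemma mod_Suc_pred: "j < n \<Longrightarrow> Suc ((j + n - 1) mod n) mod n = j"
  by (cases j) (auto simp: mod_Suc)

lemma neighbour_opposite: "i < n \<Longrightarrow> d = 2 \<or> d = 3 \<Longrightarrow> neighbour n (5 - d) (neighbour n d i) = i"
  using mod_pred_Suc[of i n] mod_Suc_pred[of i n] by (auto simp: neighbour_def)

text \<open>A segment determines its pair of ends, and the list is distinct, so an edge at
  \<open>vs ! i\<close> joins it to one of its two cyclic neighbours.\<close>

lemma boundary_edge_neighbour:
  assumes "boundary_order J vs" "is_edge J (vs ! i) z" "i < length vs"
  shows "z = vs ! neighbour (length vs) 2 i \<or> z = vs ! neighbour (length vs) 3 i"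
proof -
  let ?n = "length vs"
  have "closed_segment (vs ! i) z \<in> edges J" using assms(2) by (simp add: is_edge_def)
  then obtain j where j: "j < ?n" "closed_segment (vs ! i) z = closed_segment (vs ! j) (vs ! (Suc j mod ?n))"
    using assms(1) unfolding boundary_order_def by auto
  then have eq: "{vs ! i, z} = {vs ! j, vs ! (Suc j mod ?n)}" by simp
  have d: "distinct vs" using assms(1) by (simp add: boundary_order_def)
  have j': "Suc j mod ?n < ?n" by (rule mod_less_divisor) (use j(1) in linarith)
  consider "vs ! i = vs ! j" "z = vs ! (Suc j mod ?n)" | "vs ! i = vs ! (Suc j mod ?n)" "z = vs ! j"
    using eq by (metis doubleton_eq_iff)
  then show ?thesis
  proof cases
    case 1
    then have "i = j" using d assms(3) j(1) by (simp add: nth_eq_iff_index_eq)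
    then show ?thesis using 1 by (simp add: neighbour_def)
  next
    case 2
    then have "i = Suc j mod ?n" using d assms(3) j' by (simp add: nth_eq_iff_index_eq)
    then show ?thesis using 2 mod_pred_Suc[OF j(1)] by (simp add: neighbour_def)
  qed
qed

lemma boundary_edge_vertex:
  assumes "boundary_order J vs" "is_edge J p q"
  shows "p \<in> vertices J"
proof -
  have "closed_segment p q \<in> edges J" using assms(2) by (simp add: is_edge_def)
  then obtain j where j: "j < length vs" "closed_segment p q = closed_segment (vs ! j) (vs ! (Suc j mod length vs))"
    using assms(1) unfolding boundary_order_def by auto
  then have "p \<in> {vs ! j, vs ! (Suc j mod length vs)}" by auto
  moreover have "Suc j mod length vs < length vs" by (rule mod_less_divisor) (use j(1) in linarith)
  ultimately have "p \<in> set vs" using j(1) by auto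
  then show ?thesis using assms(1) by (simp add: boundary_order_def)
qed

section \<open>Breakpoints of the two staircases\<close>

context staircase_hole
begin

abbreviation "pe \<equiv> plateau_end b"

text \<open>Each step goes to the nearer of the two plateau ends, which is the merge of both chains.
  After reaching \<open>b\<close> the sequence stays there.\<close>

primrec X :: "nat \<Rightarrow> int" where
  "X 0 = a"
| "X (Suc k) = (if X k < b then min (pe lo (X k)) (pe up (X k)) else b)"

declare X.simps(2) [simp del]

definition m :: nat where "m = (LEAST k. X k = b)"

lemma X_le_b: "X k \<le> b"
proof (cases k)
  case (Suc l)
  then show ?thesis using plateau_end(2)[where x = "X l" and f = lo and b = b] by (auto simp: X.simps(2) min_le_iff_disj)
qed (use ab in simp)

text \<open>Every step gains at least 1 until \<open>b\<close> is reached, which proves that the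
  index \<open>m\<close> exists.\<close>

lemma X_ge: "min b (a + int k) \<le> X k"
proof (induction k)
  case (Suc k)
  then show ?case using plateau_end(1)[where x = "X k" and f = lo and b = b] plateau_end(1)[where x = "X k" and f = up and b = b] by (auto simp: X.simps(2))
qed simp

lemma X_m: "X m = b"
proof -
  have "X (nat (b - a)) = b" using X_ge[of "nat (b - a)"] X_le_b[of "nat (b - a)"] ab by simp
  then show ?thesis unfolding m_def by (rule LeastI)
qed

lemma X_less_b: "k < m \<Longrightarrow> X k < b"
  using not_less_Least[of k "\<lambda>k. X k = b"] X_le_b[of k] by (simp add: m_def less_le)

lemma m_pos: "0 < m"
  using X_m ab by (intro Nat.gr0I) auto

lemma X_Suc: "k < m \<Longrightarrow> X (Suc k) = min (pe lo (X k)) (pe up (X k))"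
  using X_less_b by (simp add: X.simps(2))

lemma X_increasing: "k < m \<Longrightarrow> X k < X (Suc k)"
  using X_Suc[of k] plateau_end(1)[OF X_less_b[of k], where f = lo] plateau_end(1)[OF X_less_b[of k], where f = up] by auto

lemma X_strict: "i < j \<Longrightarrow> j \<le> m \<Longrightarrow> X i < X j"
proof (induction j)
  case (Suc j)
  then show ?case using X_increasing[of j] by (cases "i = j") auto
qed simp

lemma X_ge_a: "a \<le> X k"
  using X_ge[of k] ab by auto

lemma piece_const:
  assumes "k < m" "X k \<le> i" "i < X (Suc k)"
  shows "lo i = lo (X k)" "up i = up (X k)"
proof -
  have "i < pe lo (X k)" "i < pe up (X k)" using assms(3) X_Suc[OF assms(1)] by auto
  then show "lo i = lo (X k)" "up i = up (X k)"
    using assms(2) by (auto intro!: plateau_end(4)[OF X_less_b[OF assms(1)]])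
qed

lemma locate_piece:
  assumes "a \<le> i" "i < b"
  obtains k where "k < m" "X k \<le> i" "i < X (Suc k)"
proof -
  define k where "k = (LEAST k. i < X (Suc k))"
  obtain n where n: "m = Suc n" using m_pos by (cases m) auto
  have in': "i < X (Suc n)" using assms(2) X_m n by simp
  have "i < X (Suc k)" unfolding k_def by (rule LeastI[where P = "\<lambda>k. i < X (Suc k)", OF in'])
  moreover have "k \<le> n" unfolding k_def by (rule Least_le[where P = "\<lambda>k. i < X (Suc k)", OF in'])
  moreover have "X k \<le> i"
  proof (cases k)
    case (Suc l)
    then show ?thesis using not_less_Least[of l "\<lambda>k. i < X (Suc k)"] by (auto simp: k_def[symmetric])
  qed (use assms in auto)
  ultimately show thesis using that[of k] n by simp
qed

lemma hole_pieces:
  "J \<union> inside J = (\<Union>k<m. {real_of_int (X k)..real_of_int (X (Suc k))} \<times> {real_of_int (lo (X k))..real_of_int (up (X k))})"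
proof (intro set_eqI iffI)
  fix p assume "p \<in> J \<union> inside J"
  then obtain i where i: "a \<le> i" "i < b" "p \<in> {of_int i..of_int i + 1} \<times> {of_int (lo i)..of_int (up i)}"
    unfolding hole_columns by auto
  obtain k where k: "k < m" "X k \<le> i" "i < X (Suc k)" using locate_piece[OF i(1,2)] by blast
  have "real_of_int (X k) \<le> of_int i" "real_of_int i + 1 \<le> of_int (X (Suc k))" using k(2,3) by linarith+
  then have "p \<in> {real_of_int (X k)..real_of_int (X (Suc k))} \<times> {real_of_int (lo (X k))..real_of_int (up (X k))}"
    using i(3) piece_const[OF k] by (auto)
  then show "p \<in> (\<Union>k<m. {real_of_int (X k)..real_of_int (X (Suc k))} \<times> {real_of_int (lo (X k))..real_of_int (up (X k))})"
    using k(1) by blast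
next
  fix p :: pt
  assume "p \<in> (\<Union>k<m. {real_of_int (X k)..real_of_int (X (Suc k))} \<times> {real_of_int (lo (X k))..real_of_int (up (X k))})"
  then obtain k where k: "k < m" and p: "of_int (X k) \<le> fst p" "fst p \<le> of_int (X (Suc k))"
    "of_int (lo (X k)) \<le> snd p" "snd p \<le> of_int (up (X k))" by (auto)
  define i where "i = min \<lfloor>fst p\<rfloor> (X (Suc k) - 1)"
  have i: "X k \<le> i" "i < X (Suc k)" "of_int i \<le> fst p" "fst p \<le> of_int i + 1"
    using p(1,2) X_increasing[OF k] unfolding i_def by (auto simp: le_floor_iff min_def, linarith+)
  have "a \<le> i" "i < b" using i X_ge_a[of k] X_le_b[of "Suc k"] by (auto)
  then show "p \<in> J \<union> inside J" unfolding hole_columns using i p(3,4) piece_const[OF k i(1,2)]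
    by (auto simp: mem_Times_iff intro!: bexI[of _ i])
qed

text \<open>At an inner breakpoint at least one staircase changes height, and the vertical edge of
  that step ends in vertices; the two outer breakpoints carry the left and right edges.\<close>

lemma breakpoint_vertex:
  assumes "boundary_order J vs" "k \<le> m"
  shows "\<exists>y. (of_int (X k), y) \<in> vertices J"
proof -
  consider "k = 0" | "k = m" | "0 < k" "k < m" using assms(2) by linarith
  then show ?thesis
  proof cases
    case 1
    then show ?thesis using boundary_edge_vertex[OF assms(1) left_edge] by auto
  next
    case 2
    then show ?thesis using boundary_edge_vertex[OF assms(1) right_edge] X_m by auto
  next
    case 3
    then obtain l where l: "k = Suc l" by (cases k) auto
    have lm: "l < m" using 3 l by simp
    have x: "a < X k" "X k < b" using X_increasing[OF lm] X_ge_a[of l] X_less_b[OF 3(2)] l by (auto)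
    have c: "lo (X k - 1) = lo (X l)" "up (X k - 1) = up (X l)"
      using piece_const[OF lm, of "X k - 1"] X_increasing[OF lm] l by (auto)
    have "X k = pe lo (X l) \<or> X k = pe up (X l)" using X_Suc[OF lm] l by (auto simp: min_def)
    then have "lo (X k) \<noteq> lo (X k - 1) \<or> up (X k) \<noteq> up (X k - 1)"
      using plateau_end(3)[OF X_less_b[OF lm], where f = lo] plateau_end(3)[OF X_less_b[OF lm], where f = up] x c by auto
    then show ?thesis
      using boundary_edge_vertex[OF assms(1) top_step[OF x]] boundary_edge_vertex[OF assms(1) bottom_step[OF x]] by metis
  qed
qed

text \<open>The \<open>m + 1\<close> breakpoints have different abscissas, so the chosen vertices
  are different. The strict inequality later absorbs the additive constants of the running
  time.\<close>

lemma m_less_nv: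
  assumes "boundary_order J vs"
  shows "m < nv J"
proof -
  have "finite (vertices J)" using assms unfolding boundary_order_def by (metis List.finite_set)
  obtain y where y: "\<And>k. k \<le> m \<Longrightarrow> (of_int (X k), y k) \<in> vertices J"
    using breakpoint_vertex[OF assms] by metis
  have "inj_on (\<lambda>k. (of_int (X k) :: real, y k)) {..m}"
  proof (rule inj_onI)
    fix i j assume "i \<in> {..m}" "j \<in> {..m}" "(of_int (X i) :: real, y i) = (of_int (X j), y j)"
    then show "i = j" using X_strict[of i j] X_strict[of j i] by (cases i j rule: linorder_cases) auto
  qed
  moreover have "(\<lambda>k. (of_int (X k) :: real, y k)) ` {..m} \<subseteq> vertices J" using y by auto
  ultimately have "card {..m} \<le> card (vertices J)" using \<open>finite (vertices J)\<close> card_inj_on_le by blast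
  then show ?thesis by (simp add: nv_def)
qed

lemma chain_step:
  assumes "f = lo \<or> f = up" "a < x" "x < b" "f (x - 1) \<noteq> f x"
  shows "is_edge J (of_int x, of_int (f (x - 1))) (of_int x, of_int (f x))"
  using assms top_step bottom_step by auto

lemma chain_edge:
  assumes "f = lo \<or> f = up" "a \<le> x" "x < b" "x = a \<or> f (x - 1) \<noteq> f x"
  shows "is_edge J (of_int x, of_int (f x)) (of_int (pe f x), of_int (f x))"
  using assms(1)
proof
  assume f: "f = lo"
  note p = plateau_end[OF assms(3), where f = lo]
  show ?thesis unfolding f
  proof (rule bottom_edge)
    show "lo i = lo x" if "x \<le> i" "i < pe lo x" for i using that by (rule p(4))
  qed (use assms(2,4) p(1-3) f in auto)
next
  assume f: "f = up"
  note p = plateau_end[OF assms(3), where f = up]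
  show ?thesis unfolding f
  proof (rule top_edge)
    show "up i = up x" if "x \<le> i" "i < pe up x" for i using that by (rule p(4))
  qed (use assms(2,4) p(1-3) f in auto)
qed


end

section \<open>Walking along the stored boundary\<close>

locale stored_staircase = staircase_hole J a b lo up
  for J a b lo up +
  fixes vs :: "pt list" and ad :: "int list" and M0 :: "int \<Rightarrow> int" and F :: int
  assumes bo: "boundary_order J vs" and st: "stored_list M0 vs ad F"
begin

abbreviation "N \<equiv> neighbour (length vs)"

lemma node:
  assumes "i < length vs"
  shows "1 \<le> ad ! i" "ad ! i + 4 \<le> F" "(of_int (M0 (ad ! i)), of_int (M0 (ad ! i + 1))) = vs ! i"
    "d = 2 \<or> d = 3 \<Longrightarrow> M0 (ad ! i + d) = ad ! N d i"
  using assms st unfolding stored_list_def neighbour_def by auto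

lemma node_coordinates:
  assumes "i < length vs" "vs ! i = (of_int x, of_int y)"
  shows "M0 (ad ! i) = x" "M0 (ad ! i + 1) = y"
  using node(3)[OF assms(1)] assms(2) by auto

text \<open>A boundary edge leads to one of the two list neighbours; if it is not the backward one,
  it is the forward one. This makes the walk independent of the orientation of the list.\<close>

lemma walk:
  assumes "i < length vs" "is_edge J (vs ! i) z" "vs ! N (5 - d) i \<noteq> z" "d = 2 \<or> d = 3"
  shows "vs ! N d i = z"
  using boundary_edge_neighbour[OF bo assms(2,1)] assms(3,4) by auto

text \<open>\<open>A\<close> is the node at the right end of the edge of the chain \<open>f\<close> above or below \<open>x\<close>. That its
  neighbour against direction \<open>d\<close> lies on the same edge guarantees that \<open>d\<close> leads onwards.\<close>

definition at_chain :: "(int \<Rightarrow> int) \<Rightarrow> int \<Rightarrow> int \<Rightarrow> int \<Rightarrow> bool" where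
  "at_chain f d x A \<longleftrightarrow> (\<exists>i<length vs. A = ad ! i \<and> vs ! i = (of_int (pe f x), of_int (f x)) \<and>
     fst (vs ! N (5 - d) i) < of_int (pe f x) \<and> snd (vs ! N (5 - d) i) = of_int (f x))"

lemma at_chain_read:
  assumes "at_chain f d x A" "\<And>y. y < F \<Longrightarrow> M y = M0 y" "d = 2 \<or> d = 3"
  shows "M A = pe f x" "M (A + 1) = f x" "M (M (A + d) + d) = M0 (M0 (A + d) + d)"
proof -
  obtain i where i: "i < length vs" "A = ad ! i" "vs ! i = (of_int (pe f x), of_int (f x))"
    using assms(1) by (auto simp: at_chain_def)
  have "A + 4 \<le> F" using node(2)[OF i(1)] i(2) by simp
  then show "M A = pe f x" "M (A + 1) = f x" using node_coordinates[OF i(1,3)] assms(2) i(2) by auto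
  have "M (A + d) = ad ! N d i" using node(4)[OF i(1) assms(3)] assms(2)[of "A + d"] \<open>A + 4 \<le> F\<close> assms(3) i(2) by auto
  moreover have "ad ! N d i + 4 \<le> F" using node(2)[OF neighbour_less[OF i(1)]] .
  ultimately show "M (M (A + d) + d) = M0 (M0 (A + d) + d)"
    using assms(2)[of "ad ! N d i + d"] assms(3) node(4)[OF i(1) assms(3)] i(2) by auto
qed

lemma at_chain_next:
  assumes "at_chain f d x A" "\<And>y. y < F \<Longrightarrow> M y = M0 y" "d = 2 \<or> d = 3"
  shows "M (A + d) + 4 \<le> F"
proof -
  obtain i where i: "i < length vs" "A = ad ! i" using assms(1) by (auto simp: at_chain_def)
  have "M (A + d) = ad ! N d i"
    using node(4)[OF i(1) assms(3)] assms(2)[of "A + d"] node(2)[OF i(1)] assms(3) i(2) by auto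
  then show ?thesis using node(2)[OF neighbour_less[OF i(1)]] by simp
qed

text \<open>Against direction \<open>d\<close> lies the other end of the leftmost edge, so direction
  \<open>d\<close> must follow the first horizontal edge of the chain.\<close>

lemma at_chain_start:
  assumes f: "f = lo \<or> f = up" and d: "d = 2 \<or> d = 3" and i: "i < length vs" "vs ! i = (of_int a, of_int (f a))"
    and opp: "fst (vs ! N (5 - d) i) = of_int a"
  shows "at_chain f d a (M0 (ad ! i + d))"
proof -
  let ?z = "(of_int (pe f a), of_int (f a)) :: pt"
  have p: "a < pe f a" by (rule plateau_end(1)[OF ab])
  have e: "is_edge J (vs ! i) ?z" unfolding i(2) using chain_edge[OF f, of a] ab by simp
  have "vs ! N (5 - d) i \<noteq> ?z" using opp p by auto
  then have z: "vs ! N d i = ?z" using walk[OF i(1) e _ d] by blast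
  have "N (5 - d) (N d i) = i" by (rule neighbour_opposite[OF i(1) d])
  then show ?thesis unfolding at_chain_def using z i p node(4)[OF i(1) d] neighbour_less[OF i(1)]
    by (intro exI[of _ "N d i"]) auto
qed

text \<open>At a plateau end two links are followed: up or down the vertical step at
  \<open>x'\<close>, and along the next horizontal edge. In both cases the backward neighbour
  differs from the target, in height and in abscissa respectively, so \<open>walk\<close>
  applies.\<close>

lemma at_chain_advance:
  assumes f: "f = lo \<or> f = up" and d: "d = 2 \<or> d = 3" and x: "a \<le> x" "x < x'" "x' \<le> pe f x" "x' < b"
    and at: "at_chain f d x A"
  shows "at_chain f d x' (if x' < pe f x then A else M0 (M0 (A + d) + d))"
proof (cases "x' < pe f x")
  case True
  have "x < b" using x by simp
  then show ?thesis using plateau_end_same[of x b x' f] x True at by (simp add: at_chain_def)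
next
  case False
  then have x': "x' = pe f x" using x by simp
  have xb: "x < b" using x by simp
  have fx: "f (x' - 1) = f x" unfolding x' by (rule plateau_end(4)[OF xb]) (use x x' in auto)
  have ne: "f x' \<noteq> f x" using plateau_end(3)[OF xb, where f = f] x(4) x' by auto
  obtain i where i: "i < length vs" "A = ad ! i" "vs ! i = (of_int x', of_int (f x))"
    "snd (vs ! N (5 - d) i) = of_int (f x)"
    using at unfolding at_chain_def x'[symmetric] by blast
  let ?z = "(of_int x', of_int (f x')) :: pt" and ?z' = "(of_int (pe f x'), of_int (f x')) :: pt"
  have e: "is_edge J (vs ! i) ?z" unfolding i(3) using chain_step[OF f, of x'] x fx ne by simp
  have "vs ! N (5 - d) i \<noteq> ?z" using i(4) ne by auto
  then have z: "vs ! N d i = ?z" using walk[OF i(1) e _ d] by blast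
  define j where "j = N d i"
  have j: "j < length vs" "vs ! j = ?z" "N (5 - d) j = i" "M0 (A + d) = ad ! j"
    using neighbour_less[OF i(1)] z neighbour_opposite[OF i(1) d] node(4)[OF i(1) d] i(2) by (auto simp: j_def)
  have p: "x' < pe f x'" by (rule plateau_end(1)[OF x(4)])
  have e': "is_edge J (vs ! j) ?z'" unfolding j(2) using chain_edge[OF f, of x'] x fx ne by simp
  have "vs ! N (5 - d) j \<noteq> ?z'" unfolding j(3) i(3) using p by auto
  then have z': "vs ! N d j = ?z'" using walk[OF j(1) e' _ d] by blast
  have "M0 (M0 (A + d) + d) = ad ! N d j" using node(4)[OF j(1) d] j(4) by simp
  moreover have "N (5 - d) (N d j) = j" by (rule neighbour_opposite[OF j(1) d])
  ultimately show ?thesis unfolding at_chain_def using False z' j p neighbour_less[OF j(1)]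
    by (intro exI[of _ "N d j"]) auto
qed

end

text \<open>Registers 9 and 10 point into the upper and lower chain, 7 and 8 hold their directions,
  11 the current breakpoint, 12 the next record address and 14 the right end \<open>b\<close>. A
  chain advances only if its plateau ends at the new breakpoint; both advance if both do.\<close>

definition chains_body :: com where
  "chains_body =
    Seq (Store (Reg 12) (Reg 11))
    (Seq (Store (Plus (Reg 12) (Const 1)) (fld 10 1))
    (Seq (Store (Plus (Reg 12) (Const 2)) (Minus (Const 0) (fld 9 1)))
    (Seq (Assign 12 (Plus (Reg 12) (Const 5)))
    (Seq (Cond (Less (Mem (Reg 9)) (Mem (Reg 10))) (Assign 11 (Mem (Reg 9))) (Assign 11 (Mem (Reg 10))))
    (Seq (Cond (Less (Reg 11) (Mem (Reg 9))) Skip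
           (Assign 9 (Mem (Plus (Mem (Plus (Reg 9) (Reg 7))) (Reg 7)))))
         (Cond (Less (Reg 11) (Mem (Reg 10))) Skip
           (Assign 10 (Mem (Plus (Mem (Plus (Reg 10) (Reg 8))) (Reg 8))))))))))"

definition chains_loop :: com where
  "chains_loop = While (Less (Reg 11) (Reg 14)) chains_body"

text \<open>If the second end of the leftmost edge is the higher one, forward links lead along the
  upper chain and backward links along the lower one; otherwise the roles are exchanged.\<close>

definition chains_prog :: com where
  "chains_prog =
    Seq (Assign 6 (fld 0 2))
    (Seq (Cond (Less (fld 0 1) (fld 6 1))
       (Seq (Assign 7 (Const 2)) (Seq (Assign 8 (Const 3)) (Seq (Assign 9 (Reg 6)) (Assign 10 (Reg 0)))))
       (Seq (Assign 7 (Const 3)) (Seq (Assign 8 (Const 2)) (Seq (Assign 9 (Reg 0)) (Assign 10 (Reg 6))))))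
    (Seq (Assign 11 (Mem (Reg 9)))
    (Seq (Assign 12 (Reg 5))
    (Seq (Assign 14 (Mem (Reg 1)))
    (Seq (Assign 9 (Mem (Plus (Reg 9) (Reg 7))))
    (Seq (Assign 10 (Mem (Plus (Reg 10) (Reg 8))))
    (Seq chains_loop (Store (Reg 12) (Reg 11)))))))))"

context stored_staircase
begin

text \<open>Nothing is claimed about the chain pointers for \<open>k = m\<close>: the last iteration
  still moves them, past the right end.\<close>

definition chain_inv :: "int \<Rightarrow> int \<Rightarrow> int \<Rightarrow> nat \<Rightarrow> state \<Rightarrow> bool" where
  "chain_inv w h d k s \<longleftrightarrow> k \<le> m \<and> fst s 3 = w \<and> fst s 4 = h \<and> fst s 5 = F \<and> fst s 7 = d \<and> fst s 8 = 5 - d \<and>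
     fst s 11 = X k \<and> fst s 12 = F + 5 * int k \<and> fst s 14 = b \<and>
     (\<forall>y<F. snd s y = M0 y) \<and>
     (\<forall>j<k. snd s (F + 5 * int j) = X j \<and> snd s (F + 5 * int j + 1) = lo (X j) \<and>
        snd s (F + 5 * int j + 2) = - up (X j)) \<and>
     (k < m \<longrightarrow> at_chain up d (X k) (fst s 9) \<and> at_chain lo (5 - d) (X k) (fst s 10))"

lemma chains_loop_halts:
  assumes d: "d = 2 \<or> d = 3" and I0: "chain_inv w h d 0 s"
  shows "halts chains_loop s (\<lambda>t s'. t \<le> 70 * m + 10 \<and> chain_inv w h d m s')"
proof -
  have step: "halts chains_body s (\<lambda>t s'. \<exists>k'. chain_inv w h d k' s' \<and>
      bcost (Less (Reg 11) (Reg 14)) + 1 + t + 70 * (m - k') \<le> 70 * (m - k))"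
    if I: "chain_inv w h d k s" and bv: "bval (Less (Reg 11) (Reg 14)) s" for k s
  proof -
    obtain R M where s: "s = (R, M)" by (cases s)
    have "X k < b" using I bv by (simp add: chain_inv_def)
    then have km: "k < m" using I X_m by (cases "k = m") (auto simp: chain_inv_def)
    have R: "R 3 = w" "R 4 = h" "R 5 = F" "R 7 = d" "R 8 = 5 - d" "R 11 = X k" "R 12 = F + 5 * int k" "R 14 = b"
      and old: "\<And>y. y < F \<Longrightarrow> M y = M0 y"
      and rec: "\<And>j. j < k \<Longrightarrow> M (F + 5 * int j) = X j \<and> M (F + 5 * int j + 1) = lo (X j) \<and> M (F + 5 * int j + 2) = - up (X j)"
      and at: "at_chain up d (X k) (R 9)" "at_chain lo (5 - d) (X k) (R 10)"
      using I km unfolding chain_inv_def s by auto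
    have d': "5 - d = 2 \<or> 5 - d = 3" using d by auto
    have lt: "R 9 + 4 \<le> F" "R 10 + 4 \<le> F" using at node(2) by (auto simp: at_chain_def)
    define M' where "M' = M(F + 5 * int k := X k, F + 5 * int k + 1 := lo (X k), F + 5 * int k + 2 := - up (X k))"
    have old': "\<And>y. y < F \<Longrightarrow> M' y = M0 y" using old by (simp add: M'_def)
    note read = at_chain_read[OF at(1) old d] at_chain_read[OF at(2) old d']
    have rec': "M' (F + 5 * int j) = X j \<and> M' (F + 5 * int j + 1) = lo (X j) \<and> M' (F + 5 * int j + 2) = - up (X j)"
      if "j < Suc k" for j
    proof (cases "j = k")
      case False
      then have "j < k" using that by simp
      then have "F + 5 * int j + 5 \<le> F + 5 * int k" by simp
      then show ?thesis using rec[OF \<open>j < k\<close>] unfolding M'_def by simp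
    qed (simp add: M'_def)
    have xs: "X (Suc k) = min (pe lo (X k)) (pe up (X k))" by (rule X_Suc[OF km])
    define A9 where "A9 = (if X (Suc k) < pe up (X k) then R 9 else M0 (M0 (R 9 + d) + d))"
    define A10 where "A10 = (if X (Suc k) < pe lo (X k) then R 10 else M0 (M0 (R 10 + (5 - d)) + (5 - d)))"
    have at': "at_chain up d (X (Suc k)) A9 \<and> at_chain lo (5 - d) (X (Suc k)) A10" if "Suc k < m"
      unfolding A9_def A10_def
      using at_chain_advance[OF _ d X_ge_a X_increasing[OF km] _ X_less_b[OF that] at(1)]
        at_chain_advance[OF _ d' X_ge_a X_increasing[OF km] _ X_less_b[OF that] at(2)] xs by auto
    define R' where "R' = R(12 := F + 5 * int k + 5, 11 := X (Suc k), 9 := A9, 10 := A10)"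
    have I': "chain_inv w h d (Suc k) (R', M')"
      unfolding chain_inv_def using km R old' rec' at' by (auto simp: R'_def)
    have A: "M (R 9 + d) + 4 \<le> F" "M (R 10 + (5 - d)) + 4 \<le> F"
      using at_chain_next[OF at(1) old d] at_chain_next[OF at(2) old d'] by auto
    have ne: "y \<noteq> F + 5 * int k" "y \<noteq> F + 5 * int k + 1" "y \<noteq> F + 5 * int k + 2" if "y < F" for y
      using that by auto
    \<comment> \<open>All list cells read lie below \<open>F\<close>, hence none is affected by the
      three stores into the current record.\<close>
    have dF: "R 9 < F" "R 10 < F" "R 9 + 1 < F" "R 10 + 1 < F" "R 9 + d < F" "R 10 + (5 - d) < F"
      "M (R 9 + d) + d < F" "M (R 10 + (5 - d)) + (5 - d) < F" using lt A d by auto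
    note ne' = ne[OF dF(1)] ne[OF dF(2)] ne[OF dF(3)] ne[OF dF(4)] ne[OF dF(5)] ne[OF dF(6)] ne[OF dF(7)] ne[OF dF(8)]
    have "halts chains_body (R, M) (\<lambda>t s'. s' = (R', M') \<and> t \<le> 60)"
      using xs by (auto simp: chains_body_def halts_simps R read ne' M'_def R'_def A9_def A10_def min_def fun_upd_twist)
    then show ?thesis unfolding s by (rule halts_mono) (use I' km in \<open>auto intro!: exI[of _ "Suc k"]\<close>)
  qed
  obtain t s' k where "exec chains_loop s t s'" "chain_inv w h d k s'" "\<not> fst s' 11 < fst s' 14" "t \<le> 70 * m + 4"
    using halts_While[where I = "chain_inv w h d" and \<Phi> = "\<lambda>k. 70 * (m - k)", OF I0 step]
    unfolding chains_loop_def by (auto elim!: haltsE)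
  moreover from this have "k = m" using X_less_b[of k] by (cases "k < m") (auto simp: chain_inv_def)
  ultimately show ?thesis by (intro haltsI) auto
qed

lemma chains_prog_halts:
  assumes regs: "fst s 3 = w" "fst s 4 = h" "fst s 5 = F" "snd s = M0"
    and l: "i < length vs" "fst s 0 = ad ! i" "leftmost_edge J (vs ! i) (vs ! (Suc i mod length vs))"
    and r: "i' < length vs" "fst s 1 = ad ! i'" "rightmost_edge J (vs ! i') (vs ! (Suc i' mod length vs))"
  shows "halts chains_prog s (\<lambda>t s'. t \<le> 70 * m + 60 \<and>
     fst s' 3 = w \<and> fst s' 4 = h \<and> fst s' 5 = F \<and> fst s' 12 = F + 5 * int m \<and> fst s' 14 = X m \<and>
     (\<forall>k\<le>m. snd s' (F + 5 * int k) = X k) \<and>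
     (\<forall>k<m. snd s' (F + 5 * int k + 1) = lo (X k) \<and> snd s' (F + 5 * int k + 2) = - up (X k)))"
proof -
  define j where "j = N 2 i"
  have j: "j < length vs" "Suc i mod length vs = j" "M0 (ad ! i + 2) = ad ! j" "N 3 j = i"
    using neighbour_less[OF l(1), of 2] node(4)[OF l(1), of 2] neighbour_opposite[OF l(1), of 2] by (auto simp: j_def neighbour_def)
  have b: "M0 (ad ! i') = b"
  proof -
    have n: "N 2 i' < length vs" "Suc i' mod length vs = N 2 i'" using neighbour_less[OF r(1), of 2] by (auto simp: neighbour_def)
    show ?thesis using r(3) rightmost_edge_eq unfolding n(2) node(3)[OF r(1), symmetric] node(3)[OF n(1), symmetric] by blast
  qed
  define y1 y2 where "y1 = M0 (ad ! i + 1)" and "y2 = M0 (ad ! j + 1)"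
  have lm: "M0 (ad ! i) = a" "M0 (ad ! j) = a" "y1 = lo a \<and> y2 = up a \<or> y1 = up a \<and> y2 = lo a"
    using l(3) leftmost_edge_eq unfolding j(2) node(3)[OF l(1), symmetric] node(3)[OF j(1), symmetric] y1_def y2_def
    by blast+
  have v: "vs ! i = (of_int a, of_int y1)" "vs ! j = (of_int a, of_int y2)"
    using node(3)[OF l(1)] node(3)[OF j(1)] lm(1,2) by (simp_all add: y1_def y2_def)
  define dd where "dd = (if y1 < y2 then 2 else 3 :: int)"
  define s1 where "s1 = ((fst s)(6 := ad ! j, 7 := dd, 8 := 5 - dd, 11 := a, 12 := F, 14 := b,
      9 := M0 ((if y1 < y2 then ad ! j else ad ! i) + dd),
      10 := M0 ((if y1 < y2 then ad ! i else ad ! j) + (5 - dd))), M0)"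
  have lu: "lo a < up a" using lo_up ab by simp
  have "at_chain up dd a (fst s1 9) \<and> at_chain lo (5 - dd) a (fst s1 10)"
  proof (cases "y1 < y2")
    case True
    then have y: "y1 = lo a" "y2 = up a" using lm(3) lu by auto
    have "at_chain up 2 a (M0 (ad ! j + 2))" "at_chain lo 3 a (M0 (ad ! i + 3))"
      using at_chain_start[of up 2 j] at_chain_start[of lo 3 i] j l(1) v y by (auto simp: j_def[symmetric])
    then show ?thesis using True by (simp add: s1_def dd_def)
  next
    case False
    then have y: "y1 = up a" "y2 = lo a" using lm(3) lu by auto
    have "at_chain up 3 a (M0 (ad ! i + 3))" "at_chain lo 2 a (M0 (ad ! j + 2))"
      using at_chain_start[of up 3 i] at_chain_start[of lo 2 j] j l(1) v y by (auto simp: j_def[symmetric])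
    then show ?thesis using False by (simp add: s1_def dd_def)
  qed
  then have I0: "chain_inv w h dd 0 s1"
    using regs unfolding chain_inv_def by (simp add: s1_def)
  have "dd = 2 \<or> dd = 3" by (simp add: dd_def)
  note loop = chains_loop_halts[OF this I0]
  have fin: "halts chains_loop s1 (\<lambda>t s'. t + 50 \<le> 70 * m + 60 \<and> fst s' 3 = w \<and> fst s' 4 = h \<and> fst s' 5 = F \<and> fst s' 12 = F + 5 * int m \<and>
     fst s' 14 = X m \<and> fst s' 11 = X m \<and> (\<forall>k<m. snd s' (F + 5 * int k) = X k \<and>
     snd s' (F + 5 * int k + 1) = lo (X k) \<and> snd s' (F + 5 * int k + 2) = - up (X k)))"
    using loop by (rule halts_mono) (auto simp: chain_inv_def X_m)
  have ne5: "5 * int k + 1 \<noteq> 5 * int m" "5 * int k + 2 \<noteq> 5 * int m" for k by presburger+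
  show ?thesis
  proof (cases "y1 < y2")
    case True
    have "s1 = ((fst s)(6 := ad ! j, 7 := 2, 8 := 3, 9 := ad ! j, 10 := ad ! i, 11 := a, 12 := F, 14 := b,
        9 := M0 (ad ! j + 2), 10 := M0 (ad ! i + 3)), M0)"
      using True by (simp add: s1_def dd_def fun_eq_iff)
    with fin show ?thesis unfolding chains_prog_def using True
      by (simp add: halts_simps regs l r r(2)[unfolded One_nat_def] j lm b y1_def[symmetric] y2_def[symmetric])
        (erule halts_mono, auto simp: ne5)
  next
    case False
    have "s1 = ((fst s)(6 := ad ! j, 7 := 3, 8 := 2, 9 := ad ! i, 10 := ad ! j, 11 := a, 12 := F, 14 := b,
        9 := M0 (ad ! i + 3), 10 := M0 (ad ! j + 2)), M0)"
      using False by (simp add: s1_def dd_def fun_eq_iff)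
    with fin show ?thesis unfolding chains_prog_def using False
      by (simp add: halts_simps regs l r r(2)[unfolded One_nat_def] j lm b y1_def[symmetric] y2_def[symmetric])
        (erule halts_mono, auto simp: ne5)
  qed
qed

end

section \<open>The complete program\<close>

definition placement_prog :: com where
  "placement_prog = Seq chains_prog (Seq (next_greater_prog 1) (Seq (next_greater_prog 2) scan_prog))"

lemma (in stored_staircase) placement_prog_halts:
  assumes regs: "fst s 3 = w" "fst s 4 = h" "fst s 5 = F" "snd s = M0" and wh: "0 < w" "0 < h"
    and l: "i < length vs" "fst s 0 = ad ! i" "leftmost_edge J (vs ! i) (vs ! (Suc i mod length vs))"
    and r: "i' < length vs" "fst s 1 = ad ! i'" "rightmost_edge J (vs ! i') (vs ! (Suc i' mod length vs))"
  shows "halts placement_prog s (\<lambda>t s'. t \<le> 420 * nv J \<and>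
     output_set s' {p. BL_stable (J \<union> inside J) (of_int w) (of_int h) p})"
proof -
  define L U V where "L k = lo (X k)" and "U k = up (X k)" and "V k = - up (X k)" for k
  have nv: "m < nv J" by (rule m_less_nv[OF bo])
  interpret P: staircase_pieces m "\<lambda>k. of_int (X k)" "\<lambda>k. of_int (L k)" "\<lambda>k. of_int (U k)" "J \<union> inside J" "of_int w" "of_int h"
    by unfold_locales (use X_increasing hole_pieces wh in \<open>auto simp: L_def U_def\<close>)
  let ?S = "{(X k, y) | k y. k < m \<and> stable_pair X L U m w h k y}"
  have st: "P.stable_at k y \<longleftrightarrow> (\<exists>z. y = of_int z \<and> stable_pair X L U m w h k z)" for k y
  proof -
    have e: "of_int x + of_int z \<le> (of_int x' :: real) \<longleftrightarrow> x + z \<le> x'" "of_int x' < (of_int x + of_int z :: real) \<longleftrightarrow> x' < x + z"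
      for x x' z :: int by (metis of_int_add of_int_le_iff, metis of_int_add of_int_less_iff)
    have "P.stable_at k (of_int z) \<longleftrightarrow> stable_pair X L U m w h k z" for z
      unfolding P.stable_at_def stable_pair_def e of_int_le_iff of_int_less_iff of_int_eq_iff by auto
    \<comment> \<open>A stable ordinate equals some \<open>L j\<close> and is therefore
      integral.\<close>
    moreover have "\<exists>z. y = of_int z" if "P.stable_at k y" using that unfolding P.stable_at_def by metis
    ultimately show ?thesis by metis
  qed
  have set: "{p. BL_stable (J \<union> inside J) (of_int w) (of_int h) p} = (\<lambda>(x, y). (of_int x, of_int y)) ` ?S"
    unfolding P.BL_stable_set st by force
  obtain t1 s1 where e1: "exec chains_prog s t1 s1" and t1: "t1 \<le> 70 * m + 60"
    and r1: "fst s1 3 = w" "fst s1 4 = h" "fst s1 5 = F" "fst s1 12 = F + 5 * int m" "fst s1 14 = X m"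
    and m1: "\<forall>k\<le>m. snd s1 (F + 5 * int k) = X k"
      "\<forall>k<m. snd s1 (F + 5 * int k + 1) = L k \<and> snd s1 (F + 5 * int k + 2) = V k"
    using chains_prog_halts[OF regs l r] unfolding L_def V_def by (elim haltsE conjE)
  obtain t2 s2 where e2: "exec (next_greater_prog 1) s1 t2 s2" and t2: "t2 \<le> 70 * m + 20"
    and r2: "\<forall>r. r \<noteq> 15 \<and> r \<noteq> 16 \<longrightarrow> fst s2 r = fst s1 r"
    and m2: "\<forall>x. (\<forall>j<m. x \<noteq> F + 5 * int j + (1 + 2)) \<longrightarrow> snd s2 x = snd s1 x"
      "\<forall>j<m. snd s2 (F + 5 * int j + (1 + 2)) = F + 5 * int (next_greater L m j)"
    using next_greater_prog_halts[of s1 F m 1 L] r1 m1 by (auto elim!: haltsE)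
  \<comment> \<open>The five fields of a record have different offsets modulo 5, so writing one kind
    of field never overwrites another.\<close>
  have ne: "F + 5 * int k \<noteq> F + 5 * int j + (1 + 2)" "F + 5 * int k + 1 \<noteq> F + 5 * int j + (1 + 2)"
    "F + 5 * int k + 2 \<noteq> F + 5 * int j + (1 + 2)" "F + 5 * int k \<noteq> F + 5 * int j + (2 + 2)"
    "F + 5 * int k + 1 \<noteq> F + 5 * int j + (2 + 2)" "F + 5 * int k + 2 \<noteq> F + 5 * int j + (2 + 2)"
    "F + 5 * int k + (1 + 2) \<noteq> F + 5 * int j + (2 + 2)" for k j by presburger+
  have m2': "\<forall>k\<le>m. snd s2 (F + 5 * int k) = X k"
    "\<forall>k<m. snd s2 (F + 5 * int k + 1) = L k \<and> snd s2 (F + 5 * int k + 2) = V k"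
    using m1 m2 ne by auto
  obtain t3 s3 where e3: "exec (next_greater_prog 2) s2 t3 s3" and t3: "t3 \<le> 70 * m + 20"
    and r3: "\<forall>r. r \<noteq> 15 \<and> r \<noteq> 16 \<longrightarrow> fst s3 r = fst s2 r"
    and m3: "\<forall>x. (\<forall>j<m. x \<noteq> F + 5 * int j + (2 + 2)) \<longrightarrow> snd s3 x = snd s2 x"
      "\<forall>j<m. snd s3 (F + 5 * int j + (2 + 2)) = F + 5 * int (next_greater V m j)"
    using next_greater_prog_halts[of s2 F m 2 V] r1 r2 m2' by (auto elim!: haltsE)
  have m3': "\<And>k. k \<le> m \<Longrightarrow> snd s3 (F + 5 * int k) = X k"
    "\<And>k. k < m \<Longrightarrow> snd s3 (F + 5 * int k + 1) = L k" "\<And>k. k < m \<Longrightarrow> snd s3 (F + 5 * int k + 2) = - U k"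
    "\<And>k. k < m \<Longrightarrow> snd s3 (F + 5 * int k + 3) = F + 5 * int (next_greater L m k)"
    "\<And>k. k < m \<Longrightarrow> snd s3 (F + 5 * int k + 4) = F + 5 * int (next_greater (\<lambda>k. - U k) m k)"
    using m2 m2' m3 ne by (auto simp: V_def[abs_def] U_def)
  have r3': "fst s3 3 = w" "fst s3 4 = h" "fst s3 5 = F" "fst s3 12 = F + 5 * int m" "fst s3 14 = X m"
    using r1 r2 r3 by auto
  have "halts scan_prog s3 (\<lambda>t s'. t \<le> 210 * m + 40 \<and> (\<exists>ps. distinct ps \<and> set ps = ?S \<and> fst s' 1 = int (length ps) \<and>
     (\<forall>i<length ps. ps ! i = (snd s' (fst s' 0 + 2 * int i), snd s' (fst s' 0 + 2 * int i + 1)))))"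
    by (rule scan_prog_halts[where F = F]) (use r3' m3' X_increasing wh m_pos in auto)
  then obtain t4 s' ps where e4: "exec scan_prog s3 t4 s'" and t4: "t4 \<le> 210 * m + 40"
    and ps: "distinct ps" "set ps = ?S" "fst s' 1 = int (length ps)"
    "\<And>i. i < length ps \<Longrightarrow> ps ! i = (snd s' (fst s' 0 + 2 * int i), snd s' (fst s' 0 + 2 * int i + 1))"
    by (elim haltsE exE conjE) blast
  let ?g = "\<lambda>(x, y). (real_of_int x, real_of_int y)"
  have "inj_on ?g (set ps)" by (auto simp: inj_on_def)
  then have "distinct (map ?g ps)" using ps(1) by (simp add: distinct_map)
  moreover have "set (map ?g ps) = {p. BL_stable (J \<union> inside J) (of_int w) (of_int h) p}"
    unfolding set using ps(2) by simp
  ultimately have "output_set s' {p. BL_stable (J \<union> inside J) (of_int w) (of_int h) p}"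
    unfolding output_set_def using ps(3,4) by (intro exI[of _ "map ?g ps"]) auto
  \<comment> \<open>The bounds add up to \<open>420 * m + 140\<close>, which is below
    \<open>420 * (m + 1)\<close>.\<close>
  moreover have "t1 + (t2 + (t3 + t4)) \<le> 420 * nv J" using t1 t2 t3 t4 nv by linarith
  moreover have "exec placement_prog s (t1 + (t2 + (t3 + t4))) s'"
    unfolding placement_prog_def by (rule exec.Seq[OF e1 exec.Seq[OF e2 exec.Seq[OF e3 e4]]])
  ultimately show ?thesis by (intro haltsI conjI)
qed

theorem mainTheorem11:
  "\<exists>(prog :: com) (C :: nat).
     \<forall>(J :: pt set) (S :: pt set) (w :: int) (h :: int) (s :: state).
       nice_hole J S \<and> integral_vertices J \<and> 0 < w \<and> 0 < h \<and> placement_input J w h s \<longrightarrow>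
       (\<exists>t s'. exec prog s t s' \<and> t \<le> C * nv J \<and>
          output_set s' {p. BL_stable S (of_int w) (of_int h) p})"
proof (rule exI[of _ placement_prog], rule exI[of _ 420], intro allI impI)
  fix J S :: "pt set" and w h :: int and s :: state
  assume *: "nice_hole J S \<and> integral_vertices J \<and> 0 < w \<and> 0 < h \<and> placement_input J w h s"
  then have arc: "closed_rectilinear_arc J" and S: "S = J \<union> inside J"
    and nn: "\<nexists>a b. right_notch J a b" "\<nexists>a b. left_notch J a b"
    by (auto simp: nice_hole_def BLS_hole_def hole_def)
  obtain vs ad i i' where bo: "boundary_order J vs" and st: "stored_list (snd s) vs ad (fst s 5)"
    and l: "i < length vs" "fst s 0 = ad ! i" "leftmost_edge J (vs ! i) (vs ! (Suc i mod length vs))"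
    and r: "i' < length vs" "fst s 1 = ad ! i'" "rightmost_edge J (vs ! i') (vs ! (Suc i' mod length vs))"
    and wh: "fst s 3 = w" "fst s 4 = h"
    using * unfolding placement_input_def by blast
  have e: "is_edge J (vs ! i) (vs ! (Suc i mod length vs))"
    using l(3) by (simp add: leftmost_edge_def vertical_edge_def)
  have "grid_curve J" by (rule grid_curve_of_hole[OF arc bo _ e]) (use * in simp)
  then interpret grid_curve J .
  obtain a b lo up where stair: "a < b" "C = {(i, j). a \<le> i \<and> i < b \<and> lo i \<le> j \<and> j < up i}"
    "\<And>i. a \<le> i \<Longrightarrow> i < b \<Longrightarrow> lo i < up i"
    "\<And>i. a < i \<Longrightarrow> i < b \<Longrightarrow> lo i < up (i - 1) \<and> lo (i - 1) < up i"
    by (rule staircase_columns[OF nn]) blast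
  interpret stored_staircase J a b lo up vs ad "snd s" "fst s 5"
    by unfold_locales (use stair bo st in simp_all)
  have "halts placement_prog s (\<lambda>t s'. t \<le> 420 * nv J \<and>
     output_set s' {p. BL_stable (J \<union> inside J) (of_int w) (of_int h) p})"
    by (rule placement_prog_halts[OF wh refl refl _ _ l r]) (use * in simp_all)
  then show "\<exists>t s'. exec placement_prog s t s' \<and> t \<le> 420 * nv J \<and>
          output_set s' {p. BL_stable S (of_int w) (of_int h) p}"
    unfolding halts_def S .
qed

end
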